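(* The operators $e_i,f_i,k_i,k_i^{-1}$ ($i\in I^+$) on $\mathcal X$ satisfy all defining relations of $U_q(\mathfrak{sp}_{2n})$ (listed in the context) with $E_i,F_i,K_i,K_i^{-1}$ replaced by $e_i,f_i,k_i,k_i^{-1}$. Consequently there is a unique surjective algebra homomorphism $\Psi:U_q(\mathfrak{sp}_{2n})\to U_q^{2n}$ with $E_i\mapsto e_i$, $F_i\mapsto f_i$, $K_i^{\pm1}\mapsto k_i^{\pm1}$, where $U_q^{2n}$ is the subalgebra of $\operatorname{End}_{\mathbf{k}}(\mathcal X)$ generated by $e_i,f_i,k_i,k_i^{-1}$ ($i\in I^+$).
   Context: Let $\mathbf{k}$ be a field of characteristic $0$, $q\in\mathbf{k}$ invertible and not a root of unity, $n\ge 2$, $I=\{-n,\dots,-1,1,\dots,n\}$, $I^+=\{1,\dots,n\}$, $\lambda=q-q^{-1}$, $[m]_q=\frac{q^m-q^{-m}}{q-q^{-1}}$, $[m]_q!=[1]_q\cdots[m]_q$, $\left[{m\atop k}\right]_q=\frac{[m]_q\cdots[m-k+1]_q}{[1]_q\cdots[k]_q}$ ($k>0$), $=1$ ($k=0$); $[A,B]=AB-BA$. The quantum symplectic space $\mathcal X$ is the $\mathbf{k}$-algebra generated by $x_i$ ($i\in I$) with relations $x_jx_i=qx_ix_j$ for $i<j$, $j\neq-i$, and $x_ix_{-i}=q^2x_{-i}x_i+q^2\lambda\Omega_{i+1}$ ($i\in I^+$), where $\Omega_i=\sum_{j=i}^nq^{j-i}x_{-j}x_j$ and $\Omega_{n+1}=0$.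 Normal monomials $x^a=x_{-n}^{a_{-n}}\cdots x_{-1}^{a_{-1}}x_1^{a_1}\cdots x_n^{a_n}$, $a\in\mathbb{N}_0^{I}$, form a basis; $\varepsilon_i$ is the $i$-th unit vector. Linear operators on $\mathcal X$: $\partial_i.x^a=[a_i]_qx^{a-\varepsilon_i}$ (zero if $a_i=0$), $x_{i_L}.f=x_if$, $x_{i_R}.f=fx_i$, $\mu_i^{\pm1}.x^a=q^{\pm a_i}x^a$; products are compositions. For $i\in I^+$, $\tau_i=\prod_{j=i}^n\mu_j$, $\tau_{-i}=\prod_{j=-n}^{-i}\mu_j$, $\tau_{n+1}=\tau_{-n-1}=1$. Define $e_1=[2]_q^{-1}q^{-1}\mu_1^{-1}(\tau_{-2}^{-1}x_{-1_L}+q^2\tau_2^{-1}x_{-1_R})\partial_1$, $f_1=[2]_q^{-1}q^{-1}\mu_{-1}^{-1}(\tau_2^{-1}x_{1_R}+q^2\tau_{-2}^{-1}x_{1_L})\partial_{-1}$, $k_1=\mu_{-1}^2\mu_1^{-2}$, and for $2\le i\le n$: $e_i=\mu_{i-1}\mu_i^{-1}\tau_{-i-1}^{-1}x_{-i_L}\partial_{1-i}-\tau_i^{-1}x_{i-1_R}\partial_i$, $f_i=-\mu_{1-i}\mu_{-i}^{-1}\tau_{i+1}^{-1}x_{i_R}\partial_{i-1}+\tau_{-i}^{-1}x_{1-i_L}\partial_{-i}$, $k_i=\mu_{-i}\mu_{1-i}^{-1}\mu_{i-1}\mu_i^{-1}$. $U_q(\mathfrak{sp}_{2n})$ is the algebra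 generated by $E_i,F_i,K_i,K_i^{-1}$ ($i\in I^+$) with relations $K_iK_j=K_jK_i$, $K_iK_i^{-1}=K_i^{-1}K_i=1$, $K_iE_jK_i^{-1}=q_i^{a_{ij}}E_j$, $K_iF_jK_i^{-1}=q_i^{-a_{ij}}F_j$, $[E_i,F_j]=\delta_{ij}\frac{K_i-K_i^{-1}}{q_i-q_i^{-1}}$, and for $i\neq j$: $\sum_{t=0}^{1-a_{ij}}(-1)^t\left[{1-a_{ij}\atop t}\right]_{q_i}E_i^tE_jE_i^{1-a_{ij}-t}=0$ and the same with $F$ in place of $E$. Here $q_1=q^2$, $q_i=q$ for $i>1$, and the Cartan matrix is $a_{ii}=2$, $a_{12}=-1$, $a_{21}=-2$, $a_{i,i+1}=a_{i+1,i}=-1$ for $2\le i\le n-1$, and $a_{ij}=0$ if $|i-j|>1$ (simple roots $\alpha_1=2\epsilon_1$, $\alpha_i=\epsilon_i-\epsilon_{i-1}$ for $i\ge2$). *)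

theory Defs
  imports Main "HOL-Library.FuncSet"
begin

definition qnum :: "'k::field \<Rightarrow> nat \<Rightarrow> 'k" where
  "qnum q m = (q ^ m - inverse q ^ m) / (q - inverse q)"

definition qbinom :: "'k::field \<Rightarrow> nat \<Rightarrow> nat \<Rightarrow> 'k" where
  "qbinom q m k = (\<Prod>j<k. qnum q (m - j)) / (\<Prod>j\<in>{1..k}. qnum q j)"

definition qi :: "'k::field \<Rightarrow> nat \<Rightarrow> 'k" where
  "qi q i = (if i = 1 then q ^ 2 else q)"

(* Cartan matrix of type C_n (indices 1..n) *)
definition cartan :: "nat \<Rightarrow> nat \<Rightarrow> int" where
  "cartan i j = (if i = j then 2 else if i = 2 \<and> j = 1 then -2
                 else if j = i + 1 \<or> i = j + 1 then -1 else 0)"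

definition uq_rels ::
  "nat \<Rightarrow> 'k::field \<Rightarrow> ('b \<Rightarrow> 'b \<Rightarrow> 'b) \<Rightarrow> ('b \<Rightarrow> 'b \<Rightarrow> 'b) \<Rightarrow> ('k \<Rightarrow> 'b \<Rightarrow> 'b) \<Rightarrow> 'b
   \<Rightarrow> (nat \<Rightarrow> 'b) \<Rightarrow> (nat \<Rightarrow> 'b) \<Rightarrow> (nat \<Rightarrow> 'b) \<Rightarrow> (nat \<Rightarrow> 'b) \<Rightarrow> ('b \<times> 'b) set" where
  "uq_rels n q add mul sc one E F K Ki =
    (let zero = sc 0 one;
         sub = (\<lambda>a b. add a (sc (-1) b));
         pw = (\<lambda>a t. (mul a ^^ t) one);
         serre = (\<lambda>X i j. let m = nat (1 - cartan i j) in
                   foldr add (map (\<lambda>t. sc ((-1) ^ t * qbinom (qi q i) m t)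
                                     (mul (mul (pw (X i) t) (X j)) (pw (X i) (m - t)))) [0..<m+1]) zero)
     in {(mul (K i) (K j), mul (K j) (K i)) | i j. i \<in> {1..n} \<and> j \<in> {1..n}}
      \<union> {(mul (K i) (Ki i), one) | i. i \<in> {1..n}}
      \<union> {(mul (Ki i) (K i), one) | i. i \<in> {1..n}}
      \<union> {(mul (mul (K i) (E j)) (Ki i), sc (qi q i powi cartan i j) (E j)) | i j. i \<in> {1..n} \<and> j \<in> {1..n}}
      \<union> {(mul (mul (K i) (F j)) (Ki i), sc (qi q i powi (- cartan i j)) (F j)) | i j. i \<in> {1..n} \<and> j \<in> {1..n}}
      \<union> {(sub (mul (E i) (F j)) (mul (F j) (E i)),
          if i = j then sc (inverse (qi q i - inverse (qi q i))) (sub (K i) (Ki i)) else zero)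
         | i j. i \<in> {1..n} \<and> j \<in> {1..n}}
      \<union> {(serre E i j, zero) | i j. i \<in> {1..n} \<and> j \<in> {1..n} \<and> i \<noteq> j}
      \<union> {(serre F i j, zero) | i j. i \<in> {1..n} \<and> j \<in> {1..n} \<and> i \<noteq> j})"

datatype gen = GE nat | GF nat | GK nat | GKi nat

fun gidx :: "gen \<Rightarrow> nat" where
  "gidx (GE i) = i" | "gidx (GF i) = i" | "gidx (GK i) = i" | "gidx (GKi i) = i"

definition free_alg :: "nat \<Rightarrow> (gen list \<Rightarrow> 'k::field) set" where
  "free_alg n = {p. finite {w. p w \<noteq> 0} \<and> (\<forall>w. p w \<noteq> 0 \<longrightarrow> (\<forall>g\<in>set w. gidx g \<in> {1..n}))}"

definition fadd :: "(gen list \<Rightarrow> 'k::field) \<Rightarrow> (gen list \<Rightarrow> 'k) \<Rightarrow> (gen list \<Rightarrow> 'k)" where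
  "fadd p r = (\<lambda>w. p w + r w)"

definition fsc :: "'k::field \<Rightarrow> (gen list \<Rightarrow> 'k) \<Rightarrow> (gen list \<Rightarrow> 'k)" where
  "fsc c p = (\<lambda>w. c * p w)"

definition fmul :: "(gen list \<Rightarrow> 'k::field) \<Rightarrow> (gen list \<Rightarrow> 'k) \<Rightarrow> (gen list \<Rightarrow> 'k)" where
  "fmul p r = (\<lambda>w. \<Sum>k\<in>{0..length w}. p (take k w) * r (drop k w))"

definition fone :: "gen list \<Rightarrow> 'k::field" where
  "fone = (\<lambda>w. if w = [] then 1 else 0)"

definition fgen :: "gen \<Rightarrow> gen list \<Rightarrow> 'k::field" where
  "fgen g = (\<lambda>w. if w = [g] then 1 else 0)"

definition uq_relators :: "nat \<Rightarrow> 'k::field \<Rightarrow> (gen list \<Rightarrow> 'k) set" where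
  "uq_relators n q = {fadd l (fsc (-1) r) | l r.
     (l, r) \<in> uq_rels n q fadd fmul fsc fone (\<lambda>i. fgen (GE i)) (\<lambda>i. fgen (GF i))
                  (\<lambda>i. fgen (GK i)) (\<lambda>i. fgen (GKi i))}"

inductive_set uq_ideal :: "nat \<Rightarrow> 'k::field \<Rightarrow> (gen list \<Rightarrow> 'k) set" for n q where
  rel: "p \<in> uq_relators n q \<Longrightarrow> p \<in> uq_ideal n q"
| zero: "(\<lambda>w. 0) \<in> uq_ideal n q"
| add: "p \<in> uq_ideal n q \<Longrightarrow> r \<in> uq_ideal n q \<Longrightarrow> fadd p r \<in> uq_ideal n q"
| sc: "p \<in> uq_ideal n q \<Longrightarrow> fsc c p \<in> uq_ideal n q"
| lmul: "u \<in> free_alg n \<Longrightarrow> p \<in> uq_ideal n q \<Longrightarrow> fmul u p \<in> uq_ideal n q"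
| rmul: "u \<in> free_alg n \<Longrightarrow> p \<in> uq_ideal n q \<Longrightarrow> fmul p u \<in> uq_ideal n q"

definition uq_equiv :: "nat \<Rightarrow> 'k::field \<Rightarrow> ((gen list \<Rightarrow> 'k) \<times> (gen list \<Rightarrow> 'k)) set" where
  "uq_equiv n q = {(p, r). p \<in> free_alg n \<and> r \<in> free_alg n \<and> fadd p (fsc (-1) r) \<in> uq_ideal n q}"

definition Uq :: "nat \<Rightarrow> 'k::field \<Rightarrow> (gen list \<Rightarrow> 'k) set set" where
  "Uq n q = free_alg n // uq_equiv n q"

definition uq_cls :: "nat \<Rightarrow> 'k::field \<Rightarrow> (gen list \<Rightarrow> 'k) \<Rightarrow> (gen list \<Rightarrow> 'k) set" where
  "uq_cls n q p = uq_equiv n q `` {p}"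

definition uq_rep :: "'x set \<Rightarrow> 'x" where
  "uq_rep X = (SOME p. p \<in> X)"

definition uq_add where "uq_add n q X Y = uq_cls n q (fadd (uq_rep X) (uq_rep Y))"
definition uq_mul where "uq_mul n q X Y = uq_cls n q (fmul (uq_rep X) (uq_rep Y))"
definition uq_sc where "uq_sc n q c X = uq_cls n q (fsc c (uq_rep X))"
definition uq_one where "uq_one n q = uq_cls n q fone"

section \<open>The quantum symplectic space, presented through an algebra with a normal monomial basis\<close>

definition Iset :: "nat \<Rightarrow> int set" where
  "Iset n = {- int n..-1} \<union> {1..int n}"

definition expos :: "nat \<Rightarrow> (int \<Rightarrow> nat) set" where
  "expos n = {a. \<forall>i. i \<notin> Iset n \<longrightarrow> a i = 0}"

definition coefs :: "nat \<Rightarrow> ((int \<Rightarrow> nat) \<Rightarrow> 'k::zero) set" where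
  "coefs n = {c. finite {a. c a \<noteq> 0} \<and> (\<forall>a. c a \<noteq> 0 \<longrightarrow> a \<in> expos n)}"

definition opadd :: "('a \<Rightarrow> 'a::ring_1) \<Rightarrow> ('a \<Rightarrow> 'a) \<Rightarrow> ('a \<Rightarrow> 'a)" where
  "opadd f g = (\<lambda>v. f v + g v)"

context
  fixes n :: nat and q :: "'k::field" and \<phi> :: "'k \<Rightarrow> 'a::ring_1" and x :: "int \<Rightarrow> 'a"
begin

definition opsc :: "'k \<Rightarrow> ('a \<Rightarrow> 'a) \<Rightarrow> ('a \<Rightarrow> 'a)" where
  "opsc c f = (\<lambda>v. \<phi> c * f v)"

definition nmono :: "(int \<Rightarrow> nat) \<Rightarrow> 'a" where
  "nmono a = prod_list (map (\<lambda>i. x i ^ a i) ([- int n..-1] @ [1..int n]))"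

definition lincomb :: "((int \<Rightarrow> nat) \<Rightarrow> 'k) \<Rightarrow> 'a" where
  "lincomb c = (\<Sum>a\<in>{a. c a \<noteq> 0}. \<phi> (c a) * nmono a)"

definition normal_basis :: bool where
  "normal_basis = (\<forall>v. \<exists>!c. c \<in> coefs n \<and> v = lincomb c)"

definition coord :: "'a \<Rightarrow> (int \<Rightarrow> nat) \<Rightarrow> 'k" where
  "coord v = (THE c. c \<in> coefs n \<and> v = lincomb c)"

definition Omega :: "int \<Rightarrow> 'a" where
  "Omega i = (\<Sum>j\<in>{i..int n}. \<phi> (q ^ nat (j - i)) * x (- j) * x j)"

definition basis_op :: "((int \<Rightarrow> nat) \<Rightarrow> 'a) \<Rightarrow> 'a \<Rightarrow> 'a" where
  "basis_op h v = (\<Sum>a\<in>{a. coord v a \<noteq> 0}. \<phi> (coord v a) * h a)"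

definition der :: "int \<Rightarrow> 'a \<Rightarrow> 'a" where
  "der i = basis_op (\<lambda>a. if a i = 0 then 0 else \<phi> (qnum q (a i)) * nmono (a(i := a i - 1)))"

definition mu :: "int \<Rightarrow> 'a \<Rightarrow> 'a" where
  "mu i = basis_op (\<lambda>a. \<phi> (q ^ a i) * nmono a)"

definition mu_inv :: "int \<Rightarrow> 'a \<Rightarrow> 'a" where
  "mu_inv i = basis_op (\<lambda>a. \<phi> (inverse q ^ a i) * nmono a)"

definition xL :: "int \<Rightarrow> 'a \<Rightarrow> 'a" where "xL i = (\<lambda>v. x i * v)"
definition xR :: "int \<Rightarrow> 'a \<Rightarrow> 'a" where "xR i = (\<lambda>v. v * x i)"

definition tau_inv :: "int \<Rightarrow> 'a \<Rightarrow> 'a" where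
  "tau_inv i = foldr (\<circ>) (map mu_inv (if i > 0 then [i..int n] else [- int n..i])) id"

definition e_op :: "nat \<Rightarrow> 'a \<Rightarrow> 'a" where
  "e_op i = (if i = 1 then
      opsc (inverse (qnum q 2) * inverse q)
        (mu_inv 1 \<circ> opadd (tau_inv (-2) \<circ> xL (-1)) (opsc (q ^ 2) (tau_inv 2 \<circ> xR (-1))) \<circ> der 1)
    else let j = int i in
      opadd (mu (j - 1) \<circ> mu_inv j \<circ> tau_inv (- j - 1) \<circ> xL (- j) \<circ> der (1 - j))
            (opsc (-1) (tau_inv j \<circ> xR (j - 1) \<circ> der j)))"

definition f_op :: "nat \<Rightarrow> 'a \<Rightarrow> 'a" where
  "f_op i = (if i = 1 then
      opsc (inverse (qnum q 2) * inverse q)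
        (mu_inv (-1) \<circ> opadd (tau_inv 2 \<circ> xR 1) (opsc (q ^ 2) (tau_inv (-2) \<circ> xL 1)) \<circ> der (-1))
    else let j = int i in
      opadd (opsc (-1) (mu (1 - j) \<circ> mu_inv (- j) \<circ> tau_inv (j + 1) \<circ> xR j \<circ> der (j - 1)))
            (tau_inv (- j) \<circ> xL (1 - j) \<circ> der (- j)))"

definition k_op :: "nat \<Rightarrow> 'a \<Rightarrow> 'a" where
  "k_op i = (if i = 1 then mu (-1) \<circ> mu (-1) \<circ> mu_inv 1 \<circ> mu_inv 1
    else let j = int i in mu (- j) \<circ> mu_inv (1 - j) \<circ> mu (j - 1) \<circ> mu_inv j)"

definition kinv_op :: "nat \<Rightarrow> 'a \<Rightarrow> 'a" where
  "kinv_op i = (if i = 1 then mu_inv (-1) \<circ> mu_inv (-1) \<circ> mu 1 \<circ> mu 1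
    else let j = int i in mu_inv (- j) \<circ> mu (1 - j) \<circ> mu_inv (j - 1) \<circ> mu j)"

inductive_set Ug :: "('a \<Rightarrow> 'a) set" where
  ge: "i \<in> {1..n} \<Longrightarrow> e_op i \<in> Ug"
| gf: "i \<in> {1..n} \<Longrightarrow> f_op i \<in> Ug"
| gk: "i \<in> {1..n} \<Longrightarrow> k_op i \<in> Ug"
| gki: "i \<in> {1..n} \<Longrightarrow> kinv_op i \<in> Ug"
| one: "id \<in> Ug"
| add: "f \<in> Ug \<Longrightarrow> g \<in> Ug \<Longrightarrow> opadd f g \<in> Ug"
| mul: "f \<in> Ug \<Longrightarrow> g \<in> Ug \<Longrightarrow> f \<circ> g \<in> Ug"
| sc: "f \<in> Ug \<Longrightarrow> opsc c f \<in> Ug"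

definition uq_hom :: "((gen list \<Rightarrow> 'k) set \<Rightarrow> ('a \<Rightarrow> 'a)) \<Rightarrow> bool" where
  "uq_hom \<Psi> =
    ((\<forall>X\<in>Uq n q. \<forall>Y\<in>Uq n q. \<Psi> (uq_add n q X Y) = opadd (\<Psi> X) (\<Psi> Y)
                          \<and> \<Psi> (uq_mul n q X Y) = \<Psi> X \<circ> \<Psi> Y)
     \<and> (\<forall>c. \<forall>X\<in>Uq n q. \<Psi> (uq_sc n q c X) = opsc c (\<Psi> X))
     \<and> \<Psi> (uq_one n q) = id)"

end

end

(* The relations of the quantum symplectic space let one write e_i, f_i as explicit operators on
   normal monomials: for i > 1 they are sums of two terms, each a product of operators affecting
   a single exponent, and e_1, f_1 have the shape A + B S, where S is the operator inserting
   Omega_2 between the negative and the positive half of a monomial.  Flipping the sign of all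
   indices exchanges e_i with f_i (up to sign for i > 1).  Operators acting on disjoint sets of
   exponents commute, and S is built from its two innermost indices and the analogous operator
   on the remaining ones, so every commutator [e_i, f_j] reduces to an identity in at most six
   exponents.

   The Serre relations need no computation with monomials.  The t-fold quantum adjoint power U_t
   of f_i on f_j satisfies [e_i, U_t] = c_t U_(t-1) k_i^(-1) with c_t nonzero for t > 1 - a_ij.
   As f_i and f_j preserve the degree and lower another grading, U_t vanishes on monomials of
   bounded degree for large t, hence by descent already for t = 1 - a_ij. *)

theory Submission
  imports Defs Complex_Main
begin

section \<open>The free algebra and its quotient\<close>

text \<open>The element Omega enters only through e_1 and f_1: one of the two multiplications in
  each of them drives x(-1) past x(1), and every such passage leaves an Omega_2, which involves all
  remaining indices. S is therefore treated as a block. It commutes with whatever acts on the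
  indices 1 and -1 alone, and with each root operator whose two index pairs both occur in it, since
  Omega is invariant under those. The block has to be opened only for e_1 against f_2 and f_1
  against e_2, where letters move between the pairs 1 and 2: there A does not commute, and the
  leading pair of S makes up for it. The constant c_t is -[t][t + a_ij - 1] in q_i-integers. Its
  second factor vanishes at t = 1 - a_ij and for no other t, so the descent reaches precisely the
  Serre exponent and stops there. The descent needs a starting point, and only a bound on the degree
  supplies one; hence it runs on each homogeneous component separately, each being stable under all
  generators.\<close>

lemma free_alg_finite: "p \<in> free_alg n \<Longrightarrow> finite {w. p w \<noteq> 0}"
  by (simp add: free_alg_def)

lemma free_alg_gidx: "p \<in> free_alg n \<Longrightarrow> p w \<noteq> 0 \<Longrightarrow> g \<in> set w \<Longrightarrow> gidx g \<in> {1..n}"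
  by (simp add: free_alg_def)

lemma fadd_free: "p \<in> free_alg n \<Longrightarrow> r \<in> free_alg n \<Longrightarrow> fadd p r \<in> free_alg n"
proof -
  assume a: "p \<in> free_alg n" "r \<in> free_alg n"
  have "{w. fadd p r w \<noteq> 0} \<subseteq> {w. p w \<noteq> 0} \<union> {w. r w \<noteq> 0}" by (auto simp: fadd_def)
  from finite_subset[OF this] this a show ?thesis by (fastforce simp: free_alg_def)
qed

lemma fsc_free: "p \<in> free_alg n \<Longrightarrow> fsc c p \<in> free_alg n"
proof -
  assume a: "p \<in> free_alg n"
  have "{w. fsc c p w \<noteq> 0} \<subseteq> {w. p w \<noteq> 0}" by (auto simp: fsc_def)
  from finite_subset[OF this] this a show ?thesis by (fastforce simp: free_alg_def)
qed

lemma fone_free: "fone \<in> free_alg n"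
  by (simp add: free_alg_def fone_def)

lemma fgen_free: "gidx g \<in> {1..n} \<Longrightarrow> fgen g \<in> free_alg n"
  by (simp add: free_alg_def fgen_def)

lemma zero_free: "(\<lambda>w. 0) \<in> free_alg n"
  by (simp add: free_alg_def)

lemma fmul_supp: "{w. fmul p r w \<noteq> 0} \<subseteq> (\<lambda>(u, v). u @ v) ` ({w. p w \<noteq> 0} \<times> {w. r w \<noteq> 0})"
proof safe
  fix w assume "fmul p r w \<noteq> 0"
  then obtain k where "p (take k w) * r (drop k w) \<noteq> 0"
    unfolding fmul_def by (meson sum.neutral)
  then show "w \<in> (\<lambda>(u, v). u @ v) ` ({w. p w \<noteq> 0} \<times> {w. r w \<noteq> 0})"
    by (intro image_eqI[of _ _ "(take k w, drop k w)"]) auto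
qed

lemma fmul_free: "p \<in> free_alg n \<Longrightarrow> r \<in> free_alg n \<Longrightarrow> fmul p r \<in> free_alg n"
proof -
  assume a: "p \<in> free_alg n" "r \<in> free_alg n"
  have "finite {w. fmul p r w \<noteq> 0}"
    by (rule finite_subset[OF fmul_supp]) (use a in \<open>auto simp: free_alg_finite\<close>)
  moreover have "gidx g \<in> {1..n}" if "fmul p r w \<noteq> 0" "g \<in> set w" for w g
  proof -
    have "w \<in> (\<lambda>(u, v). u @ v) ` ({w. p w \<noteq> 0} \<times> {w. r w \<noteq> 0})"
      using that(1) by (intro subsetD[OF fmul_supp]) simp
    then obtain u v where w: "w = u @ v" "p u \<noteq> 0" "r v \<noteq> 0" by auto
    show ?thesis
      using that(2) free_alg_gidx[OF a(1) w(2), of g] free_alg_gidx[OF a(2) w(3), of g]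
      unfolding w(1) set_append by (elim UnE)
  qed
  ultimately show ?thesis unfolding free_alg_def by blast
qed

text \<open>A word with a cut is a pair of words: (u, v) goes to (u @ v, length u) injectively, so
  the double sum is a reindexing. A word of the product set may have further cuts whose pieces leave
  the supports; there \<open>h\<close> vanishes.\<close>

lemma fmul_sum_words:
  fixes h :: "gen list \<Rightarrow> gen list \<Rightarrow> 'b::comm_monoid_add" and p r :: "gen list \<Rightarrow> 'k::field"
  assumes "finite A" "finite B" "{w. p w \<noteq> 0} \<subseteq> A" "{w. r w \<noteq> 0} \<subseteq> B"
    and h: "\<And>u v. p u = 0 \<or> r v = 0 \<Longrightarrow> h u v = 0"
  shows "(\<Sum>w\<in>(\<lambda>(u, v). u @ v) ` (A \<times> B). \<Sum>k\<in>{0..length w}. h (take k w) (drop k w))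
    = (\<Sum>u\<in>A. \<Sum>v\<in>B. h u v)"
proof -
  let ?C = "(\<lambda>(u, v). u @ v) ` (A \<times> B)"
  have "(\<Sum>w\<in>?C. \<Sum>k\<in>{0..length w}. h (take k w) (drop k w))
    = (\<Sum>(w, k)\<in>Sigma ?C (\<lambda>w. {0..length w}). h (take k w) (drop k w))"
    using assms by (subst sum.Sigma) auto
  also have "\<dots> = (\<Sum>(w, k)\<in>(\<lambda>(u, v). (u @ v, length u)) ` (A \<times> B). h (take k w) (drop k w))"
  proof (rule sum.mono_neutral_right)
    show "finite (Sigma ?C (\<lambda>w. {0..length w}))" using assms by auto
    show "(\<lambda>(u, v). (u @ v, length u)) ` (A \<times> B) \<subseteq> Sigma ?C (\<lambda>w. {0..length w})" by auto
    show "\<forall>i\<in>Sigma ?C (\<lambda>w. {0..length w}) - (\<lambda>(u, v). (u @ v, length u)) ` (A \<times> B).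
      (case i of (w, k) \<Rightarrow> h (take k w) (drop k w)) = 0"
    proof (clarify, rule ccontr)
      fix w k assume w: "k \<in> {0..length w}" "(w, k) \<notin> (\<lambda>(u, v). (u @ v, length u)) ` (A \<times> B)"
        and "h (take k w) (drop k w) \<noteq> 0"
      then have "take k w \<in> A" "drop k w \<in> B" using h assms(3,4) by blast+
      then have "(take k w @ drop k w, length (take k w)) \<in> (\<lambda>(u, v). (u @ v, length u)) ` (A \<times> B)"
        by (intro image_eqI[of _ _ "(take k w, drop k w)"]) auto
      then show False using w by (auto simp: min_def split: if_splits)
    qed
  qed
  also have "\<dots> = (\<Sum>(u, v)\<in>A \<times> B. h u v)"
    by (subst sum.reindex) (auto simp: inj_on_def intro!: sum.cong)
  also have "\<dots> = (\<Sum>u\<in>A. \<Sum>v\<in>B. h u v)"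
    by (simp add: sum.cartesian_product)
  finally show ?thesis .
qed

section \<open>Words as a basis of the free algebra\<close>

definition fword :: "gen list \<Rightarrow> gen list \<Rightarrow> 'k::field" where
  "fword w = (\<lambda>u. if u = w then 1 else 0)"

lemma fword_Nil: "fword [] = fone" by (simp add: fword_def fone_def)

lemma fword_Cons: "(fword (g # w) :: gen list \<Rightarrow> 'k::field) = fmul (fgen g) (fword w)"
proof
  fix u
  show "(fword (g # w) u :: 'k) = fmul (fgen g) (fword w) u"
  proof (cases "u = g # w")
    case True
    have "fgen g (take k u) * fword w (drop k u) = (if k = 1 then 1 else 0 :: 'k)"
      if "k \<in> {0..length u}" for k
      using that True by (cases k) (auto simp: fgen_def fword_def)
    then have "fmul (fgen g) (fword w) u = (\<Sum>k\<in>{0..length u}. if k = 1 then 1 else 0 :: 'k)"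
      unfolding fmul_def by (intro sum.cong) auto
    also have "\<dots> = 1" using True by (subst sum.delta) auto
    finally show ?thesis using True by (simp add: fword_def)
  next
    case False
    have "fgen g (take k u) * fword w (drop k u) = (0 :: 'k)" for k
    proof (rule ccontr)
      assume "fgen g (take k u) * fword w (drop k u) \<noteq> (0 :: 'k)"
      then have "take k u = [g]" "drop k u = w" by (auto simp: fgen_def fword_def split: if_splits)
      then show False using False append_take_drop_id[of k u] by simp
    qed
    then have "fmul (fgen g) (fword w) u = (0 :: 'k)" unfolding fmul_def by (intro sum.neutral) blast
    then show ?thesis using False by (simp add: fword_def)
  qed
qed

text \<open>The letters generate the free algebra: words arise by multiplying letters, general
  elements by removing one word of the support at a time. Used for the image and for the uniqueness
  of the homomorphism.\<close>

lemma free_alg_induct [consumes 1, case_names one gen add mul scale]: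
  fixes p :: "gen list \<Rightarrow> 'k::field"
  assumes "p \<in> free_alg n" and one: "P fone" and gen: "\<And>g. gidx g \<in> {1..n} \<Longrightarrow> P (fgen g)"
    and add: "\<And>p r. p \<in> free_alg n \<Longrightarrow> r \<in> free_alg n \<Longrightarrow> P p \<Longrightarrow> P r \<Longrightarrow> P (fadd p r)"
    and mul: "\<And>p r. p \<in> free_alg n \<Longrightarrow> r \<in> free_alg n \<Longrightarrow> P p \<Longrightarrow> P r \<Longrightarrow> P (fmul p r)"
    and scale: "\<And>c p. p \<in> free_alg n \<Longrightarrow> P p \<Longrightarrow> P (fsc c p)"
  shows "P p"
proof -
  have word: "(fword w :: gen list \<Rightarrow> 'k) \<in> free_alg n \<and> P (fword w)" if "\<forall>g\<in>set w. gidx g \<in> {1..n}" for w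
    using that
  proof (induction w)
    case Nil
    then show ?case using one by (simp add: fword_Nil fone_free)
  next
    case (Cons g w)
    then have g: "gidx g \<in> {1..n}" and w: "(fword w :: gen list \<Rightarrow> 'k) \<in> free_alg n" "P (fword w)" by auto
    show ?case
      unfolding fword_Cons
      using fmul_free[OF fgen_free[OF g] w(1)] mul[OF fgen_free[OF g] w(1) gen[OF g] w(2)] by simp
  qed
  have "finite A \<Longrightarrow> p \<in> free_alg n \<Longrightarrow> {w. p w \<noteq> 0} \<subseteq> A \<Longrightarrow> P p" for A p
  proof (induction A arbitrary: p rule: finite_induct)
    case empty
    \<comment> \<open>The rule has no case for zero, which is obtained as 0 times the unit.\<close>
    then have "p = fsc 0 fone" by (auto simp: fsc_def)
    then show ?case using scale[OF fone_free one] by simp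
  next
    case (insert w A)
    let ?p = "p(w := 0)"
    have p: "?p \<in> free_alg n"
    proof -
      have "{u. ?p u \<noteq> 0} \<subseteq> {u. p u \<noteq> 0}" by auto
      from finite_subset[OF this] insert.prems(1) show ?thesis by (auto simp: free_alg_def)
    qed
    have IH: "P ?p" using insert.prems(2) by (intro insert.IH[OF p]) auto
    show ?case
    proof (cases "p w = 0")
      case True
      then show ?thesis using IH by (simp add: fun_upd_idem)
    next
      case False
      then have w: "(fword w :: gen list \<Rightarrow> 'k) \<in> free_alg n" "P (fword w)"
        using word insert.prems(1) free_alg_gidx by blast+
      have "p = fadd ?p (fsc (p w) (fword w))"
        by (auto simp: fadd_def fsc_def fword_def)
      from this[symmetric] show ?thesis
        using add[OF p fsc_free[OF w(1)] IH scale[OF w], of "p w"] by (simp only:)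
    qed
  qed
  then show ?thesis using assms(1) free_alg_finite by blast
qed

lemma fmul_fadd_left: "fmul (fadd a b) c = fadd (fmul a c) (fmul b c)"
  and fmul_fadd_right: "fmul c (fadd a b) = fadd (fmul c a) (fmul c b)"
  and fmul_fsc_left: "fmul (fsc s a) c = fsc s (fmul a c)"
  and fmul_fsc_right: "fmul c (fsc s a) = fsc s (fmul c a)"
  by (auto simp: fmul_def fadd_def fsc_def distrib_left distrib_right sum.distrib sum_distrib_left
      mult_ac)

section \<open>The quotient by the ideal of relations\<close>

lemma equiv_uq_equiv: "equiv (free_alg n) (uq_equiv n q)"
proof (rule equivI)
  show "uq_equiv n q \<subseteq> free_alg n \<times> free_alg n" by (auto simp: uq_equiv_def)
  have "fadd p (fsc (-1) p) = (\<lambda>w. 0)" for p :: "gen list \<Rightarrow> 'a" by (auto simp: fadd_def fsc_def)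
  then show "refl_on (free_alg n) (uq_equiv n q)"
    by (auto simp: refl_on_def uq_equiv_def uq_ideal.zero)
  show "sym (uq_equiv n q)"
  proof (rule symI)
    fix p r :: "gen list \<Rightarrow> 'a" assume "(p, r) \<in> uq_equiv n q"
    moreover have "fadd r (fsc (-1) p) = fsc (-1) (fadd p (fsc (-1) r))"
      by (auto simp: fadd_def fsc_def)
    ultimately show "(r, p) \<in> uq_equiv n q" by (simp add: uq_equiv_def uq_ideal.sc)
  qed
  show "trans (uq_equiv n q)"
  proof (rule transI)
    fix p r s :: "gen list \<Rightarrow> 'a" assume "(p, r) \<in> uq_equiv n q" "(r, s) \<in> uq_equiv n q"
    moreover have "fadd p (fsc (-1) s) = fadd (fadd p (fsc (-1) r)) (fadd r (fsc (-1) s))"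
      by (auto simp: fadd_def fsc_def)
    ultimately show "(p, s) \<in> uq_equiv n q" by (simp add: uq_equiv_def uq_ideal.add)
  qed
qed

lemma uq_cls_in: "p \<in> free_alg n \<Longrightarrow> uq_cls n q p \<in> Uq n q"
  by (simp add: Uq_def uq_cls_def quotientI)

lemma Uq_cases:
  assumes "X \<in> Uq n q"
  obtains p where "p \<in> free_alg n" "X = uq_cls n q p"
  using assms unfolding Uq_def uq_cls_def by (rule quotientE)

text \<open>The operations on classes go through a chosen representative; this makes them computable
  on any other one.\<close>

lemma uq_rep_cls:
  assumes "p \<in> free_alg n"
  shows "(p, uq_rep (uq_cls n q p)) \<in> uq_equiv n q"
proof -
  have "p \<in> uq_cls n q p" unfolding uq_cls_def using equiv_class_self[OF equiv_uq_equiv assms] .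
  then have "uq_rep (uq_cls n q p) \<in> uq_cls n q p" unfolding uq_rep_def
    by (rule someI[of "\<lambda>r. r \<in> uq_cls n q p"])
  then show ?thesis by (simp add: uq_cls_def)
qed

lemma uq_cls_eqI: "(p, r) \<in> uq_equiv n q \<Longrightarrow> uq_cls n q r = uq_cls n q p"
  unfolding uq_cls_def using equiv_class_eq[OF equiv_uq_equiv] by metis

lemma uq_add_cls:
  assumes "p \<in> free_alg n" "r \<in> free_alg n"
  shows "uq_add n q (uq_cls n q p) (uq_cls n q r) = uq_cls n q (fadd p r)"
  unfolding uq_add_def
proof (rule uq_cls_eqI)
  let ?p = "uq_rep (uq_cls n q p)" and ?r = "uq_rep (uq_cls n q r)"
  have "fadd (fadd p r) (fsc (-1) (fadd ?p ?r)) = fadd (fadd p (fsc (-1) ?p)) (fadd r (fsc (-1) ?r))"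
    by (auto simp: fadd_def fsc_def)
  then show "(fadd p r, fadd ?p ?r) \<in> uq_equiv n q"
    using uq_rep_cls[OF assms(1), of q] uq_rep_cls[OF assms(2), of q]
    by (simp add: uq_equiv_def fadd_free uq_ideal.add)
qed

lemma uq_sc_cls:
  assumes "p \<in> free_alg n"
  shows "uq_sc n q c (uq_cls n q p) = uq_cls n q (fsc c p)"
  unfolding uq_sc_def
proof (rule uq_cls_eqI)
  let ?p = "uq_rep (uq_cls n q p)"
  have "fadd (fsc c p) (fsc (-1) (fsc c ?p)) = fsc c (fadd p (fsc (-1) ?p))"
    by (auto simp: fadd_def fsc_def algebra_simps)
  then show "(fsc c p, fsc c ?p) \<in> uq_equiv n q"
    using uq_rep_cls[OF assms(1), of q] by (simp add: uq_equiv_def fsc_free uq_ideal.sc)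
qed

lemma uq_mul_cls:
  assumes "p \<in> free_alg n" "r \<in> free_alg n"
  shows "uq_mul n q (uq_cls n q p) (uq_cls n q r) = uq_cls n q (fmul p r)"
  unfolding uq_mul_def
proof (rule uq_cls_eqI)
  let ?p = "uq_rep (uq_cls n q p)" and ?r = "uq_rep (uq_cls n q r)"
  \<comment> \<open>The splitting pr - p'r' = (p - p')r + p'(r - r') exhibits a right and a left
    multiple of ideal elements.\<close>
  have "fadd (fmul p r) (fsc (-1) (fmul ?p ?r))
      = fadd (fmul (fadd p (fsc (-1) ?p)) r) (fmul ?p (fadd r (fsc (-1) ?r)))"
    unfolding fmul_fadd_left fmul_fadd_right fmul_fsc_left fmul_fsc_right
    by (auto simp: fadd_def fsc_def)
  then show "(fmul p r, fmul ?p ?r) \<in> uq_equiv n q"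
    using uq_rep_cls[OF assms(1), of q] uq_rep_cls[OF assms(2), of q] assms
    by (simp add: uq_equiv_def fmul_free uq_ideal.add uq_ideal.lmul uq_ideal.rmul)
qed

text \<open>The relations are stated over arbitrary operations, so one case rule serves both uses:
  for operators \<open>P\<close> is equality, in the free algebra it says that both sides are
  admissible and have the same evaluation.\<close>

lemma uq_rels_cases:
  assumes lr: "(l, r) \<in> uq_rels n q add mul sc one E F K Ki"
    and KK: "\<And>i j. i \<in> {1..n} \<Longrightarrow> j \<in> {1..n} \<Longrightarrow> P (mul (K i) (K j)) (mul (K j) (K i))"
    and KKi: "\<And>i. i \<in> {1..n} \<Longrightarrow> P (mul (K i) (Ki i)) one"
    and KiK: "\<And>i. i \<in> {1..n} \<Longrightarrow> P (mul (Ki i) (K i)) one"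
    and KE: "\<And>i j. i \<in> {1..n} \<Longrightarrow> j \<in> {1..n} \<Longrightarrow>
      P (mul (mul (K i) (E j)) (Ki i)) (sc (qi q i powi cartan i j) (E j))"
    and KF: "\<And>i j. i \<in> {1..n} \<Longrightarrow> j \<in> {1..n} \<Longrightarrow>
      P (mul (mul (K i) (F j)) (Ki i)) (sc (qi q i powi (- cartan i j)) (F j))"
    and EF: "\<And>i j. i \<in> {1..n} \<Longrightarrow> j \<in> {1..n} \<Longrightarrow>
      P (add (mul (E i) (F j)) (sc (-1) (mul (F j) (E i))))
        (if i = j then sc (inverse (qi q i - inverse (qi q i))) (add (K i) (sc (-1) (Ki i))) else sc 0 one)"
    and serre: "\<And>Y i j. Y = E \<or> Y = F \<Longrightarrow> i \<in> {1..n} \<Longrightarrow> j \<in> {1..n} \<Longrightarrow> i \<noteq> j \<Longrightarrow>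
      P (foldr add (map (\<lambda>t. sc ((-1) ^ t * qbinom (qi q i) (nat (1 - cartan i j)) t)
          (mul (mul ((mul (Y i) ^^ t) one) (Y j)) ((mul (Y i) ^^ (nat (1 - cartan i j) - t)) one)))
          [0..<nat (1 - cartan i j) + 1]) (sc 0 one)) (sc 0 one)"
  shows "P l r"
  using lr unfolding uq_rels_def Let_def
proof (elim UnE CollectE exE conjE)
  fix i j
  assume "(l, r) = (mul (K i) (K j), mul (K j) (K i))" "i \<in> {1..n}" "j \<in> {1..n}"
  then show ?thesis using KK by simp
next
  fix i assume "(l, r) = (mul (K i) (Ki i), one)" "i \<in> {1..n}"
  then show ?thesis using KKi by simp
next
  fix i assume "(l, r) = (mul (Ki i) (K i), one)" "i \<in> {1..n}"
  then show ?thesis using KiK by simp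
qed ((erule Pair_inject, hypsubst, rule KE KF EF, assumption+)
    | (erule Pair_inject, hypsubst, rule serre, blast, assumption+))+

section \<open>Linear operators determined by the normal monomials\<close>

locale quantum_symplectic =
  fixes n :: nat and q :: "'k::field_char_0" and \<phi> :: "'k \<Rightarrow> 'a::ring_1" and x :: "int \<Rightarrow> 'a"
  assumes n2: "n \<ge> 2"
    and q0: "q \<noteq> 0"
    and q_not_root: "\<forall>m::nat. m > 0 \<longrightarrow> q ^ m \<noteq> 1"
    and phi_add: "\<forall>a b. \<phi> (a + b) = \<phi> a + \<phi> b"
    and phi_mult: "\<forall>a b. \<phi> (a * b) = \<phi> a * \<phi> b"
    and phi_one: "\<phi> 1 = 1"
    and phi_central: "\<forall>c v. \<phi> c * v = v * \<phi> c"
    and rel1: "\<forall>i\<in>Iset n. \<forall>j\<in>Iset n. i < j \<and> j \<noteq> - i \<longrightarrow> x j * x i = \<phi> q * x i * x j"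
    and rel2: "\<forall>i\<in>{1..int n}. x i * x (- i) =
                 \<phi> (q ^ 2) * x (- i) * x i + \<phi> (q ^ 2 * (q - inverse q)) * Omega n q \<phi> x (i + 1)"
    and basis: "normal_basis n \<phi> x"
begin

text \<open>The scalars sit inside the ring through \<open>\<phi>\<close>; naming the action makes
  the ring a vector space in the sense of the library.\<close>

definition sc :: "'k \<Rightarrow> 'a \<Rightarrow> 'a" (infixr "\<star>" 75) where
  "c \<star> v = \<phi> c * v"

sublocale vector_space sc
  by unfold_locales (simp_all add: sc_def phi_add phi_mult phi_one algebra_simps)

abbreviation lin :: "('a \<Rightarrow> 'a) \<Rightarrow> bool" where "lin \<equiv> Vector_Spaces.linear sc sc"

abbreviation m :: "(int \<Rightarrow> nat) \<Rightarrow> 'a" where "m \<equiv> nmono n x"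

lemma sc_mult_left: "(c \<star> u) * v = c \<star> (u * v)"
  by (simp add: sc_def mult.assoc)

lemma sc_mult_right: "u * (c \<star> v) = c \<star> (u * v)"
  using phi_central unfolding sc_def by (metis mult.assoc)

lemma linI:
  assumes "\<And>u v. T (u + v) = T u + T v" "\<And>c v. T (c \<star> v) = c \<star> T v"
  shows "lin T"
  by (intro Vector_Spaces.linear.intro module_hom.intro module_hom_axioms.intro
      vector_space_axioms module_axioms assms)

lemma
  assumes "lin T"
  shows lin_plus: "T (u + v) = T u + T v"
    and lin_scale: "T (c \<star> v) = c \<star> T v"
    and lin_zero: "T 0 = 0"
    and lin_minus: "T (u - v) = T u - T v"
    and lin_uminus: "T (- v) = - T v"
    and lin_sum: "T (sum g A) = (\<Sum>a\<in>A. T (g a))"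
proof -
  interpret T: Vector_Spaces.linear sc sc T by (rule assms)
  show "T (u + v) = T u + T v" "T (c \<star> v) = c \<star> T v" "T 0 = 0"
    "T (u - v) = T u - T v" "T (- v) = - T v" "T (sum g A) = (\<Sum>a\<in>A. T (g a))"
    by (simp_all add: T.add T.scale T.zero T.diff T.neg T.sum)
qed

lemmas lin_simps = lin_plus lin_scale lin_zero lin_minus lin_uminus lin_sum

lemma lincomb_on:
  assumes "finite A" "{a. c a \<noteq> 0} \<subseteq> A"
  shows "lincomb n \<phi> x c = (\<Sum>a\<in>A. c a \<star> m a)"
  unfolding lincomb_def sc_def[symmetric]
  by (rule sum.mono_neutral_left) (use assms in auto)

lemma coord_props: "coord n \<phi> x v \<in> coefs n" "v = lincomb n \<phi> x (coord n \<phi> x v)"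
proof -
  have "\<exists>!c. c \<in> coefs n \<and> v = lincomb n \<phi> x c"
    using basis unfolding normal_basis_def by blast
  from theI'[OF this]
  show "coord n \<phi> x v \<in> coefs n" "v = lincomb n \<phi> x (coord n \<phi> x v)"
    unfolding coord_def by blast+
qed

lemma coord_eqI: "c \<in> coefs n \<Longrightarrow> v = lincomb n \<phi> x c \<Longrightarrow> coord n \<phi> x v = c"
  using basis coord_props[of v] unfolding normal_basis_def by metis

lemma finite_coord: "finite {a. coord n \<phi> x v a \<noteq> 0}"
  using coord_props(1)[of v] by (simp add: coefs_def)

lemma coord_expos: "coord n \<phi> x v a \<noteq> 0 \<Longrightarrow> a \<in> expos n"
  using coord_props(1)[of v] by (simp add: coefs_def)

lemma coord_expand: "v = (\<Sum>a | coord n \<phi> x v a \<noteq> 0. coord n \<phi> x v a \<star> m a)"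
  using coord_props(2)[of v] by (simp add: lincomb_def sc_def)

lemma coord_plus: "coord n \<phi> x (u + v) = (\<lambda>a. coord n \<phi> x u a + coord n \<phi> x v a)"
proof (rule coord_eqI)
  let ?c = "coord n \<phi> x u" and ?d = "coord n \<phi> x v"
  let ?A = "{a. ?c a \<noteq> 0} \<union> {a. ?d a \<noteq> 0}"
  have fin: "finite ?A" using finite_coord by blast
  have sub: "{a. ?c a + ?d a \<noteq> 0} \<subseteq> ?A" by auto
  show "(\<lambda>a. ?c a + ?d a) \<in> coefs n"
    using finite_subset[OF sub fin] coord_expos sub by (auto simp: coefs_def)
  have "u = (\<Sum>a\<in>?A. ?c a \<star> m a)" "v = (\<Sum>a\<in>?A. ?d a \<star> m a)"
    using coord_props(2) lincomb_on[OF fin, of ?c] lincomb_on[OF fin, of ?d] by auto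
  then show "u + v = lincomb n \<phi> x (\<lambda>a. ?c a + ?d a)"
    using lincomb_on[OF fin sub] by (simp add: scale_left_distrib sum.distrib)
qed

lemma coord_scale: "coord n \<phi> x (c \<star> v) = (\<lambda>a. c * coord n \<phi> x v a)"
proof (rule coord_eqI)
  let ?d = "coord n \<phi> x v"
  have sub: "{a. c * ?d a \<noteq> 0} \<subseteq> {a. ?d a \<noteq> 0}" by auto
  show "(\<lambda>a. c * ?d a) \<in> coefs n"
    using finite_subset[OF sub finite_coord] coord_expos by (auto simp: coefs_def)
  show "c \<star> v = lincomb n \<phi> x (\<lambda>a. c * ?d a)"
    using lincomb_on[OF finite_coord sub] coord_expand[of v]
    by (metis (no_types, lifting) scale_scale scale_sum_right sum.cong)
qed

lemma coord_mono: "a \<in> expos n \<Longrightarrow> coord n \<phi> x (m a) = (\<lambda>b. if b = a then 1 else 0)"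
  by (rule coord_eqI) (auto simp: coefs_def lincomb_def phi_one)

lemma lin_basis_op: "lin (basis_op n \<phi> x h)"
proof -
  \<comment> \<open>Supports differ between \<open>u\<close>, \<open>v\<close> and
    \<open>u + v\<close>, so all sums are first extended to a common finite set.\<close>
  have on: "basis_op n \<phi> x h v = (\<Sum>a\<in>A. coord n \<phi> x v a \<star> h a)"
    if "finite A" "{a. coord n \<phi> x v a \<noteq> 0} \<subseteq> A" for v A
    unfolding basis_op_def sc_def[symmetric]
    by (rule sum.mono_neutral_left) (use that in auto)
  show ?thesis
  proof (rule linI)
    fix u v
    let ?A = "{a. coord n \<phi> x u a \<noteq> 0} \<union> {a. coord n \<phi> x v a \<noteq> 0}"
    have "finite ?A" using finite_coord by blast
    then show "basis_op n \<phi> x h (u + v) = basis_op n \<phi> x h u + basis_op n \<phi> x h v"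
      by (subst (1 2 3) on[of ?A])
        (auto simp: coord_plus scale_left_distrib sum.distrib)
  next
    fix c v
    show "basis_op n \<phi> x h (c \<star> v) = c \<star> basis_op n \<phi> x h v"
      by (subst (1 2) on[of "{a. coord n \<phi> x v a \<noteq> 0}"])
        (auto simp: coord_scale finite_coord scale_sum_right)
  qed
qed

lemma basis_op_mono: "a \<in> expos n \<Longrightarrow> basis_op n \<phi> x h (m a) = h a"
  by (simp add: basis_op_def coord_mono phi_one)

lemma lin_eqI:
  assumes "lin T" "lin T'" "\<And>a. a \<in> expos n \<Longrightarrow> T (m a) = T' (m a)"
  shows "T = T'"
proof
  fix v
  show "T v = T' v"
    by (subst (1 2) coord_expand[of v])
      (auto simp: lin_sum[OF assms(1)] lin_sum[OF assms(2)] lin_scale[OF assms(1)]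
        lin_scale[OF assms(2)] assms(3) coord_expos intro!: sum.cong)
qed

lemma lin_comp: "lin S \<Longrightarrow> lin T \<Longrightarrow> lin (S \<circ> T)"
  by (rule linI) (simp_all add: lin_simps)

lemma lin_opadd: "lin S \<Longrightarrow> lin T \<Longrightarrow> lin (opadd S T)"
  by (rule linI) (simp_all add: lin_simps opadd_def algebra_simps)

lemma lin_opsc: "lin T \<Longrightarrow> lin (opsc \<phi> c T)"
  by (rule linI) (simp_all add: lin_simps opsc_def sc_def[symmetric] algebra_simps)

lemma lin_id: "lin id" by (rule linI) auto

lemma lin_xL: "lin (xL x i)" by (rule linI) (auto simp: xL_def algebra_simps sc_mult_right)

lemma lin_xR: "lin (xR x i)" by (rule linI) (auto simp: xR_def algebra_simps sc_mult_left)

lemma lin_der: "lin (der n q \<phi> x i)" by (simp add: der_def lin_basis_op)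
lemma lin_mu: "lin (mu n q \<phi> x i)" by (simp add: mu_def lin_basis_op)
lemma lin_mu_inv: "lin (mu_inv n q \<phi> x i)" by (simp add: mu_inv_def lin_basis_op)

lemma lin_tau_inv: "lin (tau_inv n q \<phi> x i)"
proof -
  have "lin (foldr (\<circ>) (map (mu_inv n q \<phi> x) is) id)" for "is"
    using lin_id lin_comp[OF lin_mu_inv] by (induction "is") (simp_all add: id_def o_def)
  then show ?thesis by (simp add: tau_inv_def)
qed

lemmas lin_intros = lin_comp lin_opadd lin_opsc lin_id lin_xL lin_xR lin_der lin_mu lin_mu_inv
  lin_tau_inv lin_basis_op

lemma opsc_sc: "opsc \<phi> c T v = c \<star> T v" by (simp add: opsc_def sc_def)

section \<open>Multiplication of normal monomials by generators\<close>

lemma expos_upd [simp]: "a \<in> expos n \<Longrightarrow> i \<in> Iset n \<Longrightarrow> a(i := k) \<in> expos n"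
  by (auto simp: expos_def)

text \<open>An ordered product over any list of indices, so that a monomial can be cut at the place
  where a generator is to be inserted.\<close>

definition seg :: "int list \<Rightarrow> (int \<Rightarrow> nat) \<Rightarrow> 'a" where
  "seg is a = prod_list (map (\<lambda>i. x i ^ a i) is)"

lemma seg_Nil [simp]: "seg [] a = 1"
  and seg_Cons: "seg (i # is) a = x i ^ a i * seg is a"
  and seg_append: "seg (is @ js) a = seg is a * seg js a"
  by (simp_all add: seg_def)

lemma seg_upd: "i \<notin> set is \<Longrightarrow> seg is (a(i := k)) = seg is a"
  unfolding seg_def by (rule arg_cong[where f = prod_list]) auto

lemma m_seg: "m a = seg [- int n..-1] a * seg [1..int n] a"
  by (simp add: nmono_def seg_def)

lemma power_commute_left:
  assumes "y * z = c \<star> (z * y)"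
  shows "y * z ^ k = (c ^ k) \<star> (z ^ k * y)"
proof (induction k)
  case (Suc k)
  have "y * z ^ Suc k = (c \<star> (z * y)) * z ^ k"
    by (simp add: assms mult.assoc[symmetric])
  also have "\<dots> = c \<star> (z * (y * z ^ k))" by (simp add: sc_mult_left mult.assoc)
  finally show ?case by (simp add: Suc sc_mult_right mult.assoc)
qed simp

lemma power_commute_right:
  assumes "z * y = c \<star> (y * z)"
  shows "z ^ k * y = (c ^ k) \<star> (y * z ^ k)"
proof (induction k)
  case (Suc k)
  have "z ^ Suc k * y = z * (z ^ k * y)" by (simp add: mult.assoc)
  also have "\<dots> = (c ^ k) \<star> ((z * y) * z ^ k)" by (simp add: Suc sc_mult_right mult.assoc)
  finally show ?case by (simp add: assms sc_mult_left mult.assoc mult.commute)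
qed simp

lemma seg_commute_left:
  assumes "\<And>i. i \<in> set is \<Longrightarrow> y * x i = q \<star> (x i * y)"
  shows "y * seg is a = (q ^ sum_list (map a is)) \<star> (seg is a * y)"
  using assms
proof (induction "is")
  case (Cons i "is")
  have "y * seg (i # is) a = (y * x i ^ a i) * seg is a" by (simp add: seg_Cons mult.assoc)
  also have "\<dots> = (q ^ a i) \<star> (x i ^ a i * (y * seg is a))"
    using Cons.prems by (simp add: power_commute_left[of y "x i" q] sc_mult_left mult.assoc)
  finally show ?case using Cons by (simp add: sc_mult_right seg_Cons mult.assoc power_add)
qed simp

lemma seg_commute_right:
  assumes "\<And>i. i \<in> set is \<Longrightarrow> x i * y = q \<star> (y * x i)"
  shows "seg is a * y = (q ^ sum_list (map a is)) \<star> (y * seg is a)"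
  using assms
proof (induction "is")
  case (Cons i "is")
  have "seg (i # is) a * y = x i ^ a i * (seg is a * y)" by (simp add: seg_Cons mult.assoc)
  also have "\<dots> = (q ^ sum_list (map a is)) \<star> ((x i ^ a i * y) * seg is a)"
    using Cons by (simp add: sc_mult_right mult.assoc)
  also have "x i ^ a i * y = (q ^ a i) \<star> (y * x i ^ a i)"
    using Cons.prems by (simp add: power_commute_right)
  finally show ?case by (simp add: sc_mult_left seg_Cons mult.assoc power_add mult.commute)
qed simp

lemma x_swap: "i \<in> Iset n \<Longrightarrow> j \<in> Iset n \<Longrightarrow> i < j \<Longrightarrow> j \<noteq> - i \<Longrightarrow> x j * x i = q \<star> (x i * x j)"
  using rel1 by (simp add: sc_def mult.assoc)

lemma Iset_iff: "i \<in> Iset n \<longleftrightarrow> (- int n \<le> i \<and> i \<le> -1) \<or> (1 \<le> i \<and> i \<le> int n)"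
  by (auto simp: Iset_def)


abbreviation lw :: "int list \<Rightarrow> (int \<Rightarrow> nat) \<Rightarrow> nat" where
  "lw is a \<equiv> sum_list (map a is)"

lemma upto_split_at: "l \<le> i \<Longrightarrow> i \<le> h \<Longrightarrow> [l..h] = [l..i - 1] @ i # [i + 1..h]"
  by (rule upto_split3)

text \<open>On its way in from the left the generator passes smaller indices of its own sign only,
  each at the cost of one factor \<open>q\<close>.\<close>

lemma seg_mult_at_left:
  assumes "1 \<le> j" "j \<le> int n"
  shows "x (- j) * seg [- int n..-1] a
    = (q ^ lw [- int n..- j - 1] a) \<star> seg [- int n..-1] (a(- j := Suc (a (- j))))"
proof -
  have sp: "[- int n..-1] = [- int n..- j - 1] @ (- j) # [- j + 1..-1]"
    using assms by (intro upto_split_at) auto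
  have "x (- j) * seg [- int n..- j - 1] a
    = (q ^ lw [- int n..- j - 1] a) \<star> (seg [- int n..- j - 1] a * x (- j))"
    using assms by (intro seg_commute_left x_swap) (auto simp: Iset_iff)
  then show ?thesis
    unfolding sp seg_append seg_Cons
    by (simp add: seg_upd sc_mult_left mult.assoc[symmetric])
qed

lemma seg_mult_at_right:
  assumes "1 \<le> j" "j \<le> int n"
  shows "seg [1..int n] a * x j
    = (q ^ lw [j + 1..int n] a) \<star> seg [1..int n] (a(j := Suc (a j)))"
proof -
  have sp: "[1..int n] = [1..j - 1] @ j # [j + 1..int n]"
    using assms by (intro upto_split_at) auto
  have "seg [j + 1..int n] a * x j
    = (q ^ lw [j + 1..int n] a) \<star> (x j * seg [j + 1..int n] a)"
    using assms by (intro seg_commute_right x_swap) (auto simp: Iset_iff)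
  then show ?thesis
    unfolding sp seg_append seg_Cons
    by (simp add: seg_upd sc_mult_left sc_mult_right mult.assoc power_commutes)
      (simp add: mult.assoc[symmetric] power_commutes)
qed

text \<open>This lemma and the next let a generator enter from the middle gap of a monomial, where
  the two factors of each summand of Omega start. Again only indices of the same sign are
  passed.\<close>

lemma seg_insert_left:
  assumes "1 \<le> j" "j \<le> int n"
  shows "seg [- int n..-1] a * x (- j)
    = (q ^ lw [- j + 1..-1] a) \<star> seg [- int n..-1] (a(- j := Suc (a (- j))))"
proof -
  have sp: "[- int n..-1] = [- int n..- j - 1] @ (- j) # [- j + 1..-1]"
    using assms by (intro upto_split_at) auto
  have "seg [- j + 1..-1] a * x (- j)
    = (q ^ lw [- j + 1..-1] a) \<star> (x (- j) * seg [- j + 1..-1] a)"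
    using assms by (intro seg_commute_right x_swap) (auto simp: Iset_iff)
  then show ?thesis
    unfolding sp seg_append seg_Cons
    by (simp add: seg_upd sc_mult_left sc_mult_right mult.assoc power_commutes)
      (simp add: mult.assoc[symmetric] power_commutes)
qed

lemma seg_insert_right:
  assumes "1 \<le> j" "j \<le> int n"
  shows "x j * seg [1..int n] a
    = (q ^ lw [1..j - 1] a) \<star> seg [1..int n] (a(j := Suc (a j)))"
proof -
  have sp: "[1..int n] = [1..j - 1] @ j # [j + 1..int n]"
    using assms by (intro upto_split_at) auto
  have "x j * seg [1..j - 1] a
    = (q ^ lw [1..j - 1] a) \<star> (seg [1..j - 1] a * x j)"
    using assms by (intro seg_commute_left x_swap) (auto simp: Iset_iff)
  then show ?thesis
    unfolding sp seg_append seg_Cons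
    by (simp add: seg_upd sc_mult_left mult.assoc[symmetric])
qed

lemma seg_left_upd: "0 < j \<Longrightarrow> seg [- int n..-1] (a(j := k)) = seg [- int n..-1] a"
  by (rule seg_upd) simp

lemma seg_right_upd: "j < 0 \<Longrightarrow> seg [1..int n] (a(j := k)) = seg [1..int n] a"
  by (rule seg_upd) simp

text \<open>A negative generator from the left, like a positive one from the right, finds its place
  before it can meet its opposite. Hence a single monomial results.\<close>

lemma xL_mono:
  assumes "1 \<le> j" "j \<le> int n"
  shows "x (- j) * m a = (q ^ lw [- int n..- j - 1] a) \<star> m (a(- j := Suc (a (- j))))"
  using assms
  by (simp add: m_seg mult.assoc[symmetric] seg_mult_at_left sc_mult_left seg_right_upd)

lemma xR_mono:
  assumes "1 \<le> j" "j \<le> int n"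
  shows "m a * x j = (q ^ lw [j + 1..int n] a) \<star> m (a(j := Suc (a j)))"
  using assms
  by (simp add: m_seg mult.assoc seg_mult_at_right sc_mult_right seg_left_upd)

lemma mu_inv_mono: "a \<in> expos n \<Longrightarrow> mu_inv n q \<phi> x i (m a) = (inverse q ^ a i) \<star> m a"
  by (simp add: mu_inv_def basis_op_mono sc_def)

lemma mu_mono: "a \<in> expos n \<Longrightarrow> mu n q \<phi> x i (m a) = (q ^ a i) \<star> m a"
  by (simp add: mu_def basis_op_mono sc_def)

text \<open>The case \<open>a i = 0\<close> is covered: the coefficient \<open>qnum q 0\<close>
  vanishes, so the truncated exponent is harmless.\<close>

lemma der_mono: "a \<in> expos n \<Longrightarrow> der n q \<phi> x i (m a) = qnum q (a i) \<star> m (a(i := a i - 1))"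
  by (simp add: der_def basis_op_mono sc_def[symmetric] qnum_def)

lemma tau_inv_mono:
  assumes "a \<in> expos n"
  shows "tau_inv n q \<phi> x i (m a)
    = (inverse q ^ lw (if i > 0 then [i..int n] else [- int n..i]) a) \<star> m a"
proof -
  have "foldr (\<circ>) (map (mu_inv n q \<phi> x) is) id (m a) = (inverse q ^ lw is a) \<star> m a" for "is"
    by (induction "is")
      (simp_all add: assms mu_inv_mono lin_scale[OF lin_mu_inv] power_add mult.commute)
  then show ?thesis by (simp add: tau_inv_def)
qed

section \<open>The quadratic element\<close>

abbreviation Om :: "int \<Rightarrow> 'a" where "Om \<equiv> Omega n q \<phi> x"

lemma Om_top: "int n < k \<Longrightarrow> Om k = 0"
  by (simp add: Omega_def)

lemma Om_rec:
  assumes "k \<le> int n"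
  shows "Om k = x (- k) * x k + q \<star> Om (k + 1)"
proof -
  have "{k..int n} = insert k {k + 1..int n}" using assms by auto
  then have "Om k = x (- k) * x k
      + (\<Sum>j\<in>{k + 1..int n}. \<phi> (q ^ nat (j - k)) * x (- j) * x j)"
    by (simp add: Omega_def phi_one)
  also have "(\<Sum>j\<in>{k + 1..int n}. \<phi> (q ^ nat (j - k)) * x (- j) * x j) = q \<star> Om (k + 1)"
    unfolding Omega_def scale_sum_right
  proof (rule sum.cong)
    fix j assume "j \<in> {k + 1..int n}"
    then have "nat (j - k) = Suc (nat (j - (k + 1)))" by auto
    then show "\<phi> (q ^ nat (j - k)) * x (- j) * x j
        = q \<star> (\<phi> (q ^ nat (j - (k + 1))) * x (- j) * x j)"
      by (simp add: sc_def phi_mult mult.assoc)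
  qed simp
  finally show ?thesis .
qed

text \<open>Passing \<open>x (- j)\<close> costs a factor \<open>q\<close> and passing
  \<open>x j\<close> its inverse, so each summand commutes already.\<close>

lemma x_Om_commute:
  assumes "i = 1 \<or> i = -1" "2 \<le> k"
  shows "x i * Om k = Om k * x i"
proof -
  have "x i * (x (- j) * x j) = (x (- j) * x j) * x i" if "2 \<le> j" "j \<le> int n" for j
  proof -
    have "x i * (x (- j) * x j) = q \<star> (x (- j) * (x i * x j))"
      using that assms x_swap[of "- j" i] by (auto simp: Iset_iff mult.assoc[symmetric] sc_mult_left)
    also have "\<dots> = x (- j) * (x j * x i)"
      using that assms x_swap[of i j] by (auto simp: Iset_iff sc_mult_right)
    finally show ?thesis by (simp add: mult.assoc)
  qed
  then have "x i * (\<phi> c * x (- j) * x j) = (\<phi> c * x (- j) * x j) * x i"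
    if "j \<in> {k..int n}" for c j
    using that assms(2) by (simp add: sc_def[symmetric] mult.assoc sc_mult_left sc_mult_right)
  then show ?thesis
    unfolding Omega_def sum_distrib_left sum_distrib_right by (intro sum.cong) auto
qed

lemma x1_xm1: "x 1 * x (-1) = (q ^ 2) \<star> (x (-1) * x 1) + (q ^ 2 * (q - inverse q)) \<star> Om 2"
  using rel2 n2 by (simp add: sc_def mult.assoc)

definition lam :: 'k where "lam = q - inverse q"

lemma lam_ne: "lam \<noteq> 0"
proof
  assume "lam = 0"
  then have "q ^ 2 = 1" using q0 by (simp add: lam_def field_simps power2_eq_square)
  then show False using q_not_root by auto
qed

lemma qnum_0 [simp]: "qnum q 0 = 0"
  by (simp add: qnum_def)

lemma qnum_lam: "lam * qnum q k = q ^ k - inverse q ^ k"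
  using lam_ne by (simp add: qnum_def lam_def)

text \<open>The recursion for the Omega coefficient in the next two lemmas: one further passage
  contributes \<open>q ^ 2 * lam\<close>, scaled by the \<open>q ^ (2 * k)\<close> gathered so
  far.\<close>

lemma om_coeff_Suc:
  "q ^ (2 * k) * (q ^ 2 * lam) + q ^ (k + 1) * lam * qnum q k = q ^ (Suc k + 1) * lam * qnum q (Suc k)"
proof -
  have 1: "c * lam * qnum q k = c * (q ^ k - inverse q ^ k)" for c k
    using qnum_lam[of k] by (simp add: mult.assoc)
  show ?thesis unfolding 1 unfolding lam_def using q0
    by (simp add: field_simps power2_eq_square mult_2 mult_2_right power_add)
qed

text \<open>Each passage of \<open>x (-1)\<close> past an \<open>x 1\<close> gives a factor
  \<open>q ^ 2\<close> and leaves an Omega; since Omega commutes with \<open>x 1\<close>, all these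
  terms can be collected in one.\<close>

lemma x1_power_xm1:
  "x 1 ^ k * x (-1) = (q ^ (2 * k)) \<star> (x (-1) * x 1 ^ k)
     + (q ^ (k + 1) * lam * qnum q k) \<star> (Om 2 * x 1 ^ (k - 1))"
proof (induction k)
  case (Suc k)
  let ?c = "q ^ (k + 1) * lam * qnum q k"
  \<comment> \<open>For \<open>k = 0\<close> the exponents do not match, but then \<open>?c\<close>
    contains \<open>qnum q 0\<close> and is zero.\<close>
  have *: "?c \<star> (x 1 * (Om 2 * x 1 ^ (k - 1))) = ?c \<star> (Om 2 * x 1 ^ k)"
  proof (cases k)
    case (Suc l)
    have "x 1 * (Om 2 * x 1 ^ l) = Om 2 * (x 1 * x 1 ^ l)"
      using x_Om_commute[of 1 2] by (simp add: mult.assoc[symmetric])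
    then show ?thesis by (simp add: Suc)
  qed simp
  have "x 1 ^ Suc k * x (-1) = x 1 * (x 1 ^ k * x (-1))" by (simp add: mult.assoc)
  also have "\<dots> = (q ^ (2 * k)) \<star> (x 1 * x (-1) * x 1 ^ k) + ?c \<star> (Om 2 * x 1 ^ k)"
    by (simp add: Suc distrib_left sc_mult_right mult.assoc)
      (use * in \<open>auto simp: mult_ac\<close>)
  also have "\<dots> = (q ^ (2 * Suc k)) \<star> (x (-1) * x 1 ^ Suc k)
      + (q ^ (2 * k) * (q ^ 2 * lam) + ?c) \<star> (Om 2 * x 1 ^ k)"
    by (simp add: x1_xm1 lam_def distrib_right distrib_left sc_mult_left scale_right_distrib
        scale_left_distrib mult.assoc power_add power2_eq_square add.assoc)
  also note om_coeff_Suc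
  finally show ?case by simp
qed simp

lemma x1_xm1_power:
  "x 1 * x (-1) ^ k = (q ^ (2 * k)) \<star> (x (-1) ^ k * x 1)
     + (q ^ (k + 1) * lam * qnum q k) \<star> (x (-1) ^ (k - 1) * Om 2)"
proof (induction k)
  case (Suc k)
  let ?c = "q ^ (k + 1) * lam * qnum q k"
  have *: "?c \<star> (x (-1) ^ (k - 1) * Om 2 * x (-1)) = ?c \<star> (x (-1) ^ k * Om 2)"
  proof (cases k)
    case (Suc l)
    have "x (-1) ^ l * Om 2 * x (-1) = x (-1) ^ l * x (-1) * Om 2"
      using x_Om_commute[of "-1" 2] by (simp add: mult.assoc)
    then show ?thesis by (simp add: Suc power_commutes)
  qed simp
  have "x 1 * x (-1) ^ Suc k = (x 1 * x (-1) ^ k) * x (-1)"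
    by (simp add: mult.assoc power_commutes)
  also have "\<dots> = (q ^ (2 * k)) \<star> (x (-1) ^ k * (x 1 * x (-1))) + ?c \<star> (x (-1) ^ k * Om 2)"
    by (simp add: Suc distrib_right sc_mult_left mult.assoc)
      (use * in \<open>simp add: mult.assoc\<close>)
  also have "\<dots> = (q ^ (2 * Suc k)) \<star> (x (-1) ^ Suc k * x 1)
      + (q ^ (2 * k) * (q ^ 2 * lam) + ?c) \<star> (x (-1) ^ k * Om 2)"
    by (simp add: x1_xm1 lam_def distrib_right distrib_left sc_mult_right scale_right_distrib
        scale_left_distrib mult.assoc power_add power2_eq_square add.assoc)
      (simp add: mult.assoc[symmetric] power_commutes)
  also note om_coeff_Suc
  finally show ?case by simp
qed simp

section \<open>The operators in the normal monomial basis\<close>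

text \<open>The common form of all operators that act on one exponent: a coefficient and a new
  exponent, both functions of the old one. Where \<open>f\<close> truncates at zero, the
  \<open>c\<close> in use vanishes.\<close>

definition index_op :: "int \<Rightarrow> (nat \<Rightarrow> 'k) \<Rightarrow> (nat \<Rightarrow> nat) \<Rightarrow> 'a \<Rightarrow> 'a" where
  "index_op i c f = basis_op n \<phi> x (\<lambda>a. c (a i) \<star> m (a(i := f (a i))))"

abbreviation raise :: "int \<Rightarrow> 'a \<Rightarrow> 'a" where "raise i \<equiv> index_op i (\<lambda>_. 1) Suc"
abbreviation lower :: "int \<Rightarrow> 'a \<Rightarrow> 'a" where "lower i \<equiv> index_op i (qnum q) (\<lambda>k. k - 1)"
abbreviation mul_q :: "int \<Rightarrow> 'a \<Rightarrow> 'a" where "mul_q i \<equiv> index_op i (\<lambda>k. q ^ k) (\<lambda>k. k)"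
abbreviation div_q :: "int \<Rightarrow> 'a \<Rightarrow> 'a" where "div_q i \<equiv> index_op i (\<lambda>k. inverse q ^ k) (\<lambda>k. k)"

lemma lin_index_op: "lin (index_op i c f)"
  by (simp add: index_op_def lin_basis_op)

lemma index_op_mono: "a \<in> expos n \<Longrightarrow> index_op i c f (m a) = c (a i) \<star> m (a(i := f (a i)))"
  by (simp add: index_op_def basis_op_mono)

lemma der_eq: "der n q \<phi> x i = lower i"
  by (rule lin_eqI) (simp_all add: lin_der lin_index_op index_op_mono der_mono)

lemma mu_eq: "mu n q \<phi> x i = mul_q i"
  by (rule lin_eqI) (simp_all add: lin_mu lin_index_op index_op_mono mu_mono)

lemma mu_inv_eq: "mu_inv n q \<phi> x i = div_q i"
  by (rule lin_eqI) (simp_all add: lin_mu_inv lin_index_op index_op_mono mu_inv_mono)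

text \<open>With \<open>k = n + 1 - d\<close>, \<open>quad d\<close> inserts \<open>\<Omega>\<^sub>k\<close> between the two halves of a normal
  monomial, up to a power of \<^term>\<open>q\<close> (lemma \<open>seg_Om_seg\<close>).\<close>

primrec quad :: "nat \<Rightarrow> 'a \<Rightarrow> 'a" where
  "quad 0 = opsc \<phi> 0 id"
| "quad (Suc d) = opadd (raise (int n - int d) \<circ> raise (int d - int n))
     (opsc \<phi> q (quad d \<circ> mul_q (int n - int d) \<circ> mul_q (int d - int n)))"

abbreviation quad2 :: "'a \<Rightarrow> 'a" where "quad2 \<equiv> quad (n - Suc 0)"

lemma lin_quad: "lin (quad d)"
  by (induction d) (simp_all only: quad.simps lin_opsc lin_id lin_opadd lin_comp lin_index_op)

lemma quad_0: "quad 0 v = 0" by (simp add: opsc_sc)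

lemma quad_Suc_mono:
  assumes "a \<in> expos n" "d < n"
  shows "quad (Suc d) (m a) = m (a(d - int n := Suc (a (d - int n)), int n - d := Suc (a (int n - d))))
    + (q * q ^ (a (int n - d) + a (d - int n))) \<star> quad d (m a)"
proof -
  have "int n - d \<in> Iset n" "d - int n \<in> Iset n" using assms by (auto simp: Iset_iff)
  then show ?thesis using assms
    by (simp add: opadd_def opsc_sc index_op_mono lin_simps[OF lin_index_op] lin_scale[OF lin_quad] power_add
        mult_ac)
qed

text \<open>Every pair of Omega_k passes the exponents with absolute index below k. This common
  power of \<open>q\<close> is split off, which leaves in \<open>quad d\<close> an operator that
  touches only the indices from k outwards.\<close>

lemma seg_Om_seg:
  assumes "a \<in> expos n" "d \<le> n"
  shows "seg [- int n..-1] a * Om (int n + 1 - d) * seg [1..int n] a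
    = (q ^ (lw [1..int n - d] a + lw [int d - int n..-1] a)) \<star> quad d (m a)"
  using assms(2)
proof (induction d)
  case 0
  show ?case by (simp add: Om_top quad_0 del: quad.simps)
next
  case (Suc d)
  define k where "k = int n - int d"
  have k: "1 \<le> k" "k \<le> int n" using Suc.prems by (auto simp: k_def)
  have k': "int n + 1 - int (Suc d) = k" "int n - int (Suc d) = k - 1" "int (Suc d) - int n = - k + 1"
      "int n + 1 - int d = k + 1" "int n - int d = k" "int d - int n = - k"
    by (auto simp: k_def)
  have IH: "seg [- int n..-1] a * Om (k + 1) * seg [1..int n] a
    = (q ^ (lw [1..k] a + lw [- k..-1] a)) \<star> quad d (m a)"
    using Suc by (simp add: k')
  have r: "seg [1..int n] (a(- k := Suc (a (- k)), k := Suc (a k)))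
    = seg [1..int n] (a(k := Suc (a k)))"
    using k seg_right_upd[of "- k" "a(k := Suc (a k))"] by (simp add: fun_upd_twist[of "- k" k])
  have "seg [- int n..-1] a * (x (- k) * x k) * seg [1..int n] a
    = (seg [- int n..-1] a * x (- k)) * (x k * seg [1..int n] a)"
    by (simp add: mult.assoc)
  also have "\<dots> = (q ^ (lw [- k + 1..-1] a + lw [1..k - 1] a)) \<star>
      m (a(- k := Suc (a (- k)), k := Suc (a k)))"
    using k r by (simp add: seg_insert_left seg_insert_right sc_mult_left sc_mult_right power_add
        m_seg seg_left_upd mult.commute)
  finally have 1: "seg [- int n..-1] a * (x (- k) * x k) * seg [1..int n] a
    = (q ^ (lw [- k + 1..-1] a + lw [1..k - 1] a)) \<star> m (a(- k := Suc (a (- k)), k := Suc (a k)))" .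
  have l1: "lw [1..k] a = lw [1..k - 1] a + a k" using k by (simp add: upto_rec2)
  have l2: "lw [- k..-1] a = a (- k) + lw [- k + 1..-1] a" using k by (simp add: upto_rec1)
  show ?case unfolding k' Om_rec[OF k(2)]
    by (simp only: distrib_left distrib_right sc_mult_left sc_mult_right 1 IH l1 l2
        quad_Suc_mono[OF assms(1), of d] Suc_le_lessD[OF Suc.prems] k')
      (simp add: scale_right_distrib power_add mult_ac add_ac)
qed

lemma lw_upd: "i \<notin> set is \<Longrightarrow> lw is (a(i := k)) = lw is a"
  by (metis fun_upd_apply map_cong)

lemma lw_upd_Suc:
  "distinct is \<Longrightarrow> i \<in> set is \<Longrightarrow> lw is (a(i := Suc (a i))) = Suc (lw is a)"
  by (induction "is") (auto simp: lw_upd)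

text \<open>As \<open>d < n\<close>, the inserted pair never has index 1. So every term adds exactly
  one letter among those that \<open>tau_inv\<close> counts, whence the one extra factor.\<close>

lemma quad_tau_inv:
  assumes a: "a \<in> expos n" and d: "d < n" and i: "i = 2 \<or> i = -2"
  shows "tau_inv n q \<phi> x i (quad d (m a))
    = (inverse q ^ Suc (lw (if i > 0 then [i..int n] else [- int n..i]) a)) \<star> quad d (m a)"
  using d
proof (induction d)
  case 0
  show ?case by (simp add: quad_0 lin_zero[OF lin_tau_inv] del: quad.simps)
next
  case (Suc d)
  define k where "k = int n - int d"
  have k: "2 \<le> k" "k \<le> int n" using Suc.prems by (auto simp: k_def)
  have k': "int n - int d = k" "int d - int n = - k" by (auto simp: k_def)
  have in': "k \<in> Iset n" "- k \<in> Iset n" using k by (auto simp: Iset_iff)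
  have "lw (if i > 0 then [i..int n] else [- int n..i]) (a(- k := Suc (a (- k)), k := Suc (a k)))
     = Suc (lw (if i > 0 then [i..int n] else [- int n..i]) a)"
    using i
  proof
    assume "i = 2"
    then show ?thesis using k lw_upd_Suc[of "[2..int n]" k "a(- k := Suc (a (- k)))"]
      by (simp add: lw_upd)
  next
    assume "i = -2"
    then show ?thesis using k lw_upd_Suc[of "[- int n..-2]" "- k" a]
      by (simp add: lw_upd)
  qed
  then show ?case using Suc in' a
    by (simp add: quad_Suc_mono k' lin_simps[OF lin_tau_inv] tau_inv_mono scale_right_distrib mult_ac
        del: quad.simps)
qed

text \<open>\<open>tau_inv\<close> removes exactly the power of \<open>q\<close> that the generator
  picks up on the way to its place.\<close>

lemma tau_inv_xL:
  assumes "1 \<le> j" "j \<le> int n"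
  shows "tau_inv n q \<phi> x (- j - 1) \<circ> xL x (- j) = raise (- j)"
proof (rule lin_eqI)
  fix a assume a: "a \<in> expos n"
  have "- j \<in> Iset n" using assms by (auto simp: Iset_iff)
  then show "(tau_inv n q \<phi> x (- j - 1) \<circ> xL x (- j)) (m a) = raise (- j) (m a)"
    using assms a q0
    by (simp add: xL_def xL_mono index_op_mono lin_scale[OF lin_tau_inv] tau_inv_mono lw_upd
        power_mult_distrib[symmetric])
qed (simp_all add: lin_intros lin_index_op)

lemma tau_inv_xR:
  assumes "1 \<le> j" "j \<le> int n"
  shows "tau_inv n q \<phi> x (j + 1) \<circ> xR x j = raise j"
proof (rule lin_eqI)
  fix a assume a: "a \<in> expos n"
  have "j \<in> Iset n" using assms by (auto simp: Iset_iff)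
  then show "(tau_inv n q \<phi> x (j + 1) \<circ> xR x j) (m a) = raise j (m a)"
    using assms a q0
    by (simp add: xR_def xR_mono index_op_mono lin_scale[OF lin_tau_inv] tau_inv_mono lw_upd
        power_mult_distrib[symmetric])
qed (simp_all add: lin_intros lin_index_op)

lemma pm1_Iset [simp]: "1 \<in> Iset n" "-1 \<in> Iset n"
  using n2 by (auto simp: Iset_iff)

text \<open>Multiplication from the hard side: \<open>x (-1)\<close> must pass its partner
  \<open>x 1\<close>, and the second term records the Omega left in the middle with one
  \<open>x 1\<close> consumed. \<open>x1_mono\<close> is the mirror image.\<close>

lemma mono_xm1:
  assumes a: "a \<in> expos n"
  shows "m a * x (-1) = (q ^ lw [2..int n] a) \<star> ((q ^ (2 * a 1)) \<star> m (a(-1 := Suc (a (-1))))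
    + (q ^ (a 1 + 1) * lam * qnum q (a 1) * q ^ (a 1 - 1 + a (-1))) \<star> quad2 (m (a(1 := a 1 - 1))))"
proof -
  let ?L = "seg [- int n..-1]" and ?R = "seg [2..int n] a" and ?a' = "a(1 := a 1 - 1)"
  have R: "seg [1..int n] b = x 1 ^ b 1 * seg [2..int n] b" for b
    using n2 by (simp add: upto_rec1[of 1] seg_Cons)
  have comm: "?R * x (-1) = (q ^ lw [2..int n] a) \<star> (x (-1) * ?R)"
    using n2 by (intro seg_commute_right x_swap) (auto simp: Iset_iff)
  have L: "?L a * x (-1) = ?L (a(-1 := Suc (a (-1))))"
    using seg_insert_left[of 1 a] n2 by simp
  have Om: "?L ?a' * Om 2 * seg [1..int n] ?a' = (q ^ (a 1 - 1 + a (-1))) \<star> quad2 (m ?a')"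
    using seg_Om_seg[of ?a' "n - 1"] n2 a by (simp add: of_nat_diff)
  have "m a * x (-1) = ?L a * x 1 ^ a 1 * (?R * x (-1))"
    by (simp add: m_seg R mult.assoc)
  also have "\<dots> = (q ^ lw [2..int n] a) \<star> (?L a * (x 1 ^ a 1 * x (-1)) * ?R)"
    by (simp add: comm sc_mult_right mult.assoc)
  also have "?L a * (x 1 ^ a 1 * x (-1)) * ?R
     = (q ^ (2 * a 1)) \<star> (?L a * x (-1) * (x 1 ^ a 1 * ?R))
       + (q ^ (a 1 + 1) * lam * qnum q (a 1)) \<star> (?L a * Om 2 * (x 1 ^ (a 1 - 1) * ?R))"
    by (simp add: x1_power_xm1 distrib_left distrib_right sc_mult_left sc_mult_right mult.assoc)
  also have "?L a * x (-1) * (x 1 ^ a 1 * ?R) = m (a(-1 := Suc (a (-1))))"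
    by (simp add: L m_seg R seg_upd)
  also have "?L a * Om 2 * (x 1 ^ (a 1 - 1) * ?R) = ?L ?a' * Om 2 * seg [1..int n] ?a'"
    by (simp add: R seg_upd)
  also note Om
  finally show ?thesis by (simp only: scale_scale)
qed

lemma x1_mono:
  assumes a: "a \<in> expos n"
  shows "x 1 * m a = (q ^ lw [- int n..-2] a) \<star> ((q ^ (2 * a (-1))) \<star> m (a(1 := Suc (a 1)))
    + (q ^ (a (-1) + 1) * lam * qnum q (a (-1)) * q ^ (a (-1) - 1 + a 1)) \<star> quad2 (m (a(-1 := a (-1) - 1))))"
proof -
  let ?L = "seg [- int n..-2] a" and ?R = "seg [1..int n]" and ?a' = "a(-1 := a (-1) - 1)"
  have L: "seg [- int n..-1] b = seg [- int n..-2] b * x (-1) ^ b (-1)" for b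
    using n2 by (simp add: upto_rec2[of "- int n" "-1"] seg_append seg_Cons)
  have comm: "x 1 * ?L = (q ^ lw [- int n..-2] a) \<star> (?L * x 1)"
    using n2 by (intro seg_commute_left x_swap) (auto simp: Iset_iff)
  have R: "x 1 * ?R a = ?R (a(1 := Suc (a 1)))"
    using seg_insert_right[of 1 a] n2 by simp
  have Om: "seg [- int n..-1] ?a' * Om 2 * ?R ?a' = (q ^ (a (-1) - 1 + a 1)) \<star> quad2 (m ?a')"
    using seg_Om_seg[of ?a' "n - 1"] n2 a by (simp add: of_nat_diff add.commute)
  have "x 1 * m a = (x 1 * ?L) * x (-1) ^ a (-1) * ?R a"
    by (simp add: m_seg L mult.assoc)
  also have "\<dots> = (q ^ lw [- int n..-2] a) \<star> (?L * (x 1 * x (-1) ^ a (-1)) * ?R a)"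
    by (simp add: comm sc_mult_left mult.assoc)
  also have "?L * (x 1 * x (-1) ^ a (-1)) * ?R a
     = (q ^ (2 * a (-1))) \<star> ((?L * x (-1) ^ a (-1)) * (x 1 * ?R a))
       + (q ^ (a (-1) + 1) * lam * qnum q (a (-1))) \<star> (?L * x (-1) ^ (a (-1) - 1) * Om 2 * ?R a)"
    by (simp add: x1_xm1_power distrib_left distrib_right sc_mult_left sc_mult_right mult.assoc)
  also have "(?L * x (-1) ^ a (-1)) * (x 1 * ?R a) = m (a(1 := Suc (a 1)))"
    by (simp add: L m_seg R seg_upd)
  also have "?L * x (-1) ^ (a (-1) - 1) * Om 2 * ?R a = seg [- int n..-1] ?a' * Om 2 * ?R ?a'"
    by (simp add: L seg_upd)
  also note Om
  finally show ?thesis by (simp only: scale_scale)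
qed

section \<open>Explicit form of the generators\<close>

text \<open>\<open>alpha k\<close> is the quantum integer of \<open>k\<close> for the parameter
  \<open>q ^ 2\<close>, and \<open>beta k\<close> is \<open>lam * q ^ k\<close> times the Gaussian
  binomial of \<open>k\<close> over 2.\<close>

definition alpha :: "nat \<Rightarrow> 'k" where "alpha k = qnum q k * (q ^ k + inverse q ^ k) / qnum q 2"
definition beta :: "nat \<Rightarrow> 'k" where
  "beta k = lam * q ^ k * qnum q k * qnum q (k - 1) / qnum q 2"

text \<open>These are A and B of the overview, for e_1 if \<open>s = 1\<close> and for f_1 if
  \<open>s = -1\<close>.\<close>

definition lin_part :: "int \<Rightarrow> 'a \<Rightarrow> 'a" where "lin_part s = raise (- s) \<circ> index_op s alpha (\<lambda>k. k - 1)"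
definition quad_part :: "int \<Rightarrow> 'a \<Rightarrow> 'a" where "quad_part s = mul_q (- s) \<circ> index_op s beta (\<lambda>k. k - 2)"

text \<open>The indices are free parameters, so that an identity proved once holds at every
  position, and the opposite generator is obtained by reversing them:
  \<open>root_op t s r p\<close>.\<close>

definition root_op :: "int \<Rightarrow> int \<Rightarrow> int \<Rightarrow> int \<Rightarrow> 'a \<Rightarrow> 'a" where
  "root_op p r s t = opadd (mul_q s \<circ> div_q t \<circ> raise p \<circ> lower r) (opsc \<phi> (-1) (raise s \<circ> lower t))"

text \<open>For \<^term>\<open>s = 1\<close> this is \<open>e\<^sub>j\<close>; for \<^term>\<open>s = - 1\<close> it is \<open>f\<^sub>1\<close> if \<^term>\<open>j = 1\<close> and
  \<open>-f\<^sub>j\<close> otherwise. Flipping the sign of all indices thus interchanges the two families.\<close>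

definition gen_op :: "int \<Rightarrow> int \<Rightarrow> 'a \<Rightarrow> 'a" where
  "gen_op s j = (if j = 1 then opadd (lin_part s) (quad_part s \<circ> quad2)
            else root_op (- (s * j)) (s * (1 - j)) (s * (j - 1)) (s * j))"

lemma lin_lin_part: "lin (lin_part s)" and lin_quad_part: "lin (quad_part s)" and lin_root_op: "lin (root_op i j k l)"
  by (simp_all only: lin_part_def quad_part_def root_op_def lin_intros lin_index_op)

lemma lin_gen_op: "lin (gen_op s j)"
  by (simp add: gen_op_def lin_intros lin_lin_part lin_quad_part lin_quad lin_root_op)

lemma e_op_eq_gen_op:
  assumes "2 \<le> i" "i \<le> n"
  shows "e_op n q \<phi> x i = gen_op 1 (int i)"
proof -
  have 1: "tau_inv n q \<phi> x (- int i - 1) (xL x (- int i) v) = raise (- int i) v" for v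
    using fun_cong[OF tau_inv_xL[of "int i"], of v] assms by simp
  have 2: "tau_inv n q \<phi> x (int i) (xR x (int i - 1) v) = raise (int i - 1) v" for v
    using fun_cong[OF tau_inv_xR[of "int i - 1"], of v] assms by simp
  show ?thesis
    using assms by (simp add: e_op_def gen_op_def root_op_def o_def Let_def 1 2 mu_eq mu_inv_eq der_eq)
qed

lemma f_op_eq_gen_op:
  assumes "2 \<le> i" "i \<le> n"
  shows "f_op n q \<phi> x i = opsc \<phi> (-1) (gen_op (-1) (int i))"
proof -
  have 1: "tau_inv n q \<phi> x (- int i) (xL x (1 - int i) v) = raise (1 - int i) v" for v
    using fun_cong[OF tau_inv_xL[of "int i - 1"], of v] assms by simp
  have 2: "tau_inv n q \<phi> x (int i + 1) (xR x (int i) v) = raise (int i) v" for v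
    using fun_cong[OF tau_inv_xR[of "int i"], of v] assms by simp
  show ?thesis
    using assms by (simp add: f_op_def gen_op_def root_op_def o_def Let_def 1 2 mu_eq mu_inv_eq der_eq
        opadd_def opsc_sc fun_eq_iff)
qed

text \<open>The inserted pair adds a letter that \<open>tau_inv\<close> counts, so the Omega term
  loses one more power of \<open>q\<close> than the other: the factor \<open>q ^ (a 1 + 1)\<close>
  of \<open>mono_xm1\<close> becomes \<open>q ^ a 1\<close>.\<close>

lemma tau_inv_xm1:
  assumes a: "a \<in> expos n"
  shows "tau_inv n q \<phi> x 2 (xR x (-1) (m a)) = (q ^ (2 * a 1)) \<star> m (a(-1 := Suc (a (-1))))
    + (q ^ a 1 * lam * qnum q (a 1) * q ^ (a 1 - 1 + a (-1))) \<star> quad2 (m (a(1 := a 1 - 1)))"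
  using a n2 by (simp add: xR_def mono_xm1 lin_simps[OF lin_tau_inv] tau_inv_mono quad_tau_inv lw_upd
      scale_right_distrib) (simp add: q0 field_simps)

lemma tau_inv_x1:
  assumes a: "a \<in> expos n"
  shows "tau_inv n q \<phi> x (-2) (xL x 1 (m a)) = (q ^ (2 * a (-1))) \<star> m (a(1 := Suc (a 1)))
    + (q ^ a (-1) * lam * qnum q (a (-1)) * q ^ (a (-1) - 1 + a 1)) \<star> quad2 (m (a(-1 := a (-1) - 1)))"
  using a n2 by (simp add: xL_def x1_mono lin_simps[OF lin_tau_inv] tau_inv_mono quad_tau_inv lw_upd
      scale_right_distrib) (simp add: q0 field_simps)

lemma qnum_2_ne: "qnum q 2 \<noteq> 0"
proof
  assume "qnum q 2 = 0"
  then have "q ^ 2 = inverse q ^ 2" using lam_ne by (simp add: qnum_def lam_def)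
  then have "q ^ 4 = 1" using q0 by (simp add: field_simps power2_eq_square eval_nat_numeral)
  then show False using q_not_root by auto
qed

text \<open>The shape in which the coefficient leaves the definition of e_1: left and right
  multiplication contribute \<open>1\<close> and \<open>q ^ 2 * q ^ (2 * k)\<close>, and
  \<open>mu_inv 1\<close> the factor \<open>inverse q ^ k\<close>.\<close>

lemma alpha_Suc: "alpha (Suc k) = inverse (qnum q 2) * inverse q * qnum q (Suc k)
    * (inverse q ^ k * (1 + q ^ 2 * q ^ (2 * k)))"
  using q0 by (simp add: alpha_def field_simps power_mult power2_eq_square power_mult_distrib)

text \<open>The operators that depend only on, and change only, exponents with index in \<open>J\<close>.\<close>

inductive Loc :: "int set \<Rightarrow> ('a \<Rightarrow> 'a) \<Rightarrow> bool" for J where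
  Loc_index_op: "i \<in> J \<Longrightarrow> i \<in> Iset n \<Longrightarrow> Loc J (index_op i c f)"
| Loc_add: "Loc J S \<Longrightarrow> Loc J T \<Longrightarrow> Loc J (opadd S T)"
| Loc_comp: "Loc J S \<Longrightarrow> Loc J T \<Longrightarrow> Loc J (S \<circ> T)"
| Loc_scale: "Loc J T \<Longrightarrow> Loc J (opsc \<phi> c T)"
| Loc_id: "Loc J id"

lemma Loc_lin: "Loc J T \<Longrightarrow> lin T"
  by (induction rule: Loc.induct) (simp_all only: lin_intros lin_index_op)

lemma Loc_mono: "Loc J T \<Longrightarrow> J \<subseteq> J' \<Longrightarrow> Loc J' T"
  by (induction rule: Loc.induct) (auto intro: Loc.intros)

lemma index_op_commute:
  assumes "i \<noteq> j" "i \<in> Iset n" "j \<in> Iset n"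
  shows "index_op i c f (index_op j d g v) = index_op j d g (index_op i c f v)"
proof -
  have "index_op i c f \<circ> index_op j d g = index_op j d g \<circ> index_op i c f"
    using assms by (intro lin_eqI)
      (auto simp: lin_comp lin_index_op index_op_mono lin_scale[OF lin_index_op] mult.commute fun_upd_twist)
  then show ?thesis by (metis comp_apply)
qed

text \<open>One induction takes a single \<open>index_op\<close> through \<open>T\<close>, a second
  one builds \<open>S\<close> from such operators.\<close>

lemma Loc_commute:
  assumes "Loc J S" "Loc J' T" "J \<inter> J' = {}"
  shows "S (T v) = T (S v)"
proof -
  have 1: "index_op i c f (T v) = T (index_op i c f v)" if "i \<in> J" "i \<in> Iset n" for i c f v
    using assms(2)
  proof (induction arbitrary: v rule: Loc.induct)
    case (Loc_index_op j d g)
    then show ?case using assms(3) that by (intro index_op_commute) auto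
  qed (auto simp: opadd_def opsc_sc lin_simps[OF lin_index_op])
  show ?thesis
    using assms(1)
    by (induction arbitrary: v rule: Loc.induct)
      (auto simp: opadd_def opsc_sc lin_simps[OF Loc_lin[OF assms(2)]] 1)
qed

lemma Loc_quad: "d \<le> n \<Longrightarrow> Loc {j. int n - d < \<bar>j\<bar>} (quad d)"
proof (induction d)
  case 0
  show ?case by (simp add: Loc.intros)
next
  case (Suc d)
  then have "Loc {j. int n - int (Suc d) < \<bar>j\<bar>} (quad d)"
    by (intro Loc_mono[OF Suc.IH]) auto
  then show ?case using Suc.prems
    by (auto intro!: Loc.intros simp: Iset_iff)
qed

lemma Loc_quad2: "Loc {j. 1 < \<bar>j\<bar>} quad2"
  using Loc_quad[of "n - 1"] n2 by (simp add: of_nat_diff)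

lemma Loc_lin_part: "s = 1 \<or> s = -1 \<Longrightarrow> Loc {-1, 1} (lin_part s)"
  and Loc_quad_part: "s = 1 \<or> s = -1 \<Longrightarrow> Loc {-1, 1} (quad_part s)"
  unfolding lin_part_def quad_part_def by (auto intro!: Loc.intros)

lemma Loc_root_op: "{i, j, k, l} \<subseteq> Iset n \<Longrightarrow> Loc {i, j, k, l} (root_op i j k l)"
  unfolding root_op_def by (auto intro!: Loc.intros)

lemma quad2_lin_part: "s = 1 \<or> s = -1 \<Longrightarrow> quad2 (lin_part s v) = lin_part s (quad2 v)"
  and quad2_quad_part: "s = 1 \<or> s = -1 \<Longrightarrow> quad2 (quad_part s v) = quad_part s (quad2 v)"
  by (rule Loc_commute[OF Loc_quad2 Loc_lin_part] Loc_commute[OF Loc_quad2 Loc_quad_part]; auto)+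

lemma G1_mono:
  assumes "a \<in> expos n" "s = 1 \<or> s = -1"
  shows "gen_op s 1 (m a) = alpha (a s) \<star> m (a(s := a s - 1, - s := Suc (a (- s))))
    + (beta (a s) * q ^ a (- s)) \<star> quad2 (m (a(s := a s - 2)))"
proof -
  have "gen_op s 1 (m a) = lin_part s (m a) + quad2 (quad_part s (m a))"
    using assms by (simp add: gen_op_def opadd_def quad2_quad_part)
  then show ?thesis using assms
    by (auto simp: fun_upd_idem lin_part_def quad_part_def index_op_mono lin_scale[OF lin_index_op] lin_scale[OF lin_quad])
qed

lemma quad2_div_q: "i = 1 \<or> i = -1 \<Longrightarrow> div_q i (quad2 v) = quad2 (div_q i v)"
  by (rule Loc_commute[OF Loc_index_op[of _ "{-1, 1}"] Loc_quad2]) auto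

text \<open>The counterpart of \<open>alpha_Suc\<close> for the Omega term; the last factor is
  \<open>mu_inv 1\<close> on the \<open>k - 1\<close> remaining letters. For \<open>k = 0\<close>
  both sides vanish.\<close>

lemma beta_Suc: "beta (Suc k) * q ^ l = inverse (qnum q 2) * inverse q * qnum q (Suc k) * q ^ 2
    * (q ^ k * lam * qnum q k * q ^ (k - 1 + l) * inverse q ^ (k - 1))"
  using q0 by (cases k) (simp_all add: beta_def field_simps power2_eq_square power_add)

lemma e_op_1: "e_op n q \<phi> x 1 = gen_op 1 1"
proof (rule lin_eqI)
  fix a assume a: "a \<in> expos n"
  have 1: "tau_inv n q \<phi> x (-2) (xL x (-1) v) = raise (-1) v" for v
    using fun_cong[OF tau_inv_xL[of 1], of v] n2 by simp
  show "e_op n q \<phi> x 1 (m a) = gen_op 1 1 (m a)"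
  proof (cases "a 1")
    case 0
    then show ?thesis using a
      by (simp add: e_op_def opadd_def opsc_sc 1 G1_mono der_mono alpha_def beta_def
          lin_simps[OF lin_tau_inv] lin_simps[OF lin_xR] lin_simps[OF lin_index_op] lin_simps[OF lin_mu_inv])
  next
    case (Suc k)
    then have gen_op: "gen_op 1 1 (m a) = alpha (Suc k) \<star> m (a(1 := k, -1 := Suc (a (-1))))
        + (beta (Suc k) * q ^ a (-1)) \<star> quad2 (m (a(1 := k - 1)))"
      using G1_mono[OF a, of 1] by simp
    show ?thesis unfolding gen_op beta_Suc alpha_Suc using a n2 Suc
      by (simp add: e_op_def opadd_def opsc_sc 1 der_mono lin_simps[OF lin_tau_inv]
          lin_simps[OF lin_xR] lin_simps[OF lin_index_op] mu_inv_eq tau_inv_xm1 quad2_div_q lin_simps[OF lin_quad] index_op_mono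
          scale_right_distrib distrib_left scale_left_distrib mult_ac fun_upd_twist
          del: quad.simps)
  qed
qed (simp_all add: e_op_def lin_intros lin_gen_op)

lemma f_op_1: "f_op n q \<phi> x 1 = gen_op (-1) 1"
proof (rule lin_eqI)
  fix a assume a: "a \<in> expos n"
  have 1: "tau_inv n q \<phi> x 2 (xR x 1 v) = raise 1 v" for v
    using fun_cong[OF tau_inv_xR[of 1], of v] n2 by simp
  show "f_op n q \<phi> x 1 (m a) = gen_op (-1) 1 (m a)"
  proof (cases "a (-1)")
    case 0
    then show ?thesis using a
      by (simp add: f_op_def opadd_def opsc_sc 1 G1_mono der_mono alpha_def beta_def
          lin_simps[OF lin_tau_inv] lin_simps[OF lin_xL] lin_simps[OF lin_index_op] lin_simps[OF lin_mu_inv])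
  next
    case (Suc k)
    then have gen_op: "gen_op (-1) 1 (m a) = alpha (Suc k) \<star> m (a(-1 := k, 1 := Suc (a 1)))
        + (beta (Suc k) * q ^ a 1) \<star> quad2 (m (a(-1 := k - 1)))"
      using G1_mono[OF a, of "-1"] by simp
    show ?thesis unfolding gen_op beta_Suc alpha_Suc using a n2 Suc
      by (simp add: f_op_def opadd_def opsc_sc 1 der_mono lin_simps[OF lin_tau_inv]
          lin_simps[OF lin_xL] lin_simps[OF lin_index_op] mu_inv_eq tau_inv_x1 quad2_div_q lin_simps[OF lin_quad] index_op_mono
          scale_right_distrib distrib_left scale_left_distrib mult_ac fun_upd_twist
          del: quad.simps)
  qed
qed (simp_all add: f_op_def lin_intros lin_gen_op)

section \<open>Commutators of the root operators\<close>

lemma lin_plus_fun: "lin S \<Longrightarrow> lin T \<Longrightarrow> lin (\<lambda>v. S v + T v)"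
  and lin_minus_fun: "lin S \<Longrightarrow> lin T \<Longrightarrow> lin (\<lambda>v. S v - T v)"
  and lin_scale_fun: "lin T \<Longrightarrow> lin (\<lambda>v. c \<star> T v)"
  and lin_comp_fun: "lin S \<Longrightarrow> lin T \<Longrightarrow> lin (\<lambda>v. S (T v))"
  and lin_ident: "lin (\<lambda>v. v)"
  by (rule linI; simp add: lin_simps scale_right_distrib scale_right_diff_distrib mult.commute)+

lemma lin_index_op_fun: "lin T \<Longrightarrow> lin (\<lambda>v. index_op i c f (T v))"
  by (rule lin_comp_fun[OF lin_index_op])

lemmas lin_funs = lin_plus_fun lin_minus_fun lin_scale_fun lin_index_op_fun lin_ident

text \<open>The exponents at the listed indices are kept in an explicit list and all others in
  \<open>a\<close>. Operators then rewrite list entries, and no function updates at unknown indices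
  have to be permuted.\<close>

definition mono_fam :: "(int \<Rightarrow> nat) \<Rightarrow> int list \<Rightarrow> nat list \<Rightarrow> 'a" where
  "mono_fam a is ks = m (\<lambda>i. case map_of (zip is ks) i of None \<Rightarrow> a i | Some k \<Rightarrow> k)"

lemma mono_fam_self: "mono_fam a is (map a is) = m a"
proof -
  have "(case map_of (zip is (map a is)) i of None \<Rightarrow> a i | Some k \<Rightarrow> k) = a i" for i
    by (induction "is") auto
  then show ?thesis by (simp add: mono_fam_def)
qed

lemma index_op_mono_fam:
  assumes "a \<in> expos n" "set is \<subseteq> Iset n" "distinct is" "length ks = length is" "j < length is"
  shows "index_op (is ! j) c f (mono_fam a is ks) = c (ks ! j) \<star> mono_fam a is (ks[j := f (ks ! j)])"
proof -
  let ?b = "\<lambda>ks i. case map_of (zip is ks) i of None \<Rightarrow> a i | Some k \<Rightarrow> k"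
  have at: "?b ks (is ! l) = ks ! l" if "length ks = length is" "l < length is" for ks l
    using map_of_zip_nth[of "is" ks l] that assms(3) by simp
  have off: "?b ks i = a i" if "length ks = length is" "i \<notin> set is" for ks i
  proof -
    have "map_of (zip is ks) i = None" using that by (simp add: map_of_zip_is_None)
    then show ?thesis by simp
  qed
  have "?b ks \<in> expos n"
    unfolding expos_def
  proof safe
    fix i assume "i \<notin> Iset n"
    then have "i \<notin> set is" "a i = 0" using assms(1,2) by (auto simp: expos_def)
    then show "?b ks i = 0" using off[OF assms(4)] by simp
  qed
  moreover have "(?b ks)(is ! j := f (ks ! j)) = ?b (ks[j := f (ks ! j)])"
  proof
    fix i
    show "((?b ks)(is ! j := f (ks ! j))) i = ?b (ks[j := f (ks ! j)]) i"
    proof (cases "i \<in> set is")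
      case True
      then obtain l where l: "l < length is" "i = is ! l" by (auto simp: in_set_conv_nth)
      have "?b (ks[j := f (ks ! j)]) i = ks[j := f (ks ! j)] ! l"
        unfolding l(2) by (rule at) (use assms l in auto)
      moreover have "?b ks i = ks ! l" unfolding l(2) by (rule at) (use assms l in auto)
      ultimately show ?thesis
        using l assms by (auto simp: nth_list_update nth_eq_iff_index_eq)
    next
      case False
      then show ?thesis using assms off[of ks i] off[of "ks[j := f (ks ! j)]" i] by auto
    qed
  qed
  ultimately show ?thesis
    using at[OF assms(4,5)] by (simp add: mono_fam_def index_op_mono)
qed

text \<open>Every monomial belongs to such a family, with its own exponents as list, so checking the
  family for all lists suffices.\<close>

lemma lin_ext:
  assumes "lin S" "lin T" "length is = l"
    "\<And>a ks. a \<in> expos n \<Longrightarrow> length ks = l \<Longrightarrow> S (mono_fam a is ks) = T (mono_fam a is ks)"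
  shows "S v = T v"
proof -
  have "S = T"
  proof (rule lin_eqI[OF assms(1,2)])
    fix a assume "a \<in> expos n"
    then show "S (m a) = T (m a)" using assms(4)[of a "map a is"] assms(3) by (simp add: mono_fam_self)
  qed
  then show ?thesis by simp
qed

lemma index_op_mono_fam4:
  assumes "a \<in> expos n" "distinct [p, r, s, t]" "{p, r, s, t} \<subseteq> Iset n"
  shows "index_op p c f (mono_fam a [p, r, s, t] [k1, k2, k3, k4]) = c k1 \<star> mono_fam a [p, r, s, t] [f k1, k2, k3, k4]"
    "index_op r c f (mono_fam a [p, r, s, t] [k1, k2, k3, k4]) = c k2 \<star> mono_fam a [p, r, s, t] [k1, f k2, k3, k4]"
    "index_op s c f (mono_fam a [p, r, s, t] [k1, k2, k3, k4]) = c k3 \<star> mono_fam a [p, r, s, t] [k1, k2, f k3, k4]"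
    "index_op t c f (mono_fam a [p, r, s, t] [k1, k2, k3, k4]) = c k4 \<star> mono_fam a [p, r, s, t] [k1, k2, k3, f k4]"
  using index_op_mono_fam[OF assms(1), of "[p, r, s, t]" "[k1, k2, k3, k4]" 0 c f]
    index_op_mono_fam[OF assms(1), of "[p, r, s, t]" "[k1, k2, k3, k4]" 1 c f]
    index_op_mono_fam[OF assms(1), of "[p, r, s, t]" "[k1, k2, k3, k4]" 2 c f]
    index_op_mono_fam[OF assms(1), of "[p, r, s, t]" "[k1, k2, k3, k4]" 3 c f] assms
  by (simp_all add: eval_nat_numeral)

lemma index_op_mono_fam6:
  assumes "a \<in> expos n" "distinct [p, r, s, t, u, w]" "{p, r, s, t, u, w} \<subseteq> Iset n"
  shows "index_op p c f (mono_fam a [p, r, s, t, u, w] [k1, k2, k3, k4, k5, k6])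
      = c k1 \<star> mono_fam a [p, r, s, t, u, w] [f k1, k2, k3, k4, k5, k6]"
    "index_op r c f (mono_fam a [p, r, s, t, u, w] [k1, k2, k3, k4, k5, k6])
      = c k2 \<star> mono_fam a [p, r, s, t, u, w] [k1, f k2, k3, k4, k5, k6]"
    "index_op s c f (mono_fam a [p, r, s, t, u, w] [k1, k2, k3, k4, k5, k6])
      = c k3 \<star> mono_fam a [p, r, s, t, u, w] [k1, k2, f k3, k4, k5, k6]"
    "index_op t c f (mono_fam a [p, r, s, t, u, w] [k1, k2, k3, k4, k5, k6])
      = c k4 \<star> mono_fam a [p, r, s, t, u, w] [k1, k2, k3, f k4, k5, k6]"
    "index_op u c f (mono_fam a [p, r, s, t, u, w] [k1, k2, k3, k4, k5, k6])
      = c k5 \<star> mono_fam a [p, r, s, t, u, w] [k1, k2, k3, k4, f k5, k6]"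
    "index_op w c f (mono_fam a [p, r, s, t, u, w] [k1, k2, k3, k4, k5, k6])
      = c k6 \<star> mono_fam a [p, r, s, t, u, w] [k1, k2, k3, k4, k5, f k6]"
  using index_op_mono_fam[OF assms(1), of "[p, r, s, t, u, w]" "[k1, k2, k3, k4, k5, k6]" 0 c f]
    index_op_mono_fam[OF assms(1), of "[p, r, s, t, u, w]" "[k1, k2, k3, k4, k5, k6]" 1 c f]
    index_op_mono_fam[OF assms(1), of "[p, r, s, t, u, w]" "[k1, k2, k3, k4, k5, k6]" 2 c f]
    index_op_mono_fam[OF assms(1), of "[p, r, s, t, u, w]" "[k1, k2, k3, k4, k5, k6]" 3 c f]
    index_op_mono_fam[OF assms(1), of "[p, r, s, t, u, w]" "[k1, k2, k3, k4, k5, k6]" 4 c f]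
    index_op_mono_fam[OF assms(1), of "[p, r, s, t, u, w]" "[k1, k2, k3, k4, k5, k6]" 5 c f] assms
  by (simp_all add: eval_nat_numeral)

lemma lin_ext4:
  assumes "lin S" "lin T"
    "\<And>a k1 k2 k3 k4. a \<in> expos n \<Longrightarrow>
      S (mono_fam a [p, r, s, t] [k1, k2, k3, k4]) = T (mono_fam a [p, r, s, t] [k1, k2, k3, k4])"
  shows "S v = T v"
proof (rule lin_ext[OF assms(1,2)])
  show "length [p, r, s, t] = 4" by simp
  fix a and ks :: "nat list" assume "a \<in> expos n" "length ks = 4"
  then show "S (mono_fam a [p, r, s, t] ks) = T (mono_fam a [p, r, s, t] ks)"
    using assms(3) by (auto simp: eval_nat_numeral length_Suc_conv)
qed

lemma lin_ext6:
  assumes "lin S" "lin T"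
    "\<And>a k1 k2 k3 k4 k5 k6. a \<in> expos n \<Longrightarrow>
      S (mono_fam a [p, r, s, t, u, w] [k1, k2, k3, k4, k5, k6])
      = T (mono_fam a [p, r, s, t, u, w] [k1, k2, k3, k4, k5, k6])"
  shows "S v = T v"
proof (rule lin_ext[OF assms(1,2)])
  show "length [p, r, s, t, u, w] = 6" by simp
  fix a and ks :: "nat list" assume "a \<in> expos n" "length ks = 6"
  then show "S (mono_fam a [p, r, s, t, u, w] ks) = T (mono_fam a [p, r, s, t, u, w] ks)"
    using assms(3) by (auto simp: eval_nat_numeral length_Suc_conv)
qed

lemma sc_cong: "c = d \<Longrightarrow> c \<star> v = d \<star> v" by simp

text \<open>Together with \<open>q_power_qnum\<close> this turns coefficients into polynomials in
  the quantum integer and the inverse power of \<open>q\<close>, in which identities are plain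
  algebra.\<close>

lemma qnum_Suc: "qnum q (Suc k) = q * qnum q k + inverse q ^ k"
proof -
  have "lam * qnum q (Suc k) = lam * (q * qnum q k + inverse q ^ k)"
    by (simp add: distrib_left mult.left_commute[of lam] qnum_lam) (simp add: lam_def algebra_simps)
  then show ?thesis using lam_ne by simp
qed

lemma q_power_qnum: "q ^ k = inverse q ^ k + lam * qnum q k"
  by (simp add: qnum_lam)

lemmas eval = lin_scale[OF lin_index_op] lin_zero[OF lin_index_op]

section \<open>Commutators of two root operators\<close>

definition root_op1 :: "int \<Rightarrow> int \<Rightarrow> int \<Rightarrow> int \<Rightarrow> 'a \<Rightarrow> 'a" where
  "root_op1 p r s t v = mul_q s (div_q t (raise p (lower r v)))"
definition root_op2 :: "int \<Rightarrow> int \<Rightarrow> 'a \<Rightarrow> 'a" where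
  "root_op2 s t v = raise s (lower t v)"

lemma root_op_root_op1_root_op2: "root_op p r s t v = root_op1 p r s t v - root_op2 s t v"
  by (simp add: root_op_def root_op1_def root_op2_def opadd_def opsc_sc)

lemma lin_root_op1: "lin (root_op1 p r s t)" and lin_root_op2: "lin (root_op2 s t)"
  unfolding root_op1_def root_op2_def by (intro lin_funs)+

context
  fixes p r s t :: int
  assumes d: "distinct [p, r, s, t]" "{p, r, s, t} \<subseteq> Iset n"
begin


text \<open>In either order the diagonal factors of the operator applied last see two shifted
  exponents, which costs the same \<open>inverse q ^ 2\<close>.\<close>

lemma root_op1_root_op1: "root_op1 p r s t (root_op1 t s r p v) = root_op1 t s r p (root_op1 p r s t v)"
  unfolding root_op1_def
proof (rule lin_ext4[of _ _ p r s t v], intro lin_funs, intro lin_funs)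
  fix a k1 k2 k3 k4 assume a: "a \<in> expos n"
  let ?F = "mono_fam a [p, r, s, t] [k1, k2, k3, k4]"
  show "mul_q s (div_q t (raise p (lower r (mul_q r (div_q p (raise t (lower s ?F)))))))
      = mul_q r (div_q p (raise t (lower s (mul_q s (div_q t (raise p (lower r ?F)))))))"
    using q0 by (cases k2; cases k3) (simp_all add: index_op_mono_fam4[OF a d] eval)
qed

lemma root_op2_root_op2: "root_op2 s t (root_op2 r p v) = root_op2 r p (root_op2 s t v)"
  unfolding root_op2_def
proof (rule lin_ext4[of _ _ p r s t v], intro lin_funs, intro lin_funs)
  fix a k1 k2 k3 k4 assume a: "a \<in> expos n"
  let ?F = "mono_fam a [p, r, s, t] [k1, k2, k3, k4]"
  show "raise s (lower t (raise r (lower p ?F))) = raise r (lower p (raise s (lower t ?F)))"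
    by (simp add: index_op_mono_fam4[OF a d] eval)
qed

lemma root_op1_root_op2_commutator:
  "root_op1 p r s t (root_op2 r p v) - root_op2 r p (root_op1 p r s t v)
    = inverse lam \<star> (mul_q p (div_q r (mul_q s (div_q t v))) - div_q p (mul_q r (mul_q s (div_q t v))))"
  unfolding root_op1_def root_op2_def
proof (rule lin_ext4[of _ _ p r s t v], intro lin_funs, intro lin_funs)
  fix a k1 k2 k3 k4 assume a: "a \<in> expos n"
  let ?F = "mono_fam a [p, r, s, t] [k1, k2, k3, k4]"
  have c: "qnum q k * qnum q (Suc l) - qnum q l * qnum q (Suc k)
    = inverse lam * (q ^ k * inverse q ^ l - inverse q ^ k * q ^ l)" for k l
  proof -
    \<comment> \<open>Here \<open>z\<close>, \<open>w\<close> stand for the quantum integers of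
      \<open>k\<close>, \<open>l\<close>, and \<open>i\<close>, \<open>j\<close> for the inverse
      powers of \<open>q\<close>.\<close>
    have "z * (q * w + j) - w * (q * z + i) = inverse lam * ((i + lam * z) * j - i * (j + lam * w))"
      for z w i j using lam_ne by (simp add: field_simps)
    then show ?thesis by (simp only: qnum_Suc q_power_qnum)
  qed
  have 1: "mul_q s (div_q t (raise p (lower r (raise r (lower p ?F)))))
      = (qnum q k1 * qnum q (Suc k2) * (q ^ k3 * inverse q ^ k4)) \<star> ?F"
    by (cases k1) (simp_all add: index_op_mono_fam4[OF a d] eval)
  have 2: "raise r (lower p (mul_q s (div_q t (raise p (lower r ?F)))))
      = (qnum q k2 * qnum q (Suc k1) * (q ^ k3 * inverse q ^ k4)) \<star> ?F"
    by (cases k2) (simp_all add: index_op_mono_fam4[OF a d] eval)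
  have 3: "mul_q p (div_q r (mul_q s (div_q t ?F))) = (q ^ k1 * inverse q ^ k2 * (q ^ k3 * inverse q ^ k4)) \<star> ?F"
    "div_q p (mul_q r (mul_q s (div_q t ?F))) = (inverse q ^ k1 * q ^ k2 * (q ^ k3 * inverse q ^ k4)) \<star> ?F"
    by (simp_all add: index_op_mono_fam4[OF a d] eval)
  show "mul_q s (div_q t (raise p (lower r (raise r (lower p ?F))))) - raise r (lower p (mul_q s (div_q t (raise p (lower r ?F)))))
      = inverse lam \<star> (mul_q p (div_q r (mul_q s (div_q t ?F))) - div_q p (mul_q r (mul_q s (div_q t ?F))))"
    unfolding 1 2 3 scale_left_diff_distrib[symmetric] scale_scale left_diff_distrib[symmetric] c
    by (simp only: mult.assoc)
qed

lemma diag_reverse: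
  "index_op t c1 (\<lambda>k. k) (index_op s c2 (\<lambda>k. k) (index_op r c3 (\<lambda>k. k) (index_op p c4 (\<lambda>k. k) v)))
    = index_op p c4 (\<lambda>k. k) (index_op r c3 (\<lambda>k. k) (index_op s c2 (\<lambda>k. k) (index_op t c1 (\<lambda>k. k) v)))"
proof (rule lin_ext4[of _ _ p r s t v], intro lin_funs, intro lin_funs)
  fix a k1 k2 k3 k4 assume a: "a \<in> expos n"
  let ?F = "mono_fam a [p, r, s, t] [k1, k2, k3, k4]"
  show "index_op t c1 (\<lambda>k. k) (index_op s c2 (\<lambda>k. k) (index_op r c3 (\<lambda>k. k) (index_op p c4 (\<lambda>k. k) ?F)))
    = index_op p c4 (\<lambda>k. k) (index_op r c3 (\<lambda>k. k) (index_op s c2 (\<lambda>k. k) (index_op t c1 (\<lambda>k. k) ?F)))"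
    by (simp add: index_op_mono_fam4[OF a d] eval)
qed

end

text \<open>Terms of the same kind commute. Each of the two mixed commutators is a difference of two
  diagonal operators, one of which occurs in both and cancels.\<close>

lemma root_op_root_op_diag:
  assumes d: "distinct [p, r, s, t]" "{p, r, s, t} \<subseteq> Iset n"
  shows "root_op p r s t (root_op t s r p v) - root_op t s r p (root_op p r s t v)
    = inverse lam \<star> (div_q p (mul_q r (div_q s (mul_q t v))) - mul_q p (div_q r (mul_q s (div_q t v))))"
proof -
  have d': "distinct [t, s, r, p]" "{t, s, r, p} \<subseteq> Iset n" using assms by auto
  have "root_op p r s t (root_op t s r p v) - root_op t s r p (root_op p r s t v)
    = (root_op1 t s r p (root_op2 s t v) - root_op2 s t (root_op1 t s r p v)) - (root_op1 p r s t (root_op2 r p v) - root_op2 r p (root_op1 p r s t v))"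
    by (simp add: root_op_root_op1_root_op2 lin_minus[OF lin_root_op1] lin_minus[OF lin_root_op2] root_op1_root_op1[OF d]
        root_op2_root_op2[OF d] algebra_simps)
  then show ?thesis
    unfolding root_op1_root_op2_commutator[OF d] root_op1_root_op2_commutator[OF d'] diag_reverse[OF d]
    by (simp add: scale_right_diff_distrib)
qed

text \<open>Neighbouring positions share exactly the indices \<open>p\<close> and \<open>t\<close>.
  The effects of the two shared exponents compensate term by term, so even the single summands
  commute.\<close>

lemma root_op_root_op_adjacent:
  assumes d: "distinct [p, r, s, t, u, w]" "{p, r, s, t, u, w} \<subseteq> Iset n"
  shows "root_op p r s t (root_op u t p w v) = root_op u t p w (root_op p r s t v)"
proof -
  have TT: "root_op1 p r s t (root_op1 u t p w v) = root_op1 u t p w (root_op1 p r s t v)" for v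
    unfolding root_op1_def
  proof (rule lin_ext6[of _ _ p r s t u w v], intro lin_funs, intro lin_funs)
    fix a k1 k2 k3 k4 k5 k6 assume a: "a \<in> expos n"
    let ?F = "mono_fam a [p, r, s, t, u, w] [k1, k2, k3, k4, k5, k6]"
    show "mul_q s (div_q t (raise p (lower r (mul_q p (div_q w (raise u (lower t ?F)))))))
      = mul_q p (div_q w (raise u (lower t (mul_q s (div_q t (raise p (lower r ?F)))))))"
      using q0 by (cases k4) (simp_all add: index_op_mono_fam6[OF a d] eval)
  qed
  have TH: "root_op1 p r s t (root_op2 p w v) = root_op2 p w (root_op1 p r s t v)" for v
    unfolding root_op1_def root_op2_def
  proof (rule lin_ext6[of _ _ p r s t u w v], intro lin_funs, intro lin_funs)
    fix a k1 k2 k3 k4 k5 k6 assume a: "a \<in> expos n"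
    let ?F = "mono_fam a [p, r, s, t, u, w] [k1, k2, k3, k4, k5, k6]"
    show "mul_q s (div_q t (raise p (lower r (raise p (lower w ?F))))) = raise p (lower w (mul_q s (div_q t (raise p (lower r ?F)))))"
      by (simp add: index_op_mono_fam6[OF a d] eval)
  qed
  have HT: "root_op2 s t (root_op1 u t p w v) = root_op1 u t p w (root_op2 s t v)" for v
    unfolding root_op1_def root_op2_def
  proof (rule lin_ext6[of _ _ p r s t u w v], intro lin_funs, intro lin_funs)
    fix a k1 k2 k3 k4 k5 k6 assume a: "a \<in> expos n"
    let ?F = "mono_fam a [p, r, s, t, u, w] [k1, k2, k3, k4, k5, k6]"
    show "raise s (lower t (mul_q p (div_q w (raise u (lower t ?F))))) = mul_q p (div_q w (raise u (lower t (raise s (lower t ?F)))))"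
      by (simp add: index_op_mono_fam6[OF a d] eval)
  qed
  have HH: "root_op2 s t (root_op2 p w v) = root_op2 p w (root_op2 s t v)" for v
    unfolding root_op2_def
  proof (rule lin_ext6[of _ _ p r s t u w v], intro lin_funs, intro lin_funs)
    fix a k1 k2 k3 k4 k5 k6 assume a: "a \<in> expos n"
    let ?F = "mono_fam a [p, r, s, t, u, w] [k1, k2, k3, k4, k5, k6]"
    show "raise s (lower t (raise p (lower w ?F))) = raise p (lower w (raise s (lower t ?F)))"
      by (simp add: index_op_mono_fam6[OF a d] eval)
  qed
  show ?thesis
    by (simp add: root_op_root_op1_root_op2 lin_minus[OF lin_root_op1] lin_minus[OF lin_root_op2] TT TH HT HH)
qed

text \<open>The truncation of the quadratic element to two adjacent indices commutes with the root
  operator connecting them.\<close>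

lemma root_op_commute_quadratic:
  assumes d: "distinct [p, r, s, t]" "{p, r, s, t} \<subseteq> Iset n"
  shows "root_op p r s t (raise r (raise s v) + q \<star> mul_q r (mul_q s (raise p (raise t v))))
    = raise r (raise s (root_op p r s t v)) + q \<star> mul_q r (mul_q s (raise p (raise t (root_op p r s t v))))"
    and "root_op p r s t (mul_q r (mul_q s (mul_q p (mul_q t v)))) = mul_q r (mul_q s (mul_q p (mul_q t (root_op p r s t v))))"
proof -
  \<comment> \<open>The only pairings that fail to commute: the defect of the first summand with the
    inner pair equals that of the second summand with the outer pair.\<close>
  have TP: "root_op1 p r s t (raise r (raise s v)) - raise r (raise s (root_op1 p r s t v))
    = q \<star> (root_op2 s t (mul_q r (mul_q s (raise p (raise t v)))) - mul_q r (mul_q s (raise p (raise t (root_op2 s t v)))))"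
    unfolding root_op1_def root_op2_def
  proof (rule lin_ext4[of _ _ p r s t v], intro lin_funs, intro lin_funs)
    fix a k1 k2 k3 k4 assume a: "a \<in> expos n"
    let ?F = "mono_fam a [p, r, s, t] [k1, k2, k3, k4]"
    let ?v = "mono_fam a [p, r, s, t] [Suc k1, k2, Suc k3, k4]"
    have 1: "mul_q s (div_q t (raise p (lower r (raise r (raise s ?F)))))
      = (qnum q (Suc k2) * q ^ Suc k3 * inverse q ^ k4) \<star> ?v"
      by (simp add: index_op_mono_fam4[OF a d] eval)
    have 2: "raise r (raise s (mul_q s (div_q t (raise p (lower r ?F)))))
      = (qnum q k2 * q ^ k3 * inverse q ^ k4) \<star> ?v"
      by (cases k2) (simp_all add: index_op_mono_fam4[OF a d] eval)
    have 3: "raise s (lower t (mul_q r (mul_q s (raise p (raise t ?F)))))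
      = (qnum q (Suc k4) * q ^ k2 * q ^ k3) \<star> ?v"
      by (simp add: index_op_mono_fam4[OF a d] eval)
    have 4: "mul_q r (mul_q s (raise p (raise t (raise s (lower t ?F)))))
      = (qnum q k4 * q ^ k2 * q ^ Suc k3) \<star> ?v"
      by (cases k4) (simp_all add: index_op_mono_fam4[OF a d] eval)
    \<comment> \<open>The shifted exponent of \<open>s\<close> supplies the extra \<open>q\<close>;
      with it the difference of quantum integers collapses to a power of \<open>q\<close>.\<close>
    have e: "q * qnum q (Suc k) - qnum q k = q * q ^ k" for k
    proof -
      have "q * (q * z + i) - z = q * (i + (q - inverse q) * z)" for z i
        using q0 by (simp add: algebra_simps)
      then show ?thesis by (simp only: qnum_Suc q_power_qnum lam_def)
    qed
    have "qnum q (Suc k2) * q ^ Suc k3 * inverse q ^ k4 - qnum q k2 * q ^ k3 * inverse q ^ k4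
        = q ^ k3 * inverse q ^ k4 * (q * qnum q (Suc k2) - qnum q k2)"
      by (simp add: algebra_simps)
    also have "\<dots> = q * (qnum q (Suc k4) * q ^ k2 * q ^ k3 - qnum q k4 * q ^ k2 * q ^ Suc k3)"
      unfolding e by (simp add: qnum_Suc algebra_simps)
    finally show "mul_q s (div_q t (raise p (lower r (raise r (raise s ?F))))) - raise r (raise s (mul_q s (div_q t (raise p (lower r ?F)))))
      = q \<star> (raise s (lower t (mul_q r (mul_q s (raise p (raise t ?F))))) - mul_q r (mul_q s (raise p (raise t (raise s (lower t ?F))))))"
      unfolding 1 2 3 4 scale_left_diff_distrib[symmetric] scale_scale by (rule sc_cong)
  qed
  have HP: "root_op2 s t (raise r (raise s v)) = raise r (raise s (root_op2 s t v))"
    unfolding root_op2_def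
  proof (rule lin_ext4[of _ _ p r s t v], intro lin_funs, intro lin_funs)
    fix a k1 k2 k3 k4 assume a: "a \<in> expos n"
    let ?F = "mono_fam a [p, r, s, t] [k1, k2, k3, k4]"
    show "raise s (lower t (raise r (raise s ?F))) = raise r (raise s (raise s (lower t ?F)))"
      by (simp add: index_op_mono_fam4[OF a d] eval)
  qed
  have TQ: "root_op1 p r s t (mul_q r (mul_q s (raise p (raise t v)))) = mul_q r (mul_q s (raise p (raise t (root_op1 p r s t v))))"
    unfolding root_op1_def
  proof (rule lin_ext4[of _ _ p r s t v], intro lin_funs, intro lin_funs)
    fix a k1 k2 k3 k4 assume a: "a \<in> expos n"
    let ?F = "mono_fam a [p, r, s, t] [k1, k2, k3, k4]"
    show "mul_q s (div_q t (raise p (lower r (mul_q r (mul_q s (raise p (raise t ?F)))))))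
      = mul_q r (mul_q s (raise p (raise t (mul_q s (div_q t (raise p (lower r ?F)))))))"
      using q0 by (cases k2) (simp_all add: index_op_mono_fam4[OF a d] eval)
  qed
  show "root_op p r s t (raise r (raise s v) + q \<star> mul_q r (mul_q s (raise p (raise t v))))
    = raise r (raise s (root_op p r s t v)) + q \<star> mul_q r (mul_q s (raise p (raise t (root_op p r s t v))))"
    using TP HP TQ
    by (simp add: root_op_root_op1_root_op2 lin_simps[OF lin_root_op1] lin_simps[OF lin_root_op2] lin_simps[OF lin_index_op]
        algebra_simps)
  have TM: "root_op1 p r s t (mul_q r (mul_q s (mul_q p (mul_q t v)))) = mul_q r (mul_q s (mul_q p (mul_q t (root_op1 p r s t v))))"
    unfolding root_op1_def
  proof (rule lin_ext4[of _ _ p r s t v], intro lin_funs, intro lin_funs)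
    fix a k1 k2 k3 k4 assume a: "a \<in> expos n"
    let ?F = "mono_fam a [p, r, s, t] [k1, k2, k3, k4]"
    show "mul_q s (div_q t (raise p (lower r (mul_q r (mul_q s (mul_q p (mul_q t ?F)))))))
        = mul_q r (mul_q s (mul_q p (mul_q t (mul_q s (div_q t (raise p (lower r ?F)))))))"
      using q0 by (cases k2) (simp_all add: index_op_mono_fam4[OF a d] eval)
  qed
  have HM: "root_op2 s t (mul_q r (mul_q s (mul_q p (mul_q t v)))) = mul_q r (mul_q s (mul_q p (mul_q t (root_op2 s t v))))"
    unfolding root_op2_def
  proof (rule lin_ext4[of _ _ p r s t v], intro lin_funs, intro lin_funs)
    fix a k1 k2 k3 k4 assume a: "a \<in> expos n"
    let ?F = "mono_fam a [p, r, s, t] [k1, k2, k3, k4]"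
    show "raise s (lower t (mul_q r (mul_q s (mul_q p (mul_q t ?F))))) = mul_q r (mul_q s (mul_q p (mul_q t (raise s (lower t ?F)))))"
      using q0 by (cases k4) (simp_all add: index_op_mono_fam4[OF a d] eval)
  qed
  show "root_op p r s t (mul_q r (mul_q s (mul_q p (mul_q t v)))) = mul_q r (mul_q s (mul_q p (mul_q t (root_op p r s t v))))"
    by (simp add: root_op_root_op1_root_op2 TM HM lin_minus[OF lin_index_op])
qed

section \<open>The parts of e_1 and f_1: mutual commutators and commutation with a root
  operator\<close>

definition lin_term :: "int \<Rightarrow> int \<Rightarrow> 'a \<Rightarrow> 'a" where
  "lin_term r s v = raise s (index_op r alpha (\<lambda>k. k - 1) v)"
definition quad_term :: "int \<Rightarrow> int \<Rightarrow> 'a \<Rightarrow> 'a" where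
  "quad_term r s v = mul_q s (index_op r beta (\<lambda>k. k - 2) v)"

lemma lin_part_eq_lin_term: "lin_part s = lin_term s (- s)" and quad_part_eq_quad_term: "quad_part s = quad_term s (- s)"
  by (auto simp: lin_part_def lin_term_def quad_part_def quad_term_def)

lemma alpha_0 [simp]: "alpha 0 = 0" and beta_0 [simp]: "beta 0 = 0" and beta_1 [simp]: "beta (Suc 0) = 0"
  by (simp_all add: alpha_def beta_def)

lemma qnum_Suc_Suc: "qnum q (Suc (Suc k)) = qnum q k + (q ^ Suc k + inverse q ^ Suc k)"
proof -
  have "q * (q * z + i) + inverse q * i = z + (q * (i + (q - inverse q) * z) + inverse q * i)" for z i
    using q0 by (simp add: algebra_simps)
  then show ?thesis by (simp only: qnum_Suc q_power_qnum[of k] lam_def power_Suc)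
qed

text \<open>For the parameter \<open>q ^ 2\<close> this is [k][l+1] - [l][k+1] = [k-l], the identity
  already used for root operators.\<close>

lemma alpha_commutator:
  "alpha k * alpha (Suc l) - alpha l * alpha (Suc k)
    = inverse (q ^ 2 - inverse (q ^ 2)) * (q ^ k * q ^ k * (inverse q ^ l * inverse q ^ l)
        - inverse q ^ k * inverse q ^ k * (q ^ l * q ^ l))"
proof -
  let ?L = "q ^ 2 - inverse (q ^ 2)"
  have L: "?L \<noteq> 0" using qnum_2_ne by (auto simp: qnum_def power_inverse)
  have alpha: "alpha k = (q ^ k * q ^ k - inverse q ^ k * inverse q ^ k) / ?L" for k
  proof -
    have "lam * qnum q 2 = ?L" by (simp add: qnum_lam power_inverse)
    moreover have "lam * (qnum q k * (q ^ k + inverse q ^ k))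
        = q ^ k * q ^ k - inverse q ^ k * inverse q ^ k"
      by (simp add: mult.assoc[symmetric] qnum_lam) (simp add: algebra_simps)
    moreover have "alpha k = (lam * (qnum q k * (q ^ k + inverse q ^ k))) / (lam * qnum q 2)"
      using lam_ne by (simp add: alpha_def)
    ultimately show ?thesis by simp
  qed
  have "(Q - Q') / ?L * ((q * R * (q * R) - inverse q * R' * (inverse q * R')) / ?L)
      - (R * R - R' * R') / ?L * ((q ^ 2 * Q - inverse (q ^ 2) * Q') / ?L)
      = inverse ?L * (Q * (R' * R') - Q' * (R * R))" for Q Q' R R'
    using L by (simp add: divide_simps) (use q0 in \<open>simp add: field_simps power2_eq_square power4_eq_xxxx\<close>)
  from this[of "q ^ k * q ^ k" "inverse q ^ k * inverse q ^ k" "q ^ l" "inverse q ^ l"]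
  show ?thesis unfolding alpha by (simp add: power2_eq_square mult_ac)
qed

text \<open>Up to a common factor the two sides differ by \<open>?w\<close> times [k+2] - [k] and by
  \<open>?u\<close> times [l+2] - [l]. By \<open>qnum_Suc_Suc\<close> these differences are
  \<open>?u\<close> and \<open>?w\<close> themselves.\<close>

lemma alpha_beta_commutator:
  "beta (Suc k) * q ^ Suc l * alpha (Suc l) + alpha (Suc k) * beta (Suc (Suc l)) * q ^ k
    = alpha (Suc l) * beta (Suc (Suc k)) * q ^ l + beta (Suc l) * q ^ Suc k * alpha (Suc k)"
proof -
  let ?c = "lam * q ^ k * q ^ l * q * qnum q (Suc k) * qnum q (Suc l) / (qnum q 2 * qnum q 2)"
  let ?u = "q ^ Suc k + inverse q ^ Suc k" and ?w = "q ^ Suc l + inverse q ^ Suc l"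
  have "beta (Suc k) * q ^ Suc l * alpha (Suc l) + alpha (Suc k) * beta (Suc (Suc l)) * q ^ k
    = ?c * (q * (?w * qnum q k + ?u * qnum q (Suc (Suc l))))"
    by (simp add: alpha_def beta_def algebra_simps add_divide_distrib)
  also have "?w * qnum q k + ?u * qnum q (Suc (Suc l)) = ?w * qnum q (Suc (Suc k)) + ?u * qnum q l"
    unfolding qnum_Suc_Suc by (simp add: algebra_simps)
  also have "?c * (q * (?w * qnum q (Suc (Suc k)) + ?u * qnum q l))
    = alpha (Suc l) * beta (Suc (Suc k)) * q ^ l + beta (Suc l) * q ^ Suc k * alpha (Suc k)"
    by (simp add: alpha_def beta_def algebra_simps add_divide_distrib)
  finally show ?thesis .
qed

text \<open>If both arguments are at least 2 the powers of \<open>q\<close> agree; otherwise a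
  factor \<open>beta\<close> vanishes and the truncated exponent does not matter.\<close>

lemma beta_beta: "beta k * q ^ l * (beta l * q ^ (k - 2)) = beta l * q ^ k * (beta k * q ^ (l - 2))"
proof -
  consider "k = 0" | "k = 1" | "l = 0" | "l = 1" | k' l' where "k = Suc (Suc k')" "l = Suc (Suc l')"
    by (metis One_nat_def not0_implies_Suc)
  then show ?thesis by cases simp_all
qed

text \<open>The identity that ties the coefficient of the quadratic part to that of the linear part;
  it makes the defects in \<open>root_op_lin_term_quad_term\<close> cancel.\<close>

lemma alpha_qnum: "q * alpha (Suc (Suc k)) * qnum q (Suc k) - qnum q (Suc (Suc k)) * alpha (Suc k)
    = beta (Suc (Suc k))"
proof -
  have "q * (q * (q * u) + inverse q * (inverse q * i)) - (q * u + inverse q * i)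
      = (q - inverse q) * (q * (q * u))" for u i
    using q0 by (simp add: field_simps)
  then have e: "q * (q ^ Suc (Suc k) + inverse q ^ Suc (Suc k)) - (q ^ Suc k + inverse q ^ Suc k)
      = lam * q ^ Suc (Suc k)" by (simp only: power_Suc lam_def)
  have "q * alpha (Suc (Suc k)) * qnum q (Suc k) - qnum q (Suc (Suc k)) * alpha (Suc k)
     = qnum q (Suc (Suc k)) * qnum q (Suc k) / qnum q 2
       * (q * (q ^ Suc (Suc k) + inverse q ^ Suc (Suc k)) - (q ^ Suc k + inverse q ^ Suc k))"
    unfolding alpha_def by (simp add: algebra_simps diff_divide_distrib del: power_Suc)
  then show ?thesis unfolding e by (simp add: beta_def mult_ac)
qed

lemma beta_qnum:
  "beta (Suc (Suc (Suc k))) * (qnum q (Suc k) * inverse q) = qnum q (Suc (Suc (Suc k))) * beta (Suc (Suc k))"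
  "beta (Suc (Suc (Suc k))) * qnum q (Suc k) = qnum q (Suc (Suc (Suc k))) * (q * beta (Suc (Suc k)))"
  using q0 by (simp_all add: beta_def)

context
  fixes p r s t :: int
  assumes d: "distinct [p, r, s, t]" "{p, r, s, t} \<subseteq> Iset n"
begin

lemma lin_term_lin_term: "lin_term r s (lin_term s r v) - lin_term s r (lin_term r s v)
  = inverse (q ^ 2 - inverse (q ^ 2)) \<star> (mul_q s (mul_q s (div_q r (div_q r v))) - div_q s (div_q s (mul_q r (mul_q r v))))"
  unfolding lin_term_def
proof (rule lin_ext4[of _ _ p r s t v], intro lin_funs, intro lin_funs)
  fix a k1 k2 k3 k4 assume a: "a \<in> expos n"
  let ?F = "mono_fam a [p, r, s, t] [k1, k2, k3, k4]"
  have 1: "raise s (index_op r alpha (\<lambda>k. k - 1) (raise r (index_op s alpha (\<lambda>k. k - 1) ?F))) = (alpha k3 * alpha (Suc k2)) \<star> ?F"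
    by (cases k3) (simp_all add: index_op_mono_fam4[OF a d] eval)
  have 2: "raise r (index_op s alpha (\<lambda>k. k - 1) (raise s (index_op r alpha (\<lambda>k. k - 1) ?F))) = (alpha k2 * alpha (Suc k3)) \<star> ?F"
    by (cases k2) (simp_all add: index_op_mono_fam4[OF a d] eval)
  have 3: "mul_q s (mul_q s (div_q r (div_q r ?F))) = (q ^ k3 * q ^ k3 * (inverse q ^ k2 * inverse q ^ k2)) \<star> ?F"
    "div_q s (div_q s (mul_q r (mul_q r ?F))) = (inverse q ^ k3 * inverse q ^ k3 * (q ^ k2 * q ^ k2)) \<star> ?F"
    by (simp_all add: index_op_mono_fam4[OF a d] eval mult_ac)
  show "raise s (index_op r alpha (\<lambda>k. k - 1) (raise r (index_op s alpha (\<lambda>k. k - 1) ?F)))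
      - raise r (index_op s alpha (\<lambda>k. k - 1) (raise s (index_op r alpha (\<lambda>k. k - 1) ?F)))
    = inverse (q ^ 2 - inverse (q ^ 2)) \<star> (mul_q s (mul_q s (div_q r (div_q r ?F))) - div_q s (div_q s (mul_q r (mul_q r ?F))))"
    unfolding 1 2 3 scale_left_diff_distrib[symmetric] scale_scale alpha_commutator ..
qed

text \<open>The cross terms of [e_1, f_1], those with one inserted Omega. They cancel only jointly,
  through \<open>alpha_beta_commutator\<close>.\<close>

lemma lin_term_quad_term: "lin_term r s (quad_term s r v) + quad_term r s (lin_term s r v) = quad_term s r (lin_term r s v) + lin_term s r (quad_term r s v)"
  unfolding lin_term_def quad_term_def
proof (rule lin_ext4[of _ _ p r s t v], intro lin_funs, intro lin_funs)
  fix a k1 k2 k3 k4 assume a: "a \<in> expos n"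
  let ?F = "mono_fam a [p, r, s, t] [k1, k2, k3, k4]" and ?G = "mono_fam a [p, r, s, t] [k1, k2 - 1, k3 - 1, k4]"
  have 1: "raise s (index_op r alpha (\<lambda>k. k - 1) (mul_q r (index_op s beta (\<lambda>k. k - 2) ?F))) = (beta k3 * q ^ k2 * alpha k2) \<star> ?G"
  proof -
    consider "k3 = 0" | "k3 = 1" | k where "k3 = Suc (Suc k)" by (metis One_nat_def not0_implies_Suc)
    then show ?thesis by cases (simp_all add: index_op_mono_fam4[OF a d] eval)
  qed
  have 2: "raise r (index_op s alpha (\<lambda>k. k - 1) (mul_q s (index_op r beta (\<lambda>k. k - 2) ?F))) = (beta k2 * q ^ k3 * alpha k3) \<star> ?G"
  proof -
    consider "k2 = 0" | "k2 = 1" | k where "k2 = Suc (Suc k)" by (metis One_nat_def not0_implies_Suc)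
    then show ?thesis by cases (simp_all add: index_op_mono_fam4[OF a d] eval)
  qed
  have 3: "mul_q s (index_op r beta (\<lambda>k. k - 2) (raise r (index_op s alpha (\<lambda>k. k - 1) ?F)))
    = (alpha k3 * beta (Suc k2) * q ^ (k3 - 1)) \<star> ?G"
    by (simp add: index_op_mono_fam4[OF a d] eval eval_nat_numeral)
  have 4: "mul_q r (index_op s beta (\<lambda>k. k - 2) (raise s (index_op r alpha (\<lambda>k. k - 1) ?F)))
    = (alpha k2 * beta (Suc k3) * q ^ (k2 - 1)) \<star> ?G"
    by (simp add: index_op_mono_fam4[OF a d] eval eval_nat_numeral)
  show "raise s (index_op r alpha (\<lambda>k. k - 1) (mul_q r (index_op s beta (\<lambda>k. k - 2) ?F)))
      + mul_q s (index_op r beta (\<lambda>k. k - 2) (raise r (index_op s alpha (\<lambda>k. k - 1) ?F)))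
    = mul_q r (index_op s beta (\<lambda>k. k - 2) (raise s (index_op r alpha (\<lambda>k. k - 1) ?F)))
      + raise r (index_op s alpha (\<lambda>k. k - 1) (mul_q s (index_op r beta (\<lambda>k. k - 2) ?F)))"
    unfolding 1 2 3 4 scale_left_distrib[symmetric]
    using alpha_beta_commutator[of "k3 - 1" "k2 - 1"]
    by (cases k2; cases k3) (simp_all del: power_Suc)
qed

lemma quad_term_quad_term: "quad_term r s (quad_term s r v) = quad_term s r (quad_term r s v)"
  unfolding quad_term_def
proof (rule lin_ext4[of _ _ p r s t v], intro lin_funs, intro lin_funs)
  fix a k1 k2 k3 k4 assume a: "a \<in> expos n"
  let ?F = "mono_fam a [p, r, s, t] [k1, k2, k3, k4]"
  show "mul_q s (index_op r beta (\<lambda>k. k - 2) (mul_q r (index_op s beta (\<lambda>k. k - 2) ?F)))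
    = mul_q r (index_op s beta (\<lambda>k. k - 2) (mul_q s (index_op r beta (\<lambda>k. k - 2) ?F)))"
    using beta_beta[of k3 k2] by (simp add: index_op_mono_fam4[OF a d] eval mult_ac)
qed

text \<open>The point where S has to be opened: \<open>raise p\<close> and \<open>raise t\<close>
  insert its leading pair. Neither summand commutes alone; the defect of \<open>root_op1\<close>
  with the linear term (\<open>TA\<close>) is that of \<open>root_op2\<close> with the quadratic
  one.\<close>

lemma root_op_lin_term_quad_term:
  "root_op p r s t (lin_term r s v + quad_term r s (raise p (raise t v))) = lin_term r s (root_op p r s t v) + quad_term r s (raise p (raise t (root_op p r s t v)))"
proof -
  have TA: "root_op1 p r s t (lin_term r s v) - lin_term r s (root_op1 p r s t v)
    = root_op2 s t (quad_term r s (raise p (raise t v))) - quad_term r s (raise p (raise t (root_op2 s t v)))"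
    unfolding root_op1_def root_op2_def lin_term_def quad_term_def
  proof (rule lin_ext4[of _ _ p r s t v], intro lin_funs, intro lin_funs)
    fix a k1 k2 k3 k4 assume a: "a \<in> expos n"
    let ?F = "mono_fam a [p, r, s, t] [k1, k2, k3, k4]"
    \<comment> \<open>For \<open>k2 < 2\<close> all four coefficients below vanish, so the truncated
      exponent is harmless.\<close>
    let ?G = "mono_fam a [p, r, s, t] [Suc k1, k2 - 2, Suc k3, k4]"
    have 1: "mul_q s (div_q t (raise p (lower r (raise s (index_op r alpha (\<lambda>k. k - 1) ?F)))))
      = (alpha k2 * qnum q (k2 - 1) * q ^ Suc k3 * inverse q ^ k4) \<star> ?G"
      by (simp add: index_op_mono_fam4[OF a d] eval eval_nat_numeral)
    have 2: "raise s (index_op r alpha (\<lambda>k. k - 1) (mul_q s (div_q t (raise p (lower r ?F)))))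
      = (qnum q k2 * alpha (k2 - 1) * q ^ k3 * inverse q ^ k4) \<star> ?G"
      by (simp add: index_op_mono_fam4[OF a d] eval eval_nat_numeral)
    have 3: "raise s (lower t (mul_q s (index_op r beta (\<lambda>k. k - 2) (raise p (raise t ?F)))))
      = (beta k2 * q ^ k3 * qnum q (Suc k4)) \<star> ?G"
      by (simp add: index_op_mono_fam4[OF a d] eval)
    have 4: "mul_q s (index_op r beta (\<lambda>k. k - 2) (raise p (raise t (raise s (lower t ?F)))))
      = (beta k2 * q ^ Suc k3 * qnum q k4) \<star> ?G"
      by (cases k4) (simp_all add: index_op_mono_fam4[OF a d] eval)
    have b: "q * alpha k2 * qnum q (k2 - 1) - qnum q k2 * alpha (k2 - 1) = beta k2"
    proof -
      consider "k2 = 0" | "k2 = 1" | k where "k2 = Suc (Suc k)" by (metis One_nat_def not0_implies_Suc)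
      then show ?thesis using alpha_qnum by cases simp_all
    qed
    have "alpha k2 * qnum q (k2 - 1) * q ^ Suc k3 * inverse q ^ k4
        - qnum q k2 * alpha (k2 - 1) * q ^ k3 * inverse q ^ k4
      = (q * alpha k2 * qnum q (k2 - 1) - qnum q k2 * alpha (k2 - 1)) * q ^ k3 * inverse q ^ k4"
      by (simp add: algebra_simps)
    also have "\<dots> = beta k2 * q ^ k3 * qnum q (Suc k4) - beta k2 * q ^ Suc k3 * qnum q k4"
      unfolding b by (simp add: qnum_Suc algebra_simps)
    finally show "mul_q s (div_q t (raise p (lower r (raise s (index_op r alpha (\<lambda>k. k - 1) ?F)))))
        - raise s (index_op r alpha (\<lambda>k. k - 1) (mul_q s (div_q t (raise p (lower r ?F)))))
      = raise s (lower t (mul_q s (index_op r beta (\<lambda>k. k - 2) (raise p (raise t ?F)))))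
        - mul_q s (index_op r beta (\<lambda>k. k - 2) (raise p (raise t (raise s (lower t ?F)))))"
      unfolding 1 2 3 4 scale_left_diff_distrib[symmetric] by (rule sc_cong)
  qed
  have HA: "root_op2 s t (lin_term r s v) = lin_term r s (root_op2 s t v)"
    unfolding root_op2_def lin_term_def
  proof (rule lin_ext4[of _ _ p r s t v], intro lin_funs, intro lin_funs)
    fix a k1 k2 k3 k4 assume a: "a \<in> expos n"
    let ?F = "mono_fam a [p, r, s, t] [k1, k2, k3, k4]"
    show "raise s (lower t (raise s (index_op r alpha (\<lambda>k. k - 1) ?F))) = raise s (index_op r alpha (\<lambda>k. k - 1) (raise s (lower t ?F)))"
      by (simp add: index_op_mono_fam4[OF a d] eval)
  qed
  have TB: "root_op1 p r s t (quad_term r s (raise p (raise t v))) = quad_term r s (raise p (raise t (root_op1 p r s t v)))"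
    unfolding root_op1_def quad_term_def
  proof (rule lin_ext4[of _ _ p r s t v], intro lin_funs, intro lin_funs)
    fix a k1 k2 k3 k4 assume a: "a \<in> expos n"
    let ?F = "mono_fam a [p, r, s, t] [k1, k2, k3, k4]"
    consider "k2 = 0" | "k2 = 1" | "k2 = 2" | k where "k2 = Suc (Suc (Suc k))"
      by (metis One_nat_def Suc_1 not0_implies_Suc)
    then show "mul_q s (div_q t (raise p (lower r (mul_q s (index_op r beta (\<lambda>k. k - 2) (raise p (raise t ?F)))))))
      = mul_q s (index_op r beta (\<lambda>k. k - 2) (raise p (raise t (mul_q s (div_q t (raise p (lower r ?F)))))))"
      using q0 by cases (simp_all add: index_op_mono_fam4[OF a d] eval beta_qnum eval_nat_numeral)
  qed
  show ?thesis
    using TA HA TB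
    by (simp add: root_op_root_op1_root_op2 lin_simps[OF lin_root_op1] lin_simps[OF lin_root_op2] lin_simps[OF lin_index_op] lin_term_def quad_term_def
        algebra_simps)
qed

text \<open>For the remaining pairs of S, which see the pair \<open>p\<close>, \<open>t\<close> only
  through the diagonal factors.\<close>

lemma root_op_quad_term: "root_op p r s t (quad_term r s (mul_q p (mul_q t v))) = quad_term r s (mul_q p (mul_q t (root_op p r s t v)))"
proof -
  have TB: "root_op1 p r s t (quad_term r s (mul_q p (mul_q t v))) = quad_term r s (mul_q p (mul_q t (root_op1 p r s t v)))"
    unfolding root_op1_def quad_term_def
  proof (rule lin_ext4[of _ _ p r s t v], intro lin_funs, intro lin_funs)
    fix a k1 k2 k3 k4 assume a: "a \<in> expos n"
    let ?F = "mono_fam a [p, r, s, t] [k1, k2, k3, k4]"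
    consider "k2 = 0" | "k2 = 1" | "k2 = 2" | k where "k2 = Suc (Suc (Suc k))"
      by (metis One_nat_def Suc_1 not0_implies_Suc)
    then show "mul_q s (div_q t (raise p (lower r (mul_q s (index_op r beta (\<lambda>k. k - 2) (mul_q p (mul_q t ?F)))))))
      = mul_q s (index_op r beta (\<lambda>k. k - 2) (mul_q p (mul_q t (mul_q s (div_q t (raise p (lower r ?F)))))))"
      using q0 by cases (simp_all add: index_op_mono_fam4[OF a d] eval beta_qnum eval_nat_numeral)
  qed
  have HB: "root_op2 s t (quad_term r s (mul_q p (mul_q t v))) = quad_term r s (mul_q p (mul_q t (root_op2 s t v)))"
    unfolding root_op2_def quad_term_def
  proof (rule lin_ext4[of _ _ p r s t v], intro lin_funs, intro lin_funs)
    fix a k1 k2 k3 k4 assume a: "a \<in> expos n"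
    let ?F = "mono_fam a [p, r, s, t] [k1, k2, k3, k4]"
    show "raise s (lower t (mul_q s (index_op r beta (\<lambda>k. k - 2) (mul_q p (mul_q t ?F)))))
      = mul_q s (index_op r beta (\<lambda>k. k - 2) (mul_q p (mul_q t (raise s (lower t ?F)))))"
      using q0 by (cases k4) (simp_all add: index_op_mono_fam4[OF a d] eval)
  qed
  show ?thesis
    by (simp add: root_op_root_op1_root_op2 lin_simps[OF lin_index_op] TB HB quad_term_def[of r s "_ - _"])
      (simp add: quad_term_def lin_simps[OF lin_index_op])
qed

end

lemma Loc_index_op_pair: "{i, j} \<subseteq> Iset n \<Longrightarrow> Loc {i, j} (index_op i c f \<circ> index_op j c' f')"
  by (auto intro!: Loc.intros)

text \<open>The bound on \<open>k\<close> says that the insertion contains both pairs i and i - 1.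
  Prescribing the index pairs as sets covers both sign choices, hence both families of
  generators.\<close>

lemma root_op_quad:
  assumes d: "distinct [p, r, s, t]" and prst: "{p, t} = {i, - i}" "{r, s} = {i - 1, 1 - i}"
    and i: "2 \<le> i" "i \<le> int n" and k: "int n + 2 - i \<le> int k" "k \<le> n"
  shows "root_op p r s t (quad k v) = quad k (root_op p r s t v)"
  using k
proof (induction k arbitrary: v)
  case 0
  then show ?case using i by simp
next
  case (Suc k)
  have prst': "{p, r, s, t} \<subseteq> Iset n"
  proof -
    have "{p, r, s, t} = {i, - i} \<union> {i - 1, 1 - i}" using prst by auto
    then show ?thesis using i by (auto simp: Iset_iff)
  qed
  show ?case
  proof (cases "int n + 2 - i = int (Suc k)")
    \<comment> \<open>The pair added last lies strictly inside i - 1, away from the four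
      indices.\<close>
    case False
    let ?j = "int n - int k"
    have j: "1 \<le> ?j" "?j < i - 1" using False Suc.prems by auto
    have "{?j, - ?j} \<inter> {p, r, s, t} = {}"
    proof -
      have "{p, r, s, t} = {i, - i} \<union> {i - 1, 1 - i}" using prst by auto
      then show ?thesis using j by auto
    qed
    moreover have "{?j, - ?j} \<subseteq> Iset n" using j by (auto simp: Iset_iff)
    ultimately have c: "root_op p r s t ((index_op ?j c f \<circ> index_op (- ?j) c' f') v)
      = (index_op ?j c f \<circ> index_op (- ?j) c' f') (root_op p r s t v)" for c f c' f' v
      using Loc_commute[OF Loc_root_op[OF prst'] Loc_index_op_pair] by (metis inf_commute)
    show ?thesis
      using Suc False c by (simp add: opadd_def opsc_sc lin_simps[OF lin_root_op])
  next
    \<comment> \<open>The smallest admissible \<open>k\<close>: the pairs i - 1 and i are peeled off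
      and form the truncated quadratic element, while \<open>quad l\<close> uses only indices beyond
      i.\<close>
    case True
    then obtain l where l: "k = Suc l" using i by (cases k) auto
    have l': "int n - int k = i - 1" "int k - int n = 1 - i" "int n - int l = i" "int l - int n = - i"
      using True l by auto
    have ext: "raise i (raise (- i) (mul_q (i - 1) (mul_q (1 - i) v))) = mul_q r (mul_q s (raise p (raise t v)))"
      "mul_q i (mul_q (- i) (mul_q (i - 1) (mul_q (1 - i) v))) = mul_q r (mul_q s (mul_q p (mul_q t v)))"
      "raise (i - 1) (raise (1 - i) v) = raise r (raise s v)" for v
    proof -
      have c: "raise t (raise p v) = raise p (raise t v)" "mul_q t (mul_q p v) = mul_q p (mul_q t v)"
        "mul_q s (mul_q r v) = mul_q r (mul_q s v)" "raise s (raise r v) = raise r (raise s v)" for v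
        by (rule index_op_commute; use d prst' in auto)+
      have e: "(i = p \<and> - i = t \<or> i = t \<and> - i = p)" "(i - 1 = r \<and> 1 - i = s \<or> i - 1 = s \<and> 1 - i = r)"
        using prst by (auto simp: doubleton_eq_iff)
      have c': "index_op p c f (index_op t c' f' (mul_q r (mul_q s v))) = mul_q r (mul_q s (index_op p c f (index_op t c' f' v)))" for c f c' f'
        by (rule Loc_commute[OF Loc_index_op_pair[of p t] Loc_index_op_pair[of r s], unfolded comp_apply])
          (use d prst' in auto)
      show "raise (i - 1) (raise (1 - i) v) = raise r (raise s v)" using e(2) c by metis
      have "mul_q (i - 1) (mul_q (1 - i) v) = mul_q r (mul_q s v)" using e(2) c by metis
      moreover have "raise i (raise (- i) w) = raise p (raise t w)" "mul_q i (mul_q (- i) w) = mul_q p (mul_q t w)" for w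
        using e(1) c by metis+
      ultimately show "raise i (raise (- i) (mul_q (i - 1) (mul_q (1 - i) v))) = mul_q r (mul_q s (raise p (raise t v)))"
        "mul_q i (mul_q (- i) (mul_q (i - 1) (mul_q (1 - i) v))) = mul_q r (mul_q s (mul_q p (mul_q t v)))"
        by (simp_all add: c')
    qed
    have "quad k u = raise i (raise (- i) u) + q \<star> quad l (mul_q i (mul_q (- i) u))" for u
      by (simp add: l opadd_def opsc_sc l'(3,4))
    then have quad: "quad (Suc k) w = (raise r (raise s w) + q \<star> mul_q r (mul_q s (raise p (raise t w))))
        + q \<star> q \<star> quad l (mul_q r (mul_q s (mul_q p (mul_q t w))))" for w
      by (simp add: opadd_def opsc_sc l'(1,2) ext scale_right_distrib)
    have "root_op p r s t (quad l w) = quad l (root_op p r s t w)" for w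
    proof (rule Loc_commute[OF Loc_root_op[OF prst'] Loc_quad])
      have "{p, r, s, t} = {i, - i} \<union> {i - 1, 1 - i}" using prst by auto
      then show "{p, r, s, t} \<inter> {j. int n - int l < \<bar>j\<bar>} = {}" using l' i by auto
    qed (use Suc.prems l in auto)
    then show ?thesis
      unfolding quad
      by (simp only: lin_plus[OF lin_root_op] lin_scale[OF lin_root_op] root_op_commute_quadratic(2)[OF d prst'])
        (simp only: lin_plus[OF lin_root_op, symmetric] lin_scale[OF lin_root_op, symmetric]
          root_op_commute_quadratic(1)[OF d prst'])
  qed
qed

section \<open>The relations between the e_i and the f_j\<close>

lemma gen_op_ge2: "2 \<le> j \<Longrightarrow> gen_op s j = root_op (- (s * j)) (s * (1 - j)) (s * (j - 1)) (s * j)"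
  by (simp add: gen_op_def)

lemma gen_op_1: "gen_op s 1 v = lin_term s (- s) v + quad_term s (- s) (quad2 v)"
  by (simp add: gen_op_def opadd_def lin_part_eq_lin_term quad_part_eq_quad_term)

lemma lin_lin_term: "lin (lin_term r s)" and lin_quad_term: "lin (quad_term r s)"
  unfolding lin_term_def quad_term_def by (intro lin_funs)+

lemma pm2_Iset: "s = 1 \<or> s = -1 \<Longrightarrow> distinct [2 * s, s, - s, - (2 * s)]"
  "s = 1 \<or> s = -1 \<Longrightarrow> {2 * s, s, - s, - (2 * s)} \<subseteq> Iset n"
  using n2 by (auto simp: Iset_iff)

lemma gen_op_commute_1_2:
  assumes s: "s = 1 \<or> s = -1"
  shows "gen_op s 1 (gen_op (- s) 2 v) = gen_op (- s) 2 (gen_op s 1 v)"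
proof -
  let ?X = "root_op (2 * s) s (- s) (- (2 * s))"
  note d = pm2_Iset[OF s]
  \<comment> \<open>S is split into the pair of index 2 and \<open>quad l\<close>, which involves
    only indices from 3 on and so commutes with the root operator.\<close>
  obtain l where l: "n - Suc 0 = Suc l" "int l = int n - 2" 
    using that[of "n - 2"] n2 by (simp add: of_nat_diff)
  have quad2: "quad2 w = raise (2 * s) (raise (- (2 * s)) w) + q \<star> mul_q (2 * s) (mul_q (- (2 * s)) (quad l w))" for w
  proof -
    have "quad l (mul_q 2 (mul_q (-2) w)) = mul_q 2 (mul_q (-2) (quad l w))"
      by (rule Loc_commute[OF Loc_quad Loc_index_op_pair, unfolded comp_apply]) (use l n2 in \<open>auto simp: Iset_iff\<close>)
    then have "quad2 w = raise 2 (raise (-2) w) + q \<star> mul_q 2 (mul_q (-2) (quad l w))"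
      using l by (simp add: opadd_def opsc_sc)
    moreover have "raise 2 (raise (-2) w) = raise (-2) (raise 2 w)" "mul_q 2 (mul_q (-2) w) = mul_q (-2) (mul_q 2 w)" for w
      by (rule index_op_commute; use n2 in \<open>simp add: Iset_iff\<close>)+
    ultimately show ?thesis using s by auto
  qed
  have quad: "?X (quad l w) = quad l (?X w)" for w
    by (rule Loc_commute[OF Loc_root_op[OF d(2)] Loc_quad]) (use l s n2 in auto)
  have "gen_op s 1 w = lin_term s (- s) w + quad_term s (- s) (raise (2 * s) (raise (- (2 * s)) w))
      + q \<star> quad_term s (- s) (mul_q (2 * s) (mul_q (- (2 * s)) (quad l w)))" for w
    unfolding gen_op_1 quad2 by (simp add: lin_simps[OF lin_quad_term])
  moreover have "gen_op (- s) 2 = ?X" by (simp add: gen_op_def mult.commute)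
  ultimately show ?thesis
    by (simp only: lin_plus[OF lin_root_op] lin_scale[OF lin_root_op] root_op_quad_term[OF d] quad)
      (simp only: lin_plus[OF lin_root_op, symmetric] root_op_lin_term_quad_term[OF d])
qed

lemma gen_op_root_op_indices:
  assumes "s = 1 \<or> s = -1" "2 \<le> j" "j \<le> int n"
  shows "distinct [- (s * j), s * (1 - j), s * (j - 1), s * j]"
    and "{- (s * j), s * (1 - j), s * (j - 1), s * j} \<subseteq> Iset n"
    and "{- (s * j), s * (1 - j), s * (j - 1), s * j} = {j, - j, j - 1, 1 - j}"
  using assms by (auto simp: Iset_iff)

lemma Loc_gen_op:
  assumes "s = 1 \<or> s = -1" "2 \<le> j" "j \<le> int n"
  shows "Loc {j, - j, j - 1, 1 - j} (gen_op s j)"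
  using Loc_root_op[OF gen_op_root_op_indices(2)[OF assms]] by (simp add: gen_op_ge2[OF assms(2)] gen_op_root_op_indices(3)[OF assms])

lemma gen_op_commute_less:
  assumes s: "s = 1 \<or> s = -1" and ij: "1 \<le> i" "i < j" "j \<le> int n"
  shows "gen_op s i (gen_op (- s) j v) = gen_op (- s) j (gen_op s i v)"
proof -
  have s': "- s = 1 \<or> - s = -1" using s by auto
  \<comment> \<open>The distance decides: in the second case S contains both pairs of the root
    operator, in the third two indices are shared, in the last the index sets are disjoint.\<close>
  consider "i = 1" "j = 2" | "i = 1" "3 \<le> j" | "2 \<le> i" "j = i + 1" | "2 \<le> i" "i + 2 \<le> j"
    using ij by linarith
  then show ?thesis
  proof cases
    case 1
    then show ?thesis using gen_op_commute_1_2[OF s] by simp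
  next
    case 2
    have L: "Loc {j, - j, j - 1, 1 - j} (gen_op (- s) j)" using Loc_gen_op[OF s'] 2 ij by simp
    have lin_part: "lin_part s (gen_op (- s) j w) = gen_op (- s) j (lin_part s w)" and quad_part: "quad_part s (gen_op (- s) j w) = gen_op (- s) j (quad_part s w)" for w
      by (rule Loc_commute[OF Loc_lin_part[OF s] L] Loc_commute[OF Loc_quad_part[OF s] L]; use 2 in auto)+
    have "quad2 (gen_op (- s) j w) = gen_op (- s) j (quad2 w)" for w
    proof -
      have g: "gen_op (- s) j = root_op (s * j) (- (s * (1 - j))) (- (s * (j - 1))) (- (s * j))"
        using 2 by (simp add: gen_op_ge2)
      show ?thesis unfolding g
        by (rule root_op_quad[symmetric, where i = j]) (use s 2 ij n2 in auto)
    qed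
    then show ?thesis using 2(1)
      by (simp add: gen_op_def[of s 1] opadd_def lin_part quad_part lin_plus[OF lin_gen_op])
  next
    case 3
    let ?p = "- (s * i)" and ?r = "s * (1 - i)" and ?s = "s * (i - 1)" and ?t = "s * i"
    have "gen_op s i = root_op ?p ?r ?s ?t" "gen_op (- s) j = root_op (s * (i + 1)) ?t ?p (- (s * (i + 1)))"
      using 3 by (simp_all add: gen_op_ge2)
    moreover have "distinct [?p, ?r, ?s, ?t, s * (i + 1), - (s * (i + 1))]"
      "{?p, ?r, ?s, ?t, s * (i + 1), - (s * (i + 1))} \<subseteq> Iset n"
      using s 3 ij by (auto simp: Iset_iff)
    ultimately show ?thesis using root_op_root_op_adjacent by metis
  next
    case 4
    show ?thesis
      by (rule Loc_commute[OF Loc_gen_op[OF s] Loc_gen_op[OF s']]) (use 4 ij in auto)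
  qed
qed

lemma gen_op_commute:
  assumes s: "s = 1 \<or> s = -1" and ij: "i \<noteq> j" "1 \<le> i" "i \<le> int n" "1 \<le> j" "j \<le> int n"
  shows "gen_op s i (gen_op (- s) j v) = gen_op (- s) j (gen_op s i v)"
proof (cases "i < j")
  case True
  then show ?thesis using assms gen_op_commute_less by simp
next
  case False
  \<comment> \<open>Flipping the sign exchanges the two families and so the roles of
    \<open>i\<close> and \<open>j\<close>.\<close>
  then show ?thesis using gen_op_commute_less[of "- s" j i v] assms by auto
qed

lemma e_op_gen_op: "i \<in> {1..n} \<Longrightarrow> e_op n q \<phi> x i = gen_op 1 (int i)"
  using e_op_1 e_op_eq_gen_op[of i] by (cases "i = 1") auto

lemma f_op_gen_op: "i \<in> {1..n} \<Longrightarrow> f_op n q \<phi> x i = opsc \<phi> (if i = 1 then 1 else -1) (gen_op (-1) (int i))"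
  using f_op_1 f_op_eq_gen_op[of i] by (cases "i = 1") (auto simp: opsc_sc fun_eq_iff)

lemma e_f_commute:
  assumes "i \<in> {1..n}" "j \<in> {1..n}" "i \<noteq> j"
  shows "e_op n q \<phi> x i (f_op n q \<phi> x j v) = f_op n q \<phi> x j (e_op n q \<phi> x i v)"
  using assms gen_op_commute[of 1 "int i" "int j" v]
  by (simp add: e_op_gen_op f_op_gen_op opsc_sc lin_scale[OF lin_gen_op])

lemma e_f_diag:
  assumes i: "i \<in> {1..n}"
  shows "e_op n q \<phi> x i (f_op n q \<phi> x i v) - f_op n q \<phi> x i (e_op n q \<phi> x i v)
    = inverse (qi q i - inverse (qi q i)) \<star> (k_op n q \<phi> x i v - kinv_op n q \<phi> x i v)"
proof (cases "i = 1")
  case True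
  have d: "distinct [2, 1, -1, -2 :: int]" "{2, 1, -1, -2} \<subseteq> Iset n" using pm2_Iset[of 1] by auto
  have c: "quad2 (lin_term 1 (-1) w) = lin_term 1 (-1) (quad2 w)" "quad2 (lin_term (-1) 1 w) = lin_term (-1) 1 (quad2 w)"
    "quad2 (quad_term 1 (-1) w) = quad_term 1 (-1) (quad2 w)" "quad2 (quad_term (-1) 1 w) = quad_term (-1) 1 (quad2 w)" for w
    using quad2_lin_part[of 1] quad2_lin_part[of "-1"] quad2_quad_part[of 1] quad2_quad_part[of "-1"] by (simp_all add: lin_part_eq_lin_term quad_part_eq_quad_term)
  \<comment> \<open>The commutator sorted by the number of factors S, which can all be moved to the
    right. Only the part without S survives.\<close>
  have "gen_op 1 1 (gen_op (-1) 1 v) - gen_op (-1) 1 (gen_op 1 1 v)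
    = (lin_term 1 (-1) (lin_term (-1) 1 v) - lin_term (-1) 1 (lin_term 1 (-1) v))
      + ((lin_term 1 (-1) (quad_term (-1) 1 (quad2 v)) + quad_term 1 (-1) (lin_term (-1) 1 (quad2 v)))
       - (quad_term (-1) 1 (lin_term 1 (-1) (quad2 v)) + lin_term (-1) 1 (quad_term 1 (-1) (quad2 v))))
      + (quad_term 1 (-1) (quad_term (-1) 1 (quad2 (quad2 v))) - quad_term (-1) 1 (quad_term 1 (-1) (quad2 (quad2 v))))"
    by (simp add: gen_op_1 gen_op_1[of "-1", simplified] lin_plus[OF lin_lin_term] lin_plus[OF lin_quad_term] lin_plus[OF lin_quad] c
        algebra_simps)
  then show ?thesis
    unfolding lin_term_lin_term[OF d] lin_term_quad_term[OF d] quad_term_quad_term[OF d] True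
    by (simp add: e_op_1[unfolded One_nat_def] f_op_1[unfolded One_nat_def] k_op_def kinv_op_def mu_eq mu_inv_eq qi_def)
next
  case False
  then have i2: "2 \<le> int i" "int i \<le> int n" using i by auto
  note d = gen_op_root_op_indices[of 1, OF _ i2, simplified]
  have "gen_op (-1) (int i) = root_op (int i) (int i - 1) (1 - int i) (- int i)"
    "gen_op 1 (int i) = root_op (- int i) (1 - int i) (int i - 1) (int i)"
    using i2 by (simp_all add: gen_op_ge2)
  \<comment> \<open>The sign in front is the one in f_i =
    -\<open>gen_op (-1) (int i)\<close>.\<close>
  then have "e_op n q \<phi> x i (f_op n q \<phi> x i v) - f_op n q \<phi> x i (e_op n q \<phi> x i v)
    = - (root_op (- int i) (1 - int i) (int i - 1) (int i) (root_op (int i) (int i - 1) (1 - int i) (- int i) v)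
      - root_op (int i) (int i - 1) (1 - int i) (- int i) (root_op (- int i) (1 - int i) (int i - 1) (int i) v))"
    using False i by (simp add: e_op_gen_op f_op_gen_op opsc_sc lin_scale[OF lin_root_op] lin_uminus[OF lin_root_op])
  then show ?thesis using False i
    by (subst (asm) root_op_root_op_diag) (use d in \<open>auto simp: k_op_def kinv_op_def mu_eq mu_inv_eq qi_def
        Let_def lam_def scale_right_diff_distrib\<close>)
qed

section \<open>Gradings and the Cartan part\<close>

text \<open>Several weights are used below: \<open>kw i\<close> for the action of k_i, the constant
  1 for the degree, and n - l and n + l, which every f_j, respectively e_j, lowers.\<close>

definition wt :: "(int \<Rightarrow> int) \<Rightarrow> (int \<Rightarrow> nat) \<Rightarrow> int" where
  "wt w a = (\<Sum>l\<in>Iset n. w l * int (a l))"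

definition graded :: "(int \<Rightarrow> int) \<Rightarrow> int \<Rightarrow> 'a set" where
  "graded w d = {v. \<forall>a. coord n \<phi> x v a \<noteq> 0 \<longrightarrow> wt w a = d}"

definition homog :: "(int \<Rightarrow> int) \<Rightarrow> int \<Rightarrow> ('a \<Rightarrow> 'a) \<Rightarrow> bool" where
  "homog w z F \<longleftrightarrow> (\<forall>d. \<forall>v\<in>graded w d. F v \<in> graded w (d + z))"

lemma finite_Iset: "finite (Iset n)"
  by (simp add: Iset_def)

lemma wt_upd: "i \<in> Iset n \<Longrightarrow> wt w (a(i := k)) = wt w a + w i * (int k - int (a i))"
  unfolding wt_def using finite_Iset
  by (simp add: sum.remove[where x = i] algebra_simps)

lemma graded_mono: "a \<in> expos n \<Longrightarrow> m a \<in> graded w (wt w a)"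
  by (simp add: graded_def coord_mono)

lemma graded_add: "u \<in> graded w d \<Longrightarrow> v \<in> graded w d \<Longrightarrow> u + v \<in> graded w d"
  by (force simp: graded_def coord_plus)

lemma graded_scale: "v \<in> graded w d \<Longrightarrow> c \<star> v \<in> graded w d"
  by (force simp: graded_def coord_scale)

lemma graded_zero: "0 \<in> graded w d"
proof -
  have "coord n \<phi> x (0 \<star> 0) = (\<lambda>a. 0)" unfolding coord_scale by simp
  then show ?thesis by (simp add: graded_def)
qed

text \<open>Nonnegative letter weights leave no monomial of negative weight; this ends the
  nilpotency argument for the adjoint powers.\<close>

lemma graded_neg:
  assumes "v \<in> graded w d" "d < 0" "\<And>l. l \<in> Iset n \<Longrightarrow> 0 \<le> w l"
  shows "v = 0"
proof -
  have nonneg: "0 \<le> wt w a" for a unfolding wt_def by (intro sum_nonneg) (simp add: assms(3))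
  then have "wt w a \<noteq> d" for a using assms(2) nonneg[of a] by linarith
  then have "{a. coord n \<phi> x v a \<noteq> 0} = {}" using assms(1) by (auto simp: graded_def)
  then show ?thesis by (subst coord_expand[of v]) simp
qed

lemma graded_expand:
  assumes "lin F" "v \<in> graded w d" "P 0" "\<And>u v. P u \<Longrightarrow> P v \<Longrightarrow> P (u + v)" "\<And>c v. P v \<Longrightarrow> P (c \<star> v)"
    "\<And>a. a \<in> expos n \<Longrightarrow> wt w a = d \<Longrightarrow> P (F (m a))"
  shows "P (F v)"
proof -
  have sum: "P (sum g I)" if "\<And>i. i \<in> I \<Longrightarrow> P (g i)" for g and I :: "(int \<Rightarrow> nat) set"
    using that by (induction I rule: infinite_finite_induct) (auto intro: assms)
  have "F v = (\<Sum>a | coord n \<phi> x v a \<noteq> 0. coord n \<phi> x v a \<star> F (m a))"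
    by (subst coord_expand[of v]) (simp add: lin_sum[OF assms(1)] lin_scale[OF assms(1)])
  also have "P \<dots>"
    by (rule sum) (use assms(2,5,6) coord_expos in \<open>auto simp: graded_def\<close>)
  finally show ?thesis .
qed

lemma homogI:
  assumes "lin F" "\<And>a. a \<in> expos n \<Longrightarrow> F (m a) \<in> graded w (wt w a + z)"
  shows "homog w z F"
  unfolding homog_def
proof safe
  fix d v assume "v \<in> graded w d"
  then show "F v \<in> graded w (d + z)"
    by (rule graded_expand[OF assms(1)]) (use assms(2) in \<open>auto intro: graded_zero graded_add graded_scale\<close>)
qed

text \<open>The shift is demanded only where the coefficient is nonzero, so truncated subtraction
  does not spoil homogeneity.\<close>

lemma homog_index_op:
  assumes "i \<in> Iset n" "\<And>k. c k \<noteq> 0 \<Longrightarrow> int (f k) = int k + t"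
  shows "homog w (t * w i) (index_op i c f)"
proof (rule homogI[OF lin_index_op])
  fix a assume a: "a \<in> expos n"
  show "index_op i c f (m a) \<in> graded w (wt w a + t * w i)"
  proof (cases "c (a i) = 0")
    case True
    then show ?thesis using a by (simp add: index_op_mono graded_zero)
  next
    case False
    have "m (a(i := f (a i))) \<in> graded w (wt w (a(i := f (a i))))"
      using a assms(1) by (intro graded_mono) simp
    then show ?thesis using a False assms
      by (simp add: index_op_mono wt_upd graded_scale mult.commute)
  qed
qed

lemma homog_comp: "homog w z F \<Longrightarrow> homog w z' F' \<Longrightarrow> homog w (z + z') (F \<circ> F')"
proof -
  assume "homog w z F" "homog w z' F'"
  then have "F (F' v) \<in> graded w (d + z' + z)" if "v \<in> graded w d" for v d
    using that by (auto simp: homog_def)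
  then show ?thesis by (simp add: homog_def add_ac)
qed

lemma homog_add: "homog w z F \<Longrightarrow> homog w z F' \<Longrightarrow> homog w z (opadd F F')"
  by (auto simp: homog_def opadd_def intro: graded_add)

lemma homog_scale: "homog w z F \<Longrightarrow> homog w z (opsc \<phi> c F)"
  by (auto simp: homog_def opsc_sc intro: graded_scale)

lemma homog_letters:
  assumes "i \<in> Iset n"
  shows "homog w (w i) (raise i)" "homog w (- w i) (lower i)" "homog w 0 (mul_q i)" "homog w 0 (div_q i)"
    "homog w (- w i) (index_op i alpha (\<lambda>k. k - 1))" "homog w (- 2 * w i) (index_op i beta (\<lambda>k. k - 2))"
proof -
  show "homog w (w i) (raise i)" using homog_index_op[OF assms, of "\<lambda>_. 1" Suc 1 w] by simp
  have pred: "homog w (- 1 * w i) (index_op i c (\<lambda>k. k - 1))" if "c 0 = 0" for c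
  proof (rule homog_index_op[OF assms])
    fix k assume "c k \<noteq> 0"
    then have "k \<noteq> 0" using that by (cases k) auto
    then show "int (k - 1) = int k + - 1" by simp
  qed
  then show "homog w (- w i) (lower i)" "homog w (- w i) (index_op i alpha (\<lambda>k. k - 1))"
    using pred[of "qnum q"] pred[of alpha] by simp_all
  show "homog w 0 (mul_q i)" "homog w 0 (div_q i)"
    using homog_index_op[OF assms, of _ "\<lambda>k. k" 0 w] by simp_all
  have "int (k - 2) = int k + - 2" if "beta k \<noteq> 0" for k
  proof -
    have "k \<noteq> 0" "k \<noteq> 1" using that beta_0 beta_1 by (metis One_nat_def)+
    then show ?thesis by auto
  qed
  then show "homog w (- 2 * w i) (index_op i beta (\<lambda>k. k - 2))"
    by (rule homog_index_op[OF assms])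
qed

text \<open>Omega is homogeneous as soon as all pairs of opposite letters have the same total
  weight.\<close>

lemma homog_quad:
  assumes w: "\<And>l. l \<in> Iset n \<Longrightarrow> w l + w (- l) = c" and "d \<le> n"
  shows "homog w c (quad d)"
  using assms(2)
proof (induction d)
  case 0
  show ?case by (simp add: homog_def opsc_sc graded_zero)
next
  case (Suc d)
  have i: "int n - d \<in> Iset n" "d - int n \<in> Iset n" using Suc.prems by (auto simp: Iset_iff)
  have "homog w (w (int n - d) + w (d - int n)) (raise (int n - d) \<circ> raise (d - int n))"
    by (intro homog_comp homog_letters i)
  moreover have "homog w (c + 0 + 0) (quad d \<circ> mul_q (int n - d) \<circ> mul_q (d - int n))"
    using Suc by (intro homog_comp homog_letters i) auto
  ultimately show ?case using w[OF i(1)] by (auto intro: homog_add homog_scale)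
qed

lemma homog_gen_op:
  assumes w: "\<And>l. l \<in> Iset n \<Longrightarrow> w l + w (- l) = c" and s: "s = 1 \<or> s = -1" and j: "1 \<le> j" "j \<le> int n"
  shows "homog w (if j = 1 then c - 2 * w s else w (s * (j - 1)) - w (s * j)) (gen_op s j)"
proof (cases "j = 1")
  case True
  have i: "s \<in> Iset n" "- s \<in> Iset n" using s by auto
  have c: "w (- s) = c - w s" using w[OF i(1)] by simp
  have "homog w (w (- s) + - w s) (lin_part s)"
    unfolding lin_part_def by (intro homog_comp homog_letters i)
  moreover have "homog w (0 + - 2 * w s + c) (quad_part s \<circ> quad2)"
    unfolding quad_part_def by (intro homog_comp homog_letters homog_quad w i) auto
  ultimately show ?thesis using True by (auto simp: gen_op_def c intro: homog_add)
next
  case False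
  then have j: "2 \<le> j" "j \<le> int n" using assms by auto
  have i: "- (s * j) \<in> Iset n" "s * (1 - j) \<in> Iset n" "s * (j - 1) \<in> Iset n" "s * j \<in> Iset n"
    using gen_op_root_op_indices(2)[OF s j] by auto
  have neg: "- (s * (j - 1)) = s * (1 - j)" by (simp add: algebra_simps)
  have c: "w (- (s * j)) = c - w (s * j)" "w (s * (1 - j)) = c - w (s * (j - 1))"
    using w[OF i(4)] w[OF i(3)] unfolding neg by auto
  have "homog w (0 + 0 + w (- (s * j)) + - w (s * (1 - j)))
      (mul_q (s * (j - 1)) \<circ> div_q (s * j) \<circ> raise (- (s * j)) \<circ> lower (s * (1 - j)))"
    by (intro homog_comp homog_letters i)
  moreover have "homog w (w (s * (j - 1)) + - w (s * j)) (opsc \<phi> (-1) (raise (s * (j - 1)) \<circ> lower (s * j)))"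
    by (intro homog_scale homog_comp homog_letters i)
  ultimately show ?thesis using j by (auto simp: gen_op_ge2 root_op_def c intro: homog_add)
qed

section \<open>Weights of the k_i and their relations\<close>

text \<open>The exponent of \<open>q\<close> with which k_i scales the letter \<open>l\<close>.
  Being odd in \<open>l\<close>, it meets the condition of \<open>homog_quad\<close> with total
  0.\<close>

definition kw :: "nat \<Rightarrow> int \<Rightarrow> int" where
  "kw i l = (if i = 1 then (if l = -1 then 2 else if l = 1 then -2 else 0)
     else (if l = - int i then 1 else 0) - (if l = 1 - int i then 1 else 0)
       + (if l = int i - 1 then 1 else 0) - (if l = int i then 1 else 0))"

lemma kw_antisym: "kw i l + kw i (- l) = 0"
  by (auto simp: kw_def)

lemma wt_kw:
  assumes "i \<in> {1..n}"
  shows "wt (kw i) a = (if i = 1 then 2 * int (a (-1)) - 2 * int (a 1)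
    else int (a (- int i)) - int (a (1 - int i)) + int (a (int i - 1)) - int (a (int i)))"
proof -
  have d: "(\<Sum>l\<in>Iset n. (if l = k then 1 else 0) * int (a l)) = int (a k)" if "k \<in> Iset n" for k
  proof -
    have "(\<Sum>l\<in>Iset n. (if l = k then 1 else 0) * int (a l)) = (\<Sum>l\<in>Iset n. if l = k then int (a l) else 0)"
      by (intro sum.cong) auto
    then show ?thesis using that by (simp add: finite_Iset)
  qed
  show ?thesis
  proof (cases "i = 1")
    case True
    have "kw i l = 2 * (if l = -1 then 1 else 0) - 2 * (if l = 1 then 1 else 0)" for l
      using True by (simp add: kw_def)
    then have "wt (kw i) a = 2 * (\<Sum>l\<in>Iset n. (if l = -1 then 1 else 0) * int (a l))
        - 2 * (\<Sum>l\<in>Iset n. (if l = 1 then 1 else 0) * int (a l))"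
      unfolding wt_def by (simp only: left_diff_distrib sum_subtractf sum_distrib_left mult.assoc)
    then show ?thesis using True by (simp add: d)
  next
    case False
    then have i: "- int i \<in> Iset n" "1 - int i \<in> Iset n" "int i - 1 \<in> Iset n" "int i \<in> Iset n"
      using assms by (auto simp: Iset_iff)
    show ?thesis using False
      by (simp add: wt_def kw_def left_diff_distrib distrib_right sum_subtractf sum.distrib d[OF i(1)]
          d[OF i(2)] d[OF i(3)] d[OF i(4)])
  qed
qed

lemma lin_k_op: "lin (k_op n q \<phi> x i)" and lin_kinv_op: "lin (kinv_op n q \<phi> x i)"
  by (auto simp: k_op_def kinv_op_def Let_def intro!: lin_comp lin_mu lin_mu_inv)

lemma k_op_mono:
  assumes "a \<in> expos n" "i \<in> {1..n}"
  shows "k_op n q \<phi> x i (m a) = (q powi wt (kw i) a) \<star> m a"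
    "kinv_op n q \<phi> x i (m a) = (q powi (- wt (kw i) a)) \<star> m a"
proof -
  have mu: "mu n q \<phi> x l (m a) = (q powi int (a l)) \<star> m a"
    "mu_inv n q \<phi> x l (m a) = (q powi (- int (a l))) \<star> m a" for l
    by (simp_all add: mu_mono mu_inv_mono assms(1) power_int_minus power_inverse)
  have add: "q powi c * q powi d = q powi (c + d)" for c d
    using q0 by (simp add: power_int_add)
  note [simp del] = power_int_of_nat
  show "k_op n q \<phi> x i (m a) = (q powi wt (kw i) a) \<star> m a"
    "kinv_op n q \<phi> x i (m a) = (q powi (- wt (kw i) a)) \<star> m a"
    by (simp_all add: wt_kw[OF assms(2)] k_op_def kinv_op_def Let_def mu lin_scale[OF lin_mu]
        lin_scale[OF lin_mu_inv] add algebra_simps)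
qed

lemma k_op_graded:
  assumes "v \<in> graded (kw i) d" "i \<in> {1..n}"
  shows "k_op n q \<phi> x i v = (q powi d) \<star> v" "kinv_op n q \<phi> x i v = (q powi (- d)) \<star> v"
proof -
  have "k_op n q \<phi> x i v - (q powi d) \<star> v = 0"
    by (rule graded_expand[where P = "\<lambda>u. u = 0" and F = "\<lambda>v. k_op n q \<phi> x i v - (q powi d) \<star> v", OF _ assms(1)])
      (auto simp: k_op_mono[OF _ assms(2)] intro!: lin_funs lin_k_op)
  moreover have "kinv_op n q \<phi> x i v - (q powi (- d)) \<star> v = 0"
    by (rule graded_expand[where P = "\<lambda>u. u = 0" and F = "\<lambda>v. kinv_op n q \<phi> x i v - (q powi (- d)) \<star> v", OF _ assms(1)])
      (auto simp: k_op_mono[OF _ assms(2)] intro!: lin_funs lin_kinv_op)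
  ultimately show "k_op n q \<phi> x i v = (q powi d) \<star> v" "kinv_op n q \<phi> x i v = (q powi (- d)) \<star> v"
    by simp_all
qed

text \<open>k_i is a scalar on each weight component, so it commutes with a homogeneous operator up
  to the power of \<open>q\<close> given by the shift.\<close>

lemma k_op_homog:
  assumes "homog (kw i) z F" "lin F" "i \<in> {1..n}"
  shows "k_op n q \<phi> x i (F v) = (q powi z) \<star> F (k_op n q \<phi> x i v)"
    "kinv_op n q \<phi> x i (F v) = (q powi (- z)) \<star> F (kinv_op n q \<phi> x i v)"
proof -
  have "F (m a) \<in> graded (kw i) (wt (kw i) a + z)" if "a \<in> expos n" for a
    using assms(1) graded_mono[OF that] by (auto simp: homog_def)
  note k = k_op_graded[OF this assms(3)]
  have "k_op n q \<phi> x i \<circ> F = opsc \<phi> (q powi z) (F \<circ> k_op n q \<phi> x i)"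
    using q0 assms by (intro lin_eqI lin_comp lin_opsc lin_k_op)
      (simp_all add: k k_op_mono opsc_sc lin_scale[OF assms(2)] power_int_add mult.commute)
  then show "k_op n q \<phi> x i (F v) = (q powi z) \<star> F (k_op n q \<phi> x i v)"
    by (auto simp: fun_eq_iff opsc_sc)
  have "q powi (- (c + z)) = q powi (- z) * q powi (- c)" for c
    using q0 power_int_add[of q "- z" "- c"] by (simp add: add.commute)
  then have neg: "q powi (- c - z) = q powi (- z) * q powi (- c)" for c by simp
  have "kinv_op n q \<phi> x i \<circ> F = opsc \<phi> (q powi (- z)) (F \<circ> kinv_op n q \<phi> x i)"
    using q0 assms by (intro lin_eqI lin_comp lin_opsc lin_kinv_op)
      (simp_all add: k k_op_mono opsc_sc lin_scale[OF assms(2)] neg)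
  then show "kinv_op n q \<phi> x i (F v) = (q powi (- z)) \<star> F (kinv_op n q \<phi> x i v)"
    by (auto simp: fun_eq_iff opsc_sc)
qed

lemma k_kinv:
  assumes "i \<in> {1..n}"
  shows "k_op n q \<phi> x i (kinv_op n q \<phi> x i v) = v" "kinv_op n q \<phi> x i (k_op n q \<phi> x i v) = v"
proof -
  have "k_op n q \<phi> x i \<circ> kinv_op n q \<phi> x i = id" "kinv_op n q \<phi> x i \<circ> k_op n q \<phi> x i = id"
    using q0 assms by (intro lin_eqI lin_comp lin_id lin_kinv_op lin_k_op;
      simp add: k_op_mono lin_scale[OF lin_k_op] lin_scale[OF lin_kinv_op] power_int_minus)+
  then show "k_op n q \<phi> x i (kinv_op n q \<phi> x i v) = v" "kinv_op n q \<phi> x i (k_op n q \<phi> x i v) = v"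
    by (simp_all add: fun_eq_iff)
qed

lemma k_commute:
  assumes "i \<in> {1..n}" "j \<in> {1..n}"
  shows "k_op n q \<phi> x i \<circ> k_op n q \<phi> x j = k_op n q \<phi> x j \<circ> k_op n q \<phi> x i"
  using assms by (intro lin_eqI lin_comp lin_k_op)
    (auto simp: k_op_mono lin_scale[OF lin_k_op] mult.commute)

lemma lin_e_op: "i \<in> {1..n} \<Longrightarrow> lin (e_op n q \<phi> x i)"
  and lin_f_op: "i \<in> {1..n} \<Longrightarrow> lin (f_op n q \<phi> x i)"
  by (simp_all add: e_op_gen_op f_op_gen_op lin_gen_op lin_opsc)

lemma qi_powi:
  assumes "i \<in> {1..n}" "j \<in> {1..n}"
  shows "qi q i powi cartan i j = q powi (if j = 1 then - 2 * kw i 1 else kw i (int j - 1) - kw i (int j))"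
    (is "?l = q powi ?r")
proof -
  \<comment> \<open>The weight shifts form the symmetrized Cartan matrix; its factor 2 for
    \<open>i = 1\<close> is absorbed by q_1 = q^2.\<close>
  have "?r = (if i = 1 then 2 else 1) * cartan i j"
  proof -
    have kw1: "kw 1 (int l) = (if l = 1 then -2 else 0)" for l
      by (simp add: kw_def)
    have kw2: "kw i (int l) = (if Suc l = i then 1 else 0) - (if l = i then 1 else 0)"
      if "i \<noteq> 1" "1 \<le> l" for l
    proof -
      have "int l \<noteq> - int i" "int l \<noteq> 1 - int i" "int l = int i - 1 \<longleftrightarrow> Suc l = i"
        using that assms by auto
      then show ?thesis using that by (simp add: kw_def)
    qed
    obtain l where l: "j = Suc l" using assms by (cases j) auto
    show ?thesis
    proof (cases "i = 1")
      case True
      then show ?thesis using kw1[of 1] kw1[of l] kw1[of j] by (simp add: l cartan_def)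
    next
      case False
      show ?thesis
      proof (cases "l = 0")
        case True
        then show ?thesis using False kw2[of 1] assms by (simp add: l cartan_def)
      next
        case False
        then show ?thesis using \<open>i \<noteq> 1\<close> kw2[of l] kw2[of j] by (simp add: l cartan_def)
      qed
    qed
  qed
  moreover have "(q ^ 2) powi c = q powi (2 * c)" for c
    by (simp add: power_int_mult)
  ultimately show ?thesis by (simp add: qi_def)
qed

lemma homog_e_op:
  assumes w: "\<And>l. l \<in> Iset n \<Longrightarrow> w l + w (- l) = c" and j: "j \<in> {1..n}"
  shows "homog w (if j = 1 then c - 2 * w 1 else w (int j - 1) - w (int j)) (e_op n q \<phi> x j)"
  using homog_gen_op[where w = w and c = c and s = 1 and j = "int j", OF w] j by (auto simp: e_op_gen_op split: if_splits)

lemma homog_f_op: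
  assumes w: "\<And>l. l \<in> Iset n \<Longrightarrow> w l + w (- l) = c" and j: "j \<in> {1..n}"
  shows "homog w (if j = 1 then c - 2 * w (-1) else w (1 - int j) - w (- int j)) (f_op n q \<phi> x j)"
  using homog_gen_op[where w = w and c = c and s = "-1" and j = "int j", OF w] j by (auto simp: f_op_gen_op intro: homog_scale split: if_splits)

lemma k_e:
  assumes "i \<in> {1..n}" "j \<in> {1..n}"
  shows "k_op n q \<phi> x i (e_op n q \<phi> x j v) = (qi q i powi cartan i j) \<star> e_op n q \<phi> x j (k_op n q \<phi> x i v)"
    "kinv_op n q \<phi> x i (e_op n q \<phi> x j v) = (qi q i powi (- cartan i j)) \<star> e_op n q \<phi> x j (kinv_op n q \<phi> x i v)"
  using k_op_homog[OF homog_e_op[where w = "kw i" and c = 0, OF kw_antisym assms(2)] lin_e_op[OF assms(2)] assms(1)] qi_powi[OF assms]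
  by (simp_all add: power_int_minus split: if_splits)

lemma k_f:
  assumes "i \<in> {1..n}" "j \<in> {1..n}"
  shows "k_op n q \<phi> x i (f_op n q \<phi> x j v) = (qi q i powi (- cartan i j)) \<star> f_op n q \<phi> x j (k_op n q \<phi> x i v)"
    "kinv_op n q \<phi> x i (f_op n q \<phi> x j v) = (qi q i powi cartan i j) \<star> f_op n q \<phi> x j (kinv_op n q \<phi> x i v)"
proof -
  have neg: "kw i (- l) = - kw i l" for l using kw_antisym[of i l] by simp
  have "(if j = 1 then 0 - 2 * kw i (-1) else kw i (1 - int j) - kw i (- int j))
    = - (if j = 1 then - 2 * kw i 1 else kw i (int j - 1) - kw i (int j))"
    using neg[of 1] neg[of "int j - 1"] neg[of "int j"] by simp
  then show "k_op n q \<phi> x i (f_op n q \<phi> x j v) = (qi q i powi (- cartan i j)) \<star> f_op n q \<phi> x j (k_op n q \<phi> x i v)"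
    "kinv_op n q \<phi> x i (f_op n q \<phi> x j v) = (qi q i powi cartan i j) \<star> f_op n q \<phi> x j (kinv_op n q \<phi> x i v)"
    using k_op_homog[OF homog_f_op[where w = "kw i" and c = 0, OF kw_antisym assms(2)] lin_f_op[OF assms(2)] assms(1), of v]
      qi_powi[OF assms]
    by (simp_all only: power_int_minus minus_minus)
qed

section \<open>The quantum Serre relations\<close>

text \<open>For \<^term>\<open>p = cartan i j\<close>, \<open>adq Q p f g t\<close> is the \<open>t\<close>-fold quantum adjoint action of
  \<^term>\<open>f\<close> on \<^term>\<open>g\<close>; the Serre relation says that it vanishes for \<open>t = 1 - p\<close>.\<close>

primrec adq :: "'k \<Rightarrow> int \<Rightarrow> ('a \<Rightarrow> 'a) \<Rightarrow> ('a \<Rightarrow> 'a) \<Rightarrow> nat \<Rightarrow> 'a \<Rightarrow> 'a" where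
  "adq Q p f g 0 = g"
| "adq Q p f g (Suc t) =
    (\<lambda>v. f (adq Q p f g t v) - (Q powi (- (p + 2 * int t))) \<star> adq Q p f g t (f v))"

text \<open>This is -[t][t + p - 1] in \<open>Q\<close>-integers, with zeros at \<open>t = 0\<close>
  and at the Serre exponent \<open>t = 1 - p\<close>.\<close>

definition adq_coeff :: "'k \<Rightarrow> int \<Rightarrow> nat \<Rightarrow> 'k" where
  "adq_coeff Q p t = - ((Q powi int t - Q powi (- int t))
    * (Q powi (p + int t - 1) - Q powi (1 - p - int t))) / (Q - inverse Q) ^ 2"

text \<open>In \<open>Q\<close>-integers this reads [t+1][t+p] = [t][t+p-1] + [2t+p], a rational
  identity in the powers \<open>a\<close> and \<open>b\<close>.\<close>

lemma adq_coeff_Suc: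
  assumes "Q \<noteq> 0" "Q - inverse Q \<noteq> 0"
  shows "adq_coeff Q p (Suc t) = adq_coeff Q p t
    - (Q powi (p + 2 * int t) - Q powi (- (p + 2 * int t))) * inverse (Q - inverse Q)"
proof -
  define a b L where "a = Q powi int t" and "b = Q powi p" and "L = Q - inverse Q"
  have nz: "a \<noteq> 0" "b \<noteq> 0" "L \<noteq> 0" using assms by (auto simp: a_def b_def L_def)
  have pw: "Q powi int (Suc t) = a * Q" "Q powi (- int (Suc t)) = inverse (a * Q)"
    "Q powi (p + int (Suc t) - 1) = a * b" "Q powi (1 - p - int (Suc t)) = inverse (a * b)"
    "Q powi (- int t) = inverse a" "Q powi (p + int t - 1) = a * b / Q"
    "Q powi (1 - p - int t) = Q / (a * b)"
    "Q powi (p + 2 * int t) = a * a * b" "Q powi (- (p + 2 * int t)) = inverse (a * a * b)"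
  proof -
    have P: "Q powi (y + z) = Q powi y * Q powi z" "Q powi (- z) = inverse (Q powi z)" for y z
      using assms(1) by (simp_all add: power_int_add power_int_minus)
    have e: "int (Suc t) = int t + 1" "p + (int t + 1) - 1 = p + int t"
      "1 - p - (int t + 1) = - (p + int t)" "p + int t - 1 = p + int t + - 1"
      "1 - p - int t = - (p + int t + - 1)" "p + 2 * int t = p + (int t + int t)"
      by simp_all
    show "Q powi int (Suc t) = a * Q" "Q powi (- int (Suc t)) = inverse (a * Q)"
      "Q powi (p + int (Suc t) - 1) = a * b" "Q powi (1 - p - int (Suc t)) = inverse (a * b)"
      "Q powi (- int t) = inverse a" "Q powi (p + int t - 1) = a * b / Q"
      "Q powi (1 - p - int t) = Q / (a * b)"
      "Q powi (p + 2 * int t) = a * a * b" "Q powi (- (p + 2 * int t)) = inverse (a * a * b)"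
      unfolding e P a_def[symmetric] b_def[symmetric] by (simp_all add: divide_inverse)
  qed
  have "(a * Q - inverse (a * Q)) * (a * b - inverse (a * b))
    = (a - inverse a) * (a * b / Q - Q / (a * b)) + (a * a * b - inverse (a * a * b)) * (Q - inverse Q)"
    using nz assms(1) by (simp add: field_simps)
  moreover have "- (y + z * L) / L ^ 2 = - y / L ^ 2 - z * inverse L" for y z
    using nz(3) by (simp add: field_simps power2_eq_square)
  ultimately have "- ((a * Q - inverse (a * Q)) * (a * b - inverse (a * b))) / L ^ 2
    = - ((a - inverse a) * (a * b / Q - Q / (a * b))) / L ^ 2
      - (a * a * b - inverse (a * a * b)) * inverse L"
    by (simp only: L_def[symmetric])
  then show ?thesis unfolding adq_coeff_def pw L_def by (simp add: a_def)
qed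

lemma adq_coeff_0 [simp]: "adq_coeff Q p 0 = 0" by (simp add: adq_coeff_def)

lemma adq_coeff_ne_0:
  assumes "Q \<noteq> 0" "\<forall>m::nat. m > 0 \<longrightarrow> Q ^ m \<noteq> 1" "0 < t" "0 < p + int t - 1"
  shows "adq_coeff Q p t \<noteq> 0"
proof -
  have ne: "Q powi z - Q powi (- z) \<noteq> 0" if "0 < z" for z
  proof
    assume "Q powi z - Q powi (- z) = 0"
    then have "Q powi z * Q powi z = 1"
      using assms(1) by (simp add: power_int_minus field_simps)
    then have "Q powi (2 * z) = 1" using assms(1) by (simp add: power_int_add[symmetric])
    then have "Q ^ nat (2 * z) = 1" using that by (simp add: power_int_def)
    then show False using assms(2) that by auto
  qed
  have "Q - inverse Q \<noteq> 0" using ne[of 1] by simp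
  moreover have "Q powi (p + int t - 1) - Q powi (1 - p - int t) \<noteq> 0"
    using ne[OF assms(4)] by (simp add: diff_diff_eq)
  ultimately show ?thesis using ne[of "int t"] assms(3) by (simp add: adq_coeff_def)
qed

lemma lin_adq: "lin f \<Longrightarrow> lin g \<Longrightarrow> lin (adq Q p f g t)"
proof (induction t)
  case (Suc t)
  then show ?case unfolding adq.simps
    by (intro lin_minus_fun lin_scale_fun lin_comp_fun[OF _ Suc.IH] lin_comp_fun[OF Suc.IH]) auto
qed simp

text \<open>\<open>e\<close> commutes with \<open>g\<close>, so only its passages past the factors
  \<open>f\<close> count, each leaving a \<open>k\<close> and a \<open>k'\<close>. The scalar in
  \<open>adq\<close> is chosen such that the contributions of \<open>k\<close> drop out.\<close>

lemma adq_kill: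
  assumes lin: "lin e" "lin f" "lin g" "lin k" "lin k'"
    and Q: "Q \<noteq> 0" "Q - inverse Q \<noteq> 0"
    and ef: "\<And>v. e (f v) - f (e v) = inverse (Q - inverse Q) \<star> (k v - k' v)"
    and eg: "\<And>v. e (g v) = g (e v)"
    and kf: "\<And>v. k (f v) = (Q powi (-2)) \<star> f (k v)" "\<And>v. k' (f v) = (Q powi 2) \<star> f (k' v)"
    and kg: "\<And>v. k (g v) = (Q powi (- p)) \<star> g (k v)" "\<And>v. k' (g v) = (Q powi p) \<star> g (k' v)"
  shows "e (adq Q p f g t v) - adq Q p f g t (e v) = adq_coeff Q p t \<star> adq Q p f g (t - 1) (k' v)"
proof -
  let ?U = "adq Q p f g" and ?L = "inverse (Q - inverse Q)"
  define c where "c t = Q powi (- (p + 2 * int t))" for t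
  define d where "d t = Q powi (p + 2 * int t)" for t
  note lU = lin_adq[OF lin(2,3), of Q p]
  have c_Suc: "c (Suc t) = Q powi (-2) * c t" and d_Suc: "d (Suc t) = Q powi 2 * d t"
    and dc: "Q powi 2 * c (Suc t) = c t" for t
    using Q(1) power_int_add[of Q "-2" "- (p + 2 * int t)"] power_int_add[of Q "2" "p + 2 * int t"]
      power_int_add[of Q "2" "- (p + 2 * int (Suc t))"]
    by (simp_all add: c_def d_def algebra_simps)
  have U_Suc: "?U (Suc t) v = f (?U t v) - c t \<star> ?U t (f v)" for t v
    by (simp add: c_def)
  \<comment> \<open>\<open>c t\<close> is thus both the coefficient in the recursion and the
    commutation factor of \<open>k\<close> with the t-th power.\<close>
  have kU: "k (?U t v) = c t \<star> ?U t (k v)" for t v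
  proof (induction t arbitrary: v)
    case 0
    show ?case by (simp add: kg c_def)
  next
    case (Suc t)
    show ?case unfolding U_Suc
      by (simp add: Suc kf c_Suc lin_simps[OF lin(4)] lin_simps[OF lin(2)] lin_scale[OF lU]
          scale_right_diff_distrib mult_ac)
  qed
  have kU': "k' (?U t v) = d t \<star> ?U t (k' v)" for t v
  proof (induction t arbitrary: v)
    case 0
    show ?case by (simp add: kg d_def)
  next
    case (Suc t)
    show ?case unfolding U_Suc
      by (simp add: Suc kf d_Suc lin_simps[OF lin(5)] lin_simps[OF lin(2)] lin_scale[OF lU]
          scale_right_diff_distrib mult_ac)
  qed
  have ef': "e (f v) = f (e v) + ?L \<star> (k v - k' v)" for v using ef[of v] by (simp add: algebra_simps)
  show ?thesis
  proof (induction t arbitrary: v)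
    case 0
    show ?case by (simp add: eg)
  next
    case (Suc t)
    let ?a = "adq_coeff Q p t"
    have IH: "e (?U t w) = ?U t (e w) + ?a \<star> ?U (t - 1) (k' w)" for w
      using Suc.IH[of w] by (simp add: algebra_simps)
    \<comment> \<open>Moving \<open>k'\<close> past \<open>f\<close> turns \<open>c t\<close> into
      \<open>c (t - 1)\<close>, so the bracket is again an adjoint power. For \<open>t = 0\<close>
      the coefficient \<open>?a\<close> is zero.\<close>
    have step: "?a \<star> (f (?U (t - 1) (k' v)) - c t \<star> ?U (t - 1) (k' (f v))) = ?a \<star> ?U t (k' v)"
    proof (cases t)
      case (Suc l)
      then show ?thesis using dc[of l] by (simp add: kf lin_scale[OF lU] U_Suc mult.commute del: adq.simps)
    qed simp
    have "e (?U (Suc t) v) - ?U (Suc t) (e v)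
      = ?a \<star> (f (?U (t - 1) (k' v)) - c t \<star> ?U (t - 1) (k' (f v)))
        + ?L \<star> (k (?U t v) - c t \<star> ?U t (k v)) - ?L \<star> (k' (?U t v) - c t \<star> ?U t (k' v))"
      unfolding U_Suc
      by (simp add: lin_simps[OF lin(1)] IH ef' lin_simps[OF lin(2)] lin_simps[OF lU]
          scale_right_diff_distrib scale_right_distrib mult_ac)
    \<comment> \<open>The bracket with \<open>k\<close> vanishes by \<open>kU\<close>; the one with
      \<open>k'\<close> contributes \<open>d t - c t\<close> by \<open>kU'\<close>.\<close>
    also have "\<dots> = (?a - (d t - c t) * ?L) \<star> ?U t (k' v)"
      unfolding step kU kU'
      by (simp add: algebra_simps)
    also have "?a - (d t - c t) * ?L = adq_coeff Q p (Suc t)"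
      unfolding adq_coeff_Suc[OF Q] c_def d_def ..
    finally show ?case by simp
  qed
qed

text \<open>Descent: if the next adjoint power vanishes on the stable set \<open>W\<close>, then so
  does its commutator with \<open>e\<close>, which is a nonzero multiple of the present one.\<close>

lemma adq_vanish:
  assumes lin: "lin e" "lin f" "lin g" "lin k" "lin k'"
    and Q: "Q \<noteq> 0" "\<forall>m::nat. m > 0 \<longrightarrow> Q ^ m \<noteq> 1"
    and ef: "\<And>v. e (f v) - f (e v) = inverse (Q - inverse Q) \<star> (k v - k' v)"
    and eg: "\<And>v. e (g v) = g (e v)"
    and kf: "\<And>v. k (f v) = (Q powi (-2)) \<star> f (k v)" "\<And>v. k' (f v) = (Q powi 2) \<star> f (k' v)"
    and kg: "\<And>v. k (g v) = (Q powi (- p)) \<star> g (k v)" "\<And>v. k' (g v) = (Q powi p) \<star> g (k' v)"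
    and k: "\<And>v. k' (k v) = v"
    and W: "\<And>v. v \<in> W \<Longrightarrow> e v \<in> W" "\<And>v. v \<in> W \<Longrightarrow> k v \<in> W"
    and K: "\<And>t v. K \<le> t \<Longrightarrow> v \<in> W \<Longrightarrow> adq Q p f g t v = 0"
    and t: "1 - p \<le> int t" and v: "v \<in> W"
  shows "adq Q p f g t v = 0"
proof -
  have "Q - inverse Q \<noteq> 0"
  proof
    assume "Q - inverse Q = 0"
    then have "Q ^ 2 = 1" using Q(1) by (simp add: field_simps power2_eq_square)
    then show False using Q(2) by auto
  qed
  note kill = adq_kill[OF lin Q(1) this ef eg kf kg]
  \<comment> \<open>\<open>r\<close> bounds the distance to \<open>K\<close>, from where on
    vanishing is known.\<close>
  have "\<forall>v\<in>W. adq Q p f g l v = 0" if "1 - p \<le> int l" "K \<le> l + r" for l r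
    using that
  proof (induction r arbitrary: l)
    case 0
    then show ?case using K by simp
  next
    case (Suc r)
    have IH: "\<forall>v\<in>W. adq Q p f g (Suc l) v = 0" using Suc.IH[of "Suc l"] Suc.prems by simp
    show ?case
    proof
      fix v assume v: "v \<in> W"
      \<comment> \<open>The commutator is evaluated at \<open>k v\<close>, so that \<open>k'\<close>
        in its value is undone. The coefficient has index \<open>Suc l\<close>, which exceeds 1 - p
        even for the Serre exponent \<open>l\<close>.\<close>
      have "adq_coeff Q p (Suc l) \<star> adq Q p f g l v = 0"
        using kill[of "Suc l" "k v"] IH W v by (simp add: k lin_zero[OF lin(1)] del: adq.simps)
      then show "adq Q p f g l v = 0" using adq_coeff_ne_0[OF Q, of "Suc l" p] Suc.prems by auto
    qed
  qed
  then show ?thesis using t v by (metis le_add2)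
qed

lemma homog_adq:
  assumes "homog w z f" "homog w z' g"
  shows "homog w (z' + int t * z) (adq Q p f g t)"
proof (induction t)
  case 0
  then show ?case using assms by simp
next
  case (Suc t)
  have "homog w (z + (z' + int t * z)) (f \<circ> adq Q p f g t)"
    "homog w (z' + int t * z + z) (adq Q p f g t \<circ> f)"
    by (rule homog_comp[OF assms(1) Suc.IH], rule homog_comp[OF Suc.IH assms(1)])
  then have "homog w (z' + int (Suc t) * z) (opadd (f \<circ> adq Q p f g t)
     (opsc \<phi> (- (Q powi (- (p + 2 * int t)))) (adq Q p f g t \<circ> f)))"
    by (intro homog_add homog_scale) (simp_all add: algebra_simps)
  then show ?case by (simp add: opadd_def opsc_sc)
qed

text \<open>The quantum adjoint action is nilpotent on monomials of bounded degree, because each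
  factor lowers a second, nonnegative grading which is bounded on such monomials.\<close>

lemma adq_eventually_zero:
  assumes lin: "lin f" "lin g" and wb: "\<And>l. l \<in> Iset n \<Longrightarrow> 0 \<le> w l" "\<And>l. l \<in> Iset n \<Longrightarrow> w l \<le> b"
    and h: "homog w z f" "homog w z' g" "z < 0" "z' < 0"
    and v: "v \<in> graded (\<lambda>_. 1) d" and t: "nat (b * d) \<le> t"
  shows "adq Q p f g t v = 0"
  using lin_adq[OF lin] v
proof (rule graded_expand[where P = "\<lambda>u. u = 0"])
  fix a assume a: "a \<in> expos n" "wt (\<lambda>_. 1) a = d"
  \<comment> \<open>The weight is at most \<open>b\<close> times the degree, and the shifts are
    integers below 0, so \<open>t\<close> factors exhaust it.\<close>
  have "wt w a \<le> b * wt (\<lambda>_. 1) a"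
    unfolding wt_def sum_distrib_left by (intro sum_mono) (use wb in \<open>auto intro: mult_right_mono\<close>)
  moreover have "b * d \<le> int t" using t by simp
  ultimately have "wt w a \<le> int t" using a by simp
  moreover have "int t * z \<le> int t * (- 1)"
    using h(3) by (intro mult_left_mono) auto
  ultimately have "wt w a + (z' + int t * z) < 0" using h(4) by simp
  moreover have "adq Q p f g t (m a) \<in> graded w (wt w a + (z' + int t * z))"
    using homog_adq[OF h(1,2)] graded_mono[OF a(1)] by (auto simp: homog_def)
  ultimately show "adq Q p f g t (m a) = 0" using graded_neg wb(1) by blast
qed auto

lemma qi_props:
  "qi q i \<noteq> 0" "\<forall>m::nat. m > 0 \<longrightarrow> qi q i ^ m \<noteq> 1"
  using q0 q_not_root by (auto simp: qi_def power_mult[symmetric])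

lemma k_HS1:
  assumes "i \<in> {1..n}" "v \<in> graded (\<lambda>_. 1) d"
  shows "k_op n q \<phi> x i v \<in> graded (\<lambda>_. 1) d" "kinv_op n q \<phi> x i v \<in> graded (\<lambda>_. 1) d"
proof -
  have "k_op n q \<phi> x i (m a) \<in> graded (\<lambda>_. 1) (wt (\<lambda>_. 1) a + 0)"
    "kinv_op n q \<phi> x i (m a) \<in> graded (\<lambda>_. 1) (wt (\<lambda>_. 1) a + 0)" if "a \<in> expos n" for a
    using that by (simp_all add: k_op_mono[OF that assms(1)] graded_scale graded_mono)
  then have "homog (\<lambda>_. 1) 0 (k_op n q \<phi> x i)" "homog (\<lambda>_. 1) 0 (kinv_op n q \<phi> x i)"
    by (intro homogI lin_k_op lin_kinv_op; simp)+
  then show "k_op n q \<phi> x i v \<in> graded (\<lambda>_. 1) d" "kinv_op n q \<phi> x i v \<in> graded (\<lambda>_. 1) d"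
    using assms(2) by (auto simp: homog_def)
qed

lemma adq_F:
  assumes ij: "i \<in> {1..n}" "j \<in> {1..n}" "i \<noteq> j" and t: "1 - cartan i j \<le> int t"
  shows "adq (qi q i) (cartan i j) (f_op n q \<phi> x i) (f_op n q \<phi> x j) t v = 0"
proof -
  let ?e = "e_op n q \<phi> x" and ?f = "f_op n q \<phi> x" and ?k = "k_op n q \<phi> x" and ?k' = "kinv_op n q \<phi> x"
  \<comment> \<open>Between 0 and 2n on all letters, with total 2n on opposite ones; f_1 lowers this
    weight by 2 and every other f_j by 1.\<close>
  let ?w = "\<lambda>l. int n - l"
  \<comment> \<open>With all letter weights equal to 1 the generators have shift 0, so each degree
    component is stable.\<close>
  have d: "e_op n q \<phi> x i u \<in> graded (\<lambda>_. 1) d" if "u \<in> graded (\<lambda>_. 1) d" for u d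
    using homog_e_op[where w = "\<lambda>_. 1" and c = 2, OF _ ij(1)] that by (auto simp: homog_def split: if_splits)
  have hf: "\<exists>z<0. homog ?w z (?f j)" if "j \<in> {1..n}" for j
    using homog_f_op[where w = ?w and c = "2 * int n" and j = j, OF _ that] by (force split: if_splits)
  obtain z z' where z: "homog ?w z (?f i)" "z < 0" "homog ?w z' (?f j)" "z' < 0"
    using hf[OF ij(1)] hf[OF ij(2)] by auto
  have c2: "cartan i i = 2" by (simp add: cartan_def)
  have zero: "adq (qi q i) (cartan i j) (?f i) (?f j) t u = 0" if "u \<in> graded (\<lambda>_. 1) d" for u d
  proof (rule adq_vanish[where W = "graded (\<lambda>_. 1) d" and K = "nat (2 * int n * d)"])
    show "?e i (?f i v) - ?f i (?e i v) = inverse (qi q i - inverse (qi q i)) \<star> (?k i v - ?k' i v)" for v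
      by (rule e_f_diag[OF ij(1)])
    show "?e i (?f j v) = ?f j (?e i v)" for v by (rule e_f_commute[OF ij])
    show "?k i (?f i v) = (qi q i powi (-2)) \<star> ?f i (?k i v)"
      "?k' i (?f i v) = (qi q i powi 2) \<star> ?f i (?k' i v)" for v
      using k_f[OF ij(1) ij(1)] c2 by simp_all
    show "?k i (?f j v) = (qi q i powi (- cartan i j)) \<star> ?f j (?k i v)"
      "?k' i (?f j v) = (qi q i powi cartan i j) \<star> ?f j (?k' i v)" for v
      using k_f[OF ij(1,2)] by simp_all
    show "adq (qi q i) (cartan i j) (?f i) (?f j) t v = 0"
      if "nat (2 * int n * d) \<le> t" "v \<in> graded (\<lambda>_. 1) d" for t v
      by (rule adq_eventually_zero[where w = ?w and b = "2 * int n", OF _ _ _ _ z(1,3,2,4) that(2,1)])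
        (use ij in \<open>auto simp: lin_f_op Iset_iff\<close>)
  qed (use ij t that d in \<open>auto simp: lin_e_op lin_f_op lin_k_op lin_kinv_op qi_props k_kinv k_HS1\<close>)
  have "adq (qi q i) (cartan i j) (?f i) (?f j) t = opsc \<phi> 0 id"
    by (rule lin_eqI) (use ij in \<open>auto simp: lin_adq lin_f_op lin_opsc lin_id opsc_sc intro: zero graded_mono\<close>)
  then show ?thesis by (simp add: opsc_sc)
qed

lemma adq_E:
  assumes ij: "i \<in> {1..n}" "j \<in> {1..n}" "i \<noteq> j" and t: "1 - cartan i j \<le> int t"
  shows "adq (qi q i) (cartan i j) (e_op n q \<phi> x i) (e_op n q \<phi> x j) t v = 0"
proof -
  let ?e = "e_op n q \<phi> x" and ?f = "f_op n q \<phi> x" and ?k = "k_op n q \<phi> x" and ?k' = "kinv_op n q \<phi> x"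
  let ?w = "\<lambda>l. int n + l"
  have d: "?f i u \<in> graded (\<lambda>_. 1) d" if "u \<in> graded (\<lambda>_. 1) d" for u d
    using homog_f_op[where w = "\<lambda>_. 1" and c = 2, OF _ ij(1)] that by (auto simp: homog_def split: if_splits)
  have he: "\<exists>z<0. homog ?w z (?e j)" if "j \<in> {1..n}" for j
    using homog_e_op[where w = ?w and c = "2 * int n" and j = j, OF _ that] by (force split: if_splits)
  obtain z z' where z: "homog ?w z (?e i)" "z < 0" "homog ?w z' (?e j)" "z' < 0"
    using he[OF ij(1)] he[OF ij(2)] by auto
  have c2: "cartan i i = 2" by (simp add: cartan_def)
  \<comment> \<open>The roles are exchanged: f_i now commutes past the e's, and since [f_i, e_i] =
    -[e_i, f_i], k_i and its inverse trade places.\<close>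
  have zero: "adq (qi q i) (cartan i j) (?e i) (?e j) t u = 0" if "u \<in> graded (\<lambda>_. 1) d" for u d
  proof (rule adq_vanish[where W = "graded (\<lambda>_. 1) d" and K = "nat (2 * int n * d)" and e = "?f i"
        and k = "?k' i" and k' = "?k i"])
    show "?f i (?e i v) - ?e i (?f i v) = inverse (qi q i - inverse (qi q i)) \<star> (?k' i v - ?k i v)" for v
      using arg_cong[OF e_f_diag[OF ij(1), of v], of uminus] by (simp add: scale_right_diff_distrib)
    show "?f i (?e j v) = ?e j (?f i v)" for v using e_f_commute[of j i] ij by simp
    show "?k' i (?e i v) = (qi q i powi (-2)) \<star> ?e i (?k' i v)"
      "?k i (?e i v) = (qi q i powi 2) \<star> ?e i (?k i v)" for v
      using k_e[OF ij(1) ij(1)] c2 by simp_all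
    show "?k' i (?e j v) = (qi q i powi (- cartan i j)) \<star> ?e j (?k' i v)"
      "?k i (?e j v) = (qi q i powi cartan i j) \<star> ?e j (?k i v)" for v
      using k_e[OF ij(1,2)] by simp_all
    show "adq (qi q i) (cartan i j) (?e i) (?e j) t v = 0"
      if "nat (2 * int n * d) \<le> t" "v \<in> graded (\<lambda>_. 1) d" for t v
      by (rule adq_eventually_zero[where w = ?w and b = "2 * int n", OF _ _ _ _ z(1,3,2,4) that(2,1)])
        (use ij in \<open>auto simp: lin_e_op Iset_iff\<close>)
  qed (use ij t that d in \<open>auto simp: lin_e_op lin_f_op lin_k_op lin_kinv_op qi_props k_kinv k_HS1\<close>)
  have "adq (qi q i) (cartan i j) (?e i) (?e j) t = opsc \<phi> 0 id"
    by (rule lin_eqI) (use ij in \<open>auto simp: lin_adq lin_e_op lin_opsc lin_id opsc_sc intro: zero graded_mono\<close>)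
  then show ?thesis by (simp add: opsc_sc)
qed

section \<open>From adjoint powers to the Serre sums\<close>

definition serre_op :: "'k \<Rightarrow> nat \<Rightarrow> ('a \<Rightarrow> 'a) \<Rightarrow> ('a \<Rightarrow> 'a) \<Rightarrow> 'a \<Rightarrow> 'a" where
  "serre_op Q r f g = foldr opadd (map (\<lambda>t. opsc \<phi> ((-1) ^ t * qbinom Q r t)
     ((((\<circ>) f ^^ t) id \<circ> g) \<circ> ((\<circ>) f ^^ (r - t)) id)) [0..<r + 1]) (opsc \<phi> 0 id)"

lemma qnum_eqs:
  assumes "Q \<noteq> 0" "Q - inverse Q \<noteq> 0"
  shows "qnum Q 1 = 1" "qnum Q 2 = Q + inverse Q" "qnum Q 3 = Q ^ 2 + 1 + inverse Q ^ 2"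
proof -
  have "Q ^ 2 - inverse Q ^ 2 = (Q + inverse Q) * (Q - inverse Q)"
    "Q ^ 3 - inverse Q ^ 3 = (Q ^ 2 + 1 + inverse Q ^ 2) * (Q - inverse Q)"
    using assms(1) by (simp_all add: field_simps power2_eq_square power3_eq_cube)
  then show "qnum Q 1 = 1" "qnum Q 2 = Q + inverse Q" "qnum Q 3 = Q ^ 2 + 1 + inverse Q ^ 2"
    using assms(2) by (simp_all add: qnum_def)
qed

text \<open>With L and R left and right composition with \<open>f\<close>, the adjoint power is the
  product of the factors L - Q^(-(p+2i)) R. For \<open>t = 1 - p\<close> the exponents are symmetric
  around 0, and the product expands with Gaussian binomials. The three exponents that occur are
  expanded by hand.\<close>

lemma serre_op_eq_adq:
  assumes "lin f" "lin g" "Q \<noteq> 0" "\<forall>m::nat. m > 0 \<longrightarrow> Q ^ m \<noteq> 1" "p = 0 \<or> p = -1 \<or> p = -2"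
  shows "serre_op Q (nat (1 - p)) f g v = ((-1) ^ nat (1 - p)) \<star> adq Q p f g (nat (1 - p)) v"
proof -
  have qn: "qnum Q j \<noteq> 0" if "j > 0" for j
  proof
    assume 0: "qnum Q j = 0"
    have "Q ^ 2 \<noteq> 1" using assms(4) by simp
    then have "Q - inverse Q \<noteq> 0" using assms(3) by (auto simp: field_simps power2_eq_square)
    then have "Q ^ j = inverse Q ^ j" using 0 by (simp add: qnum_def)
    then have "Q ^ j * Q ^ j = inverse Q ^ j * Q ^ j" by simp
    also have "\<dots> = 1" using assms(3) by (simp add: power_mult_distrib[symmetric])
    finally have "Q ^ (2 * j) = 1" by (simp add: mult_2 power_add)
    then show False using assms(4) that by simp
  qed
  have L: "Q - inverse Q \<noteq> 0" using qn[of 1] by (auto simp: qnum_def)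
  note q = qnum_eqs[OF assms(3) L]
  have b1: "qbinom Q 1 0 = 1" "qbinom Q 1 1 = 1"
    using qn by (simp_all add: qbinom_def)
  have b2: "qbinom Q 2 0 = 1" "qbinom Q 2 1 = Q + inverse Q" "qbinom Q 2 2 = 1"
    using qn[of 2] q by (simp_all add: qbinom_def numeral_eq_Suc)
  have b3: "qbinom Q 3 0 = 1" "qbinom Q 3 1 = Q ^ 2 + 1 + inverse Q ^ 2"
    "qbinom Q 3 2 = Q ^ 2 + 1 + inverse Q ^ 2" "qbinom Q 3 3 = 1"
    using qn[of 2] qn[of 3] q by (simp_all add: qbinom_def numeral_eq_Suc)
  note fg = lin_simps[OF assms(1)] lin_simps[OF assms(2)]
  show ?thesis
    using assms(5)
  proof (elim disjE)
    assume "p = 0"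
    then show ?thesis
      using b1 by (simp add: serre_op_def opadd_def opsc_sc)
  next
    assume p: "p = -1"
    have "[0..<2 + 1] = [0, 1, 2 :: nat]" by (simp add: upt_conv_Cons)
    then have "serre_op Q 2 f g v = g (f (f v)) - (Q + inverse Q) \<star> f (g (f v)) + f (f (g v))"
      unfolding serre_op_def using b2
      by (simp add: opadd_def opsc_sc numeral_eq_Suc) (simp flip: scale_minus_left)
    moreover have "adq Q (-1) f g 2 v = g (f (f v)) - (Q + inverse Q) \<star> f (g (f v)) + f (f (g v))"
      using assms(3) by (simp add: numeral_eq_Suc fg scale_left_distrib algebra_simps)
    ultimately show ?thesis using p by simp
  next
    assume p: "p = -2"
    let ?c = "Q ^ 2 + 1 + inverse Q ^ 2"
    have "[0..<3 + 1] = [0, 1, 2, 3 :: nat]" by (simp add: upt_conv_Cons)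
    then have "serre_op Q 3 f g v
      = g (f (f (f v))) - ?c \<star> f (g (f (f v))) + ?c \<star> f (f (g (f v))) - f (f (f (g v)))"
      unfolding serre_op_def using b3
      by (simp add: opadd_def opsc_sc numeral_eq_Suc) (simp flip: scale_minus_left)
    moreover have "Q powi -2 = inverse Q * inverse Q" "Q * (Q * (inverse Q * inverse Q)) = 1"
      using assms(3) by (simp_all add: power_int_def power2_eq_square divide_simps)
    then have "adq Q (-2) f g 3 v
      = - (g (f (f (f v))) - ?c \<star> f (g (f (f v))) + ?c \<star> f (f (g (f v))) - f (f (f (g v))))"
      using assms(3) by (simp add: numeral_eq_Suc fg scale_left_distrib algebra_simps)
    ultimately show ?thesis using p by simp
  qed
qed

abbreviation "eo \<equiv> e_op n q \<phi> x"
abbreviation "fo \<equiv> f_op n q \<phi> x"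
abbreviation "ko \<equiv> k_op n q \<phi> x"
abbreviation "kio \<equiv> kinv_op n q \<phi> x"

lemma cartan_values: "i \<noteq> j \<Longrightarrow> cartan i j = 0 \<or> cartan i j = -1 \<or> cartan i j = -2"
  by (auto simp: cartan_def)

lemma serre_op_e:
  assumes "i \<in> {1..n}" "j \<in> {1..n}" "i \<noteq> j"
  shows "serre_op (qi q i) (nat (1 - cartan i j)) (eo i) (eo j) = opsc \<phi> 0 id"
proof
  fix v
  have "1 - cartan i j \<le> int (nat (1 - cartan i j))" by simp
  from adq_E[OF assms this]
  show "serre_op (qi q i) (nat (1 - cartan i j)) (eo i) (eo j) v = opsc \<phi> 0 id v"
    by (subst serre_op_eq_adq)
      (use assms cartan_values qi_props lin_e_op in \<open>auto simp: opsc_sc\<close>)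
qed

lemma serre_op_f:
  assumes "i \<in> {1..n}" "j \<in> {1..n}" "i \<noteq> j"
  shows "serre_op (qi q i) (nat (1 - cartan i j)) (fo i) (fo j) = opsc \<phi> 0 id"
proof
  fix v
  have "1 - cartan i j \<le> int (nat (1 - cartan i j))" by simp
  from adq_F[OF assms this]
  show "serre_op (qi q i) (nat (1 - cartan i j)) (fo i) (fo j) v = opsc \<phi> 0 id v"
    by (subst serre_op_eq_adq)
      (use assms cartan_values qi_props lin_f_op in \<open>auto simp: opsc_sc\<close>)
qed

lemma k_kinv_comp: "i \<in> {1..n} \<Longrightarrow> ko i \<circ> kio i = id" "i \<in> {1..n} \<Longrightarrow> kio i \<circ> ko i = id"
  by (auto simp: k_kinv)

lemma k_e_comp:
  assumes "i \<in> {1..n}" "j \<in> {1..n}"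
  shows "ko i \<circ> eo j \<circ> kio i = opsc \<phi> (qi q i powi cartan i j) (eo j)"
  using assms by (auto simp: k_e k_kinv opsc_sc)

lemma k_f_comp:
  assumes "i \<in> {1..n}" "j \<in> {1..n}"
  shows "ko i \<circ> fo j \<circ> kio i = opsc \<phi> (qi q i powi (- cartan i j)) (fo j)"
  using assms by (auto simp: k_f k_kinv opsc_sc)

lemma e_f_comp:
  assumes "i \<in> {1..n}" "j \<in> {1..n}"
  shows "opadd (eo i \<circ> fo j) (opsc \<phi> (-1) (fo j \<circ> eo i)) =
    (if i = j then opsc \<phi> (inverse (qi q i - inverse (qi q i))) (opadd (ko i) (opsc \<phi> (-1) (kio i)))
     else opsc \<phi> 0 id)"
proof (cases "i = j")
  case True
  then show ?thesis using e_f_diag[OF assms(1)] by (auto simp: opadd_def opsc_sc)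
next
  case False
  then show ?thesis using e_f_commute[OF assms] by (auto simp: opadd_def opsc_sc)
qed

lemma uq_rels_operators:
  assumes "(l, r) \<in> uq_rels n q opadd (\<circ>) (opsc \<phi>) id eo fo ko kio"
  shows "l = r"
  using assms
proof (rule uq_rels_cases)
  fix Y i j
  assume "Y = eo \<or> Y = fo" and ij: "i \<in> {1..n}" "j \<in> {1..n}" "i \<noteq> j"
  then show "foldr opadd (map (\<lambda>t. opsc \<phi> ((-1) ^ t * qbinom (qi q i) (nat (1 - cartan i j)) t)
      (((\<circ>) (Y i) ^^ t) id \<circ> Y j \<circ> ((\<circ>) (Y i) ^^ (nat (1 - cartan i j) - t)) id))
      [0..<nat (1 - cartan i j) + 1]) (opsc \<phi> 0 id) = opsc \<phi> 0 id"
    using serre_op_e[OF ij, unfolded serre_op_def] serre_op_f[OF ij, unfolded serre_op_def]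
    by (elim disjE) (simp_all only:)
qed (rule k_commute k_kinv_comp k_e_comp k_f_comp e_f_comp; assumption)+

section \<open>The homomorphism\<close>

primrec opg :: "gen \<Rightarrow> 'a \<Rightarrow> 'a" where
  "opg (GE i) = eo i" | "opg (GF i) = fo i" | "opg (GK i) = ko i" | "opg (GKi i) = kio i"

definition opw :: "gen list \<Rightarrow> 'a \<Rightarrow> 'a" where
  "opw w = foldr (\<circ>) (map opg w) id"

definition ev :: "(gen list \<Rightarrow> 'k) \<Rightarrow> 'a \<Rightarrow> 'a" where
  "ev p v = (\<Sum>w | p w \<noteq> 0. p w \<star> opw w v)"

lemma lin_opg: "gidx g \<in> {1..n} \<Longrightarrow> lin (opg g)"
  by (cases g) (simp_all add: lin_e_op lin_f_op lin_k_op lin_kinv_op)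

lemma opw_append: "opw (u @ w) v = opw u (opw w v)"
  unfolding opw_def by (induction u) simp_all

lemma lin_opw: "\<forall>g\<in>set w. gidx g \<in> {1..n} \<Longrightarrow> lin (opw w)"
proof (induction w)
  case Nil
  show ?case using lin_id by (simp add: opw_def id_def)
next
  case (Cons g w)
  then have "lin (opg g \<circ> opw w)" by (intro lin_comp lin_opg) auto
  then show ?case by (simp add: opw_def comp_def)
qed

lemma ev_on:
  assumes "finite W" "{w. p w \<noteq> 0} \<subseteq> W"
  shows "ev p v = (\<Sum>w\<in>W. p w \<star> opw w v)"
  unfolding ev_def by (rule sum.mono_neutral_left) (use assms in auto)

lemma ev_fadd:
  assumes "p \<in> free_alg n" "r \<in> free_alg n"
  shows "ev (fadd p r) = opadd (ev p) (ev r)"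
proof
  fix v
  let ?A = "{w. p w \<noteq> 0} \<union> {w. r w \<noteq> 0}"
  have "finite ?A" using assms by (simp add: free_alg_finite)
  then show "ev (fadd p r) v = opadd (ev p) (ev r) v"
    by (subst (1) ev_on[of ?A], simp, force simp: fadd_def)
      (simp add: opadd_def ev_on[of ?A p] ev_on[of ?A r] fadd_def scale_left_distrib sum.distrib)
qed

lemma ev_fsc:
  assumes "p \<in> free_alg n"
  shows "ev (fsc c p) = opsc \<phi> c (ev p)"
proof
  fix v
  have "finite {w. p w \<noteq> 0}" using assms by (simp add: free_alg_finite)
  then show "ev (fsc c p) v = opsc \<phi> c (ev p) v"
    by (subst ev_on[of "{w. p w \<noteq> 0}"]) (auto simp: fsc_def opsc_sc ev_def scale_sum_right)
qed

lemma ev_fone: "ev fone = id"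
proof
  fix v
  have "ev fone v = (\<Sum>w\<in>{[]}. fone w \<star> opw w v)"
    by (rule ev_on) (auto simp: fone_def)
  then show "ev fone v = id v" by (simp add: fone_def opw_def)
qed

lemma ev_fgen: "ev (fgen g) = opg g"
proof
  fix v
  have "ev (fgen g) v = (\<Sum>w\<in>{[g]}. fgen g w \<star> opw w v)"
    by (rule ev_on) (auto simp: fgen_def)
  then show "ev (fgen g) v = opg g v" by (simp add: fgen_def opw_def)
qed

text \<open>The sum over cuts becomes a double sum over pairs of words. The inner one is drawn
  through \<open>opw u\<close> by linearity, which rests on the letters of \<open>u\<close> having
  admissible indices.\<close>

lemma ev_fmul:
  assumes p: "p \<in> free_alg n" and r: "r \<in> free_alg n"
  shows "ev (fmul p r) = ev p \<circ> ev r"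
proof
  fix v
  let ?A = "{w. p w \<noteq> 0}" and ?B = "{w. r w \<noteq> 0}"
  let ?C = "(\<lambda>(u, v). u @ v) ` (?A \<times> ?B)"
  have fin: "finite ?A" "finite ?B" using assms by (auto simp: free_alg_finite)
  have "ev (fmul p r) v = (\<Sum>w\<in>?C. fmul p r w \<star> opw w v)"
    by (rule ev_on) (use fin fmul_supp in auto)
  also have "\<dots> = (\<Sum>w\<in>?C. \<Sum>k\<in>{0..length w}.
      (p (take k w) * r (drop k w)) \<star> opw (take k w) (opw (drop k w) v))"
    by (simp add: fmul_def scale_sum_left flip: opw_append)
  also have "\<dots> = (\<Sum>u\<in>?A. \<Sum>w\<in>?B. (p u * r w) \<star> opw u (opw w v))"
    by (rule fmul_sum_words[OF fin, where p = p and r = r]) auto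
  also have "\<dots> = (\<Sum>u\<in>?A. p u \<star> opw u (ev r v))"
  proof (rule sum.cong)
    fix u assume "u \<in> ?A"
    then have "lin (opw u)" using free_alg_gidx[OF p] by (intro lin_opw) auto
    then show "(\<Sum>w\<in>?B. (p u * r w) \<star> opw u (opw w v)) = p u \<star> opw u (ev r v)"
      by (simp add: ev_def lin_sum[of "opw u"] lin_scale[of "opw u"] scale_sum_right)
  qed simp
  finally show "ev (fmul p r) v = (ev p \<circ> ev r) v" by (simp add: ev_def)
qed

lemma ev_fpow:
  assumes "p \<in> free_alg n"
  shows "(fmul p ^^ t) fone \<in> free_alg n \<and> ev ((fmul p ^^ t) fone) = ((\<circ>) (ev p) ^^ t) id"
  using assms by (induction t) (simp_all add: fone_free fmul_free ev_fone ev_fmul)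

definition fserre :: "'k \<Rightarrow> nat \<Rightarrow> (gen list \<Rightarrow> 'k) \<Rightarrow> (gen list \<Rightarrow> 'k) \<Rightarrow> gen list \<Rightarrow> 'k" where
  "fserre Q r f g = foldr fadd (map (\<lambda>t. fsc ((-1) ^ t * qbinom Q r t)
     (fmul (fmul ((fmul f ^^ t) fone) g) ((fmul f ^^ (r - t)) fone))) [0..<r + 1]) (fsc 0 fone)"

lemma ev_fserre:
  assumes f: "f \<in> free_alg n" and g: "g \<in> free_alg n"
  shows "fserre Q r f g \<in> free_alg n \<and> ev (fserre Q r f g) = serre_op Q r (ev f) (ev g)"
proof -
  have foldr_Cons_apply: "foldr fadd (y # ys) z = fadd y (foldr fadd ys z)"
    for y and ys :: "(gen list \<Rightarrow> 'k) list" and z by simp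
  have foldr_Cons_apply': "foldr opadd (y # ys) z = opadd y (foldr opadd ys z)"
    for y and ys :: "('a \<Rightarrow> 'a) list" and z by simp
  have pw: "(fmul f ^^ t) fone \<in> free_alg n" "ev ((fmul f ^^ t) fone) = ((\<circ>) (ev f) ^^ t) id" for t
    using ev_fpow[OF f] by auto
  \<comment> \<open>Generalized to arbitrary coefficients and an arbitrary list, so that induction
    on the list applies.\<close>
  have "foldr fadd (map (\<lambda>t. fsc (c t) (fmul (fmul ((fmul f ^^ t) fone) g) ((fmul f ^^ (r - t)) fone))) ts)
      (fsc 0 fone) \<in> free_alg n \<and>
    ev (foldr fadd (map (\<lambda>t. fsc (c t) (fmul (fmul ((fmul f ^^ t) fone) g) ((fmul f ^^ (r - t)) fone))) ts)
      (fsc 0 fone)) = foldr opadd (map (\<lambda>t. opsc \<phi> (c t)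
     ((((\<circ>) (ev f) ^^ t) id \<circ> ev g) \<circ> ((\<circ>) (ev f) ^^ (r - t)) id)) ts) (opsc \<phi> 0 id)" for c ts
  proof (induction ts)
    case Nil
    show ?case by (simp add: ev_fsc ev_fone fone_free fsc_free id_def)
  next
    case (Cons t ts)
    then show ?case
      by (simp only: list.map foldr_Cons_apply foldr_Cons_apply' ev_fadd ev_fsc ev_fmul fadd_free fsc_free
          fmul_free g pw simp_thms)
  qed
  then show ?thesis unfolding fserre_def serre_op_def .
qed

lemma free_gens:
  assumes "i \<in> {1..n}"
  shows "fgen (GE i) \<in> free_alg n" "fgen (GF i) \<in> free_alg n" "fgen (GK i) \<in> free_alg n"
    "fgen (GKi i) \<in> free_alg n"
  using assms by (simp_all add: fgen_free)

lemma ev_rels: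
  assumes "(l, r) \<in> uq_rels n q fadd fmul fsc fone (\<lambda>i. fgen (GE i)) (\<lambda>i. fgen (GF i))
     (\<lambda>i. fgen (GK i)) (\<lambda>i. fgen (GKi i))"
  shows "l \<in> free_alg n \<and> r \<in> free_alg n \<and> ev l = ev r"
  using assms
proof (rule uq_rels_cases)
  fix Y i j
  assume Y: "Y = (\<lambda>i. fgen (GE i)) \<or> Y = (\<lambda>i. fgen (GF i) :: gen list \<Rightarrow> 'k)"
    and ij: "i \<in> {1..n}" "j \<in> {1..n}" "i \<noteq> j"
  let ?s = "fserre (qi q i) (nat (1 - cartan i j)) (Y i) (Y j)"
  have Yf: "Y i \<in> free_alg n" "Y j \<in> free_alg n" using Y free_gens ij by auto
  have "ev ?s = opsc \<phi> 0 id"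
    using Y ev_fserre[OF Yf] serre_op_e[OF ij] serre_op_f[OF ij] by (auto simp: ev_fgen)
  then have "?s \<in> free_alg n \<and> fsc 0 fone \<in> free_alg n \<and> ev ?s = ev (fsc 0 fone)"
    using ev_fserre[OF Yf] by (simp add: fsc_free fone_free ev_fsc ev_fone)
  then show "foldr fadd (map (\<lambda>t. fsc ((-1) ^ t * qbinom (qi q i) (nat (1 - cartan i j)) t)
      (fmul (fmul ((fmul (Y i) ^^ t) fone) (Y j)) ((fmul (Y i) ^^ (nat (1 - cartan i j) - t)) fone)))
      [0..<nat (1 - cartan i j) + 1]) (fsc 0 fone) \<in> free_alg n \<and> fsc 0 fone \<in> free_alg n \<and>
    ev (foldr fadd (map (\<lambda>t. fsc ((-1) ^ t * qbinom (qi q i) (nat (1 - cartan i j)) t)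
      (fmul (fmul ((fmul (Y i) ^^ t) fone) (Y j)) ((fmul (Y i) ^^ (nat (1 - cartan i j) - t)) fone)))
      [0..<nat (1 - cartan i j) + 1]) (fsc 0 fone)) = ev (fsc 0 fone)"
    unfolding fserre_def .
next
  fix i j assume "i \<in> {1..n}" "j \<in> {1..n}"
  note ij = this free_gens[OF this(1)] free_gens[OF this(2)]
  show "fadd (fmul (fgen (GE i)) (fgen (GF j))) (fsc (-1) (fmul (fgen (GF j)) (fgen (GE i)))) \<in> free_alg n \<and>
    (if i = j then fsc (inverse (qi q i - inverse (qi q i))) (fadd (fgen (GK i)) (fsc (-1) (fgen (GKi i))))
      else fsc 0 fone) \<in> free_alg n \<and>
    ev (fadd (fmul (fgen (GE i)) (fgen (GF j))) (fsc (-1) (fmul (fgen (GF j)) (fgen (GE i))))) =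
    ev (if i = j then fsc (inverse (qi q i - inverse (qi q i))) (fadd (fgen (GK i)) (fsc (-1) (fgen (GKi i))))
      else fsc 0 fone)"
    by (cases "i = j")
      (simp_all only: fadd_free fsc_free fmul_free fone_free ij ev_fadd ev_fsc ev_fmul ev_fone
        ev_fgen opg.simps e_f_comp if_True if_False simp_thms)
qed (simp_all only: fsc_free fmul_free fone_free free_gens ev_fsc ev_fmul ev_fone
    ev_fgen opg.simps k_commute k_kinv_comp k_e_comp k_f_comp simp_thms)

lemma ev_ideal: "p \<in> uq_ideal n q \<Longrightarrow> p \<in> free_alg n \<and> ev p = opsc \<phi> 0 id"
proof (induction rule: uq_ideal.induct)
  case (rel p)
  then obtain l r where lr: "p = fadd l (fsc (-1) r)" "l \<in> free_alg n" "r \<in> free_alg n" "ev l = ev r"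
    unfolding uq_relators_def using ev_rels by blast
  then show ?case by (auto simp: fadd_free fsc_free ev_fadd ev_fsc opadd_def opsc_sc)
next
  case zero
  show ?case by (auto simp: zero_free ev_def opsc_sc)
next
  case (add p r)
  then show ?case by (auto simp: fadd_free ev_fadd opadd_def opsc_sc)
next
  case (sc p c)
  then show ?case by (auto simp: fsc_free ev_fsc opsc_sc)
next
  case (lmul u p)
  \<comment> \<open>The operator \<open>ev p\<close> is zero, but composing with \<open>ev u\<close>
    on the left gives zero only because words act linearly.\<close>
  have "ev u 0 = 0"
    using lmul free_alg_gidx[OF lmul(1)] unfolding ev_def
    by (intro sum.neutral) (auto simp: lin_zero[OF lin_opw])
  then show ?case using lmul by (auto simp: fmul_free ev_fmul opsc_sc)
next
  case (rmul u p)
  then show ?case by (auto simp: fmul_free ev_fmul opsc_sc)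
qed

lemma ev_equiv:
  assumes "(p, r) \<in> uq_equiv n q"
  shows "ev p = ev r"
proof -
  from assms have "p \<in> free_alg n" "r \<in> free_alg n" "ev (fadd p (fsc (-1) r)) = opsc \<phi> 0 id"
    using ev_ideal by (auto simp: uq_equiv_def)
  then show ?thesis by (simp add: ev_fadd ev_fsc fsc_free fun_eq_iff opadd_def opsc_sc)
qed

text \<open>\<open>restrict\<close> fixes the values outside the carrier, so that the homomorphism
  can be unique as a function.\<close>

definition Psi :: "(gen list \<Rightarrow> 'k) set \<Rightarrow> 'a \<Rightarrow> 'a" where
  "Psi = restrict (\<lambda>X. ev (uq_rep X)) (Uq n q)"

lemma Psi_cls: "p \<in> free_alg n \<Longrightarrow> Psi (uq_cls n q p) = ev p"
  using ev_equiv[OF uq_rep_cls] by (simp add: Psi_def uq_cls_in)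

lemma uq_hom_Psi: "uq_hom n q \<phi> Psi"
proof -
  have 1: "Psi (uq_add n q X Y) = opadd (Psi X) (Psi Y) \<and> Psi (uq_mul n q X Y) = Psi X \<circ> Psi Y"
    if XY: "X \<in> Uq n q" "Y \<in> Uq n q" for X Y
  proof -
    obtain p where p: "p \<in> free_alg n" "X = uq_cls n q p" using XY(1) by (rule Uq_cases)
    obtain r where r: "r \<in> free_alg n" "Y = uq_cls n q r" using XY(2) by (rule Uq_cases)
    from p r show ?thesis
      by (simp add: uq_add_cls uq_mul_cls Psi_cls fadd_free fmul_free ev_fadd ev_fmul)
  qed
  have 2: "Psi (uq_sc n q c X) = opsc \<phi> c (Psi X)" if "X \<in> Uq n q" for c X
    using that by (rule Uq_cases) (simp add: uq_sc_cls Psi_cls fsc_free ev_fsc)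
  show ?thesis
    unfolding uq_hom_def using 1 2 by (simp add: uq_one_def Psi_cls fone_free ev_fone)
qed

lemma opg_Ug: "gidx g \<in> {1..n} \<Longrightarrow> opg g \<in> Ug n q \<phi> x"
  by (cases g) (auto intro: Ug.ge Ug.gf Ug.gk Ug.gki)

text \<open>Evaluation sends letters to generators and respects all operations, so each side
  contains what builds the other.\<close>

lemma Ug_eq: "Ug n q \<phi> x = ev ` free_alg n"
proof
  show "ev ` free_alg n \<subseteq> Ug n q \<phi> x"
  proof clarify
    fix p :: "gen list \<Rightarrow> 'k" assume "p \<in> free_alg n"
    then show "ev p \<in> Ug n q \<phi> x"
      by (induction rule: free_alg_induct)
        (simp_all only: ev_fone ev_fgen ev_fadd ev_fmul ev_fsc opg_Ug Ug.intros)
  qed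
  show "Ug n q \<phi> x \<subseteq> ev ` free_alg n"
  proof
    fix F assume "F \<in> Ug n q \<phi> x"
    then show "F \<in> ev ` free_alg n"
    proof (induction rule: Ug.induct)
      case (ge i)
      then show ?case using free_gens(1) ev_fgen[of "GE i"] by force
    next
      case (gf i)
      then show ?case using free_gens(2) ev_fgen[of "GF i"] by force
    next
      case (gk i)
      then show ?case using free_gens(3) ev_fgen[of "GK i"] by force
    next
      case (gki i)
      then show ?case using free_gens(4) ev_fgen[of "GKi i"] by force
    next
      case one
      then show ?case using fone_free ev_fone by (metis image_eqI)
    next
      case (add f g)
      then show ?case using ev_fadd fadd_free by (smt (verit) image_iff)
    next
      case (mul f g)
      then show ?case using ev_fmul fmul_free by (smt (verit) image_iff)
    next
      case (sc f c)
      then show ?case using ev_fsc fsc_free by (smt (verit) image_iff)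
    qed
  qed
qed

lemma Psi_image: "Psi ` Uq n q = Ug n q \<phi> x"
proof -
  have "Uq n q = uq_cls n q ` free_alg n"
    using uq_cls_in by (auto elim: Uq_cases)
  then show ?thesis unfolding Ug_eq by (auto simp: Psi_cls image_image)
qed

text \<open>A homomorphism on classes agrees with \<open>ev\<close> on the letters, and by induction
  on the free algebra everywhere.\<close>

lemma Psi_unique:
  assumes "Psi' \<in> extensional (Uq n q)" and hom: "uq_hom n q \<phi> Psi'"
    and gens: "\<forall>i\<in>{1..n}. Psi' (uq_cls n q (fgen (GE i))) = eo i
      \<and> Psi' (uq_cls n q (fgen (GF i))) = fo i \<and> Psi' (uq_cls n q (fgen (GK i))) = ko i
      \<and> Psi' (uq_cls n q (fgen (GKi i))) = kio i"
  shows "Psi' = Psi"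
proof (rule extensionalityI[OF assms(1)])
  show "Psi \<in> extensional (Uq n q)" by (simp add: Psi_def)
  fix X assume "X \<in> Uq n q"
  then obtain p where p: "p \<in> free_alg n" "X = uq_cls n q p" by (rule Uq_cases)
  from p(1) have "Psi' (uq_cls n q p) = ev p"
  proof (induction rule: free_alg_induct)
    case one
    show ?case using hom by (simp add: uq_hom_def uq_one_def ev_fone)
  next
    case (gen g)
    then show ?case using gens by (cases g) (simp_all add: ev_fgen)
  next
    case (add p r)
    then show ?case using hom uq_cls_in[OF add(1)] uq_cls_in[OF add(2)]
      by (simp add: uq_hom_def ev_fadd flip: uq_add_cls)
  next
    case (mul p r)
    then show ?case using hom uq_cls_in[OF mul(1)] uq_cls_in[OF mul(2)]
      by (simp add: uq_hom_def ev_fmul flip: uq_mul_cls)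
  next
    case (scale c p)
    then show ?case using hom uq_cls_in[OF scale(1)]
      by (simp add: uq_hom_def ev_fsc flip: uq_sc_cls)
  qed
  then show "Psi' X = Psi X" using p by (simp add: Psi_cls)
qed

end

theorem theorem3p6:
  fixes n :: nat and q :: "'k::field_char_0" and \<phi> :: "'k \<Rightarrow> 'a::ring_1" and x :: "int \<Rightarrow> 'a"
  assumes n2: "n \<ge> 2"
    and q0: "q \<noteq> 0"
    and q_not_root: "\<forall>m::nat. m > 0 \<longrightarrow> q ^ m \<noteq> 1"
    and phi_add: "\<forall>a b. \<phi> (a + b) = \<phi> a + \<phi> b"
    and phi_mult: "\<forall>a b. \<phi> (a * b) = \<phi> a * \<phi> b"
    and phi_one: "\<phi> 1 = 1"
    and phi_central: "\<forall>c v. \<phi> c * v = v * \<phi> c"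
    and rel1: "\<forall>i\<in>Iset n. \<forall>j\<in>Iset n. i < j \<and> j \<noteq> - i \<longrightarrow> x j * x i = \<phi> q * x i * x j"
    and rel2: "\<forall>i\<in>{1..int n}. x i * x (- i) =
                 \<phi> (q ^ 2) * x (- i) * x i + \<phi> (q ^ 2 * (q - inverse q)) * Omega n q \<phi> x (i + 1)"
    and basis: "normal_basis n \<phi> x"
  shows "(\<forall>(l, r) \<in> uq_rels n q opadd (\<circ>) (opsc \<phi>) id
                  (e_op n q \<phi> x) (f_op n q \<phi> x) (k_op n q \<phi> x) (kinv_op n q \<phi> x). l = r)
       \<and> (\<exists>!\<Psi>. \<Psi> \<in> extensional (Uq n q)
              \<and> uq_hom n q \<phi> \<Psi>
              \<and> (\<forall>i\<in>{1..n}. \<Psi> (uq_cls n q (fgen (GE i))) = e_op n q \<phi> x i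
                           \<and> \<Psi> (uq_cls n q (fgen (GF i))) = f_op n q \<phi> x i
                           \<and> \<Psi> (uq_cls n q (fgen (GK i))) = k_op n q \<phi> x i
                           \<and> \<Psi> (uq_cls n q (fgen (GKi i))) = kinv_op n q \<phi> x i)
              \<and> \<Psi> ` Uq n q = Ug n q \<phi> x)"
proof -
  interpret quantum_symplectic n q \<phi> x
    by unfold_locales (fact assms)+
  have gens: "\<forall>i\<in>{1..n}. Psi (uq_cls n q (fgen (GE i))) = e_op n q \<phi> x i
      \<and> Psi (uq_cls n q (fgen (GF i))) = f_op n q \<phi> x i
      \<and> Psi (uq_cls n q (fgen (GK i))) = k_op n q \<phi> x i
      \<and> Psi (uq_cls n q (fgen (GKi i))) = kinv_op n q \<phi> x i"
    by (simp add: Psi_cls free_gens ev_fgen)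
  show ?thesis
  proof (intro conjI ex1I[of _ Psi])
    show "\<forall>(l, r)\<in>uq_rels n q opadd (\<circ>) (opsc \<phi>) id
        (e_op n q \<phi> x) (f_op n q \<phi> x) (k_op n q \<phi> x) (kinv_op n q \<phi> x). l = r"
      using uq_rels_operators by blast
    show "Psi \<in> extensional (Uq n q)" by (simp add: Psi_def)
    show "uq_hom n q \<phi> Psi" by (rule uq_hom_Psi)
    show "Psi ` Uq n q = Ug n q \<phi> x" by (rule Psi_image)
    fix Psi'
    assume "Psi' \<in> extensional (Uq n q) \<and> uq_hom n q \<phi> Psi'
      \<and> (\<forall>i\<in>{1..n}. Psi' (uq_cls n q (fgen (GE i))) = e_op n q \<phi> x i
        \<and> Psi' (uq_cls n q (fgen (GF i))) = f_op n q \<phi> x i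
        \<and> Psi' (uq_cls n q (fgen (GK i))) = k_op n q \<phi> x i
        \<and> Psi' (uq_cls n q (fgen (GKi i))) = kinv_op n q \<phi> x i)
      \<and> Psi' ` Uq n q = Ug n q \<phi> x"
    then show "Psi' = Psi" by (elim conjE) (rule Psi_unique)
  qed (rule gens)
qed

end
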